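(* There exist universal positive constants $c_1,c_3,c_4,c_5$ such that the following holds. Let $M^*=F^*(F^* )^\top\in\mathbb R^{d\times d}$ be positive semidefinite of rank $r$ with all $r$ nonzero eigenvalues equal, with incoherence parameter $\mu$. Suppose noisy entries of $M^*$ are observed according to the symmetric Bernoulli model with observation probability $p$ and noise matrix $E$. Suppose the expected sample size $n=pd^2$ satisfies $$n=pd^2\ge c_1\max\{\mu r d\log d,\ \mu^2r^2d\}$$ and is large enough to ensure that $$\varepsilon_n:=100\,\frac{\sqrt r\,\|\Pi_\Omega(E)\|_{op}}{p\,\|F^*\|_{op}}\le\frac1{10}\|F^*\|_{op}.$$ If we are given an initial matrix $F^0\in\mathbb R^{d\times r}$ satisfying $d(F^0,F^* )\le\frac15\|F^*\|_{op}$, then with probability at least $1-4d^{-3}$, the projected gradient iterates $$F^{t+1}=\Pi_{\mathcal F}\big(F^t-\eta^t\nabla\tilde{\mathcal L}_n(F^t)\big)$$ with step size $\eta^t=c_3\dfrac{1}{\mu^2r^2\|F^*\|_{op}^2}$ satisfy, for all $t=1,2,\dots$, $$d^2(F^t,F^* )\le\Big(1-c_4\frac{1}{\mu^2r^2}\Big)^td^2(F^0,F^* )+c_5\frac{r\,\|\Pi_\Omega(E)\|_{op}^2}{p^2\|F^*\|_{op}^2}.$$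
   Context: Observation model: for each pair $i\ge j$, independently, the entry is observed with probability $p$, in which case $Y_{ij}=M^*_{ij}+E_{ij}$, where the $E_{ij}$ are measurement noise; $Y$, $E$ and the set $\Omega$ of observed positions are symmetric. $\Pi_\Omega(Z)$ is the matrix agreeing with $Z$ on entries in $\Omega$ and zero elsewhere. Loss and constraint set: $\tilde{\mathcal L}_n(F)=\frac1{2p}\sum_{(i,j)\in\Omega}\big((FF^\top)_{ij}-Y_{ij}\big)^2$ and $\mathcal F=\{F\in\mathbb R^{d\times r}:\|F\|_{2,\infty}\le\sqrt{2\mu/d}\,\|F^0\|_F\}$ (depending on the initial matrix $F^0$). $\Pi_{\mathcal F}$ is Euclidean (Frobenius) projection onto $\mathcal F$. $\|\cdot\|_F$ is the Frobenius norm, $\|\cdot\|_{op}$ the spectral norm, and $\|Z\|_{2,\infty}=\max_i\|Z_{i\cdot}\|_2$ (largest Euclidean row norm). $F^*\in\mathbb R^{d\times r}$ has orthogonal columns with $F^*(F^* )^\top=M^*$ (e.g. $F^*=UD^{1/2}$ from the eigendecomposition $M^*=UDU^\top$). Incoherence parameter: $\mu=\dfrac{d\,\|F^*\|_{2,\infty}^2}{r\,\|F^*\|_{op}^2}$. $\mathcal E(M^* )=\{A\in\mathbb R^{d\times r}:AA^\top=M^*,\ A_{\cdot i}^\top A_{\cdot j}=0\ \forall i\neq j\}$ and $d(F,F^* )=\min_{A\in\mathcal E(M^* )}\|F-A\|_F$. *)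

theory Defs
  imports
    "HOL-Probability.Probability"
    "Jordan_Normal_Form.Matrix"
    "Jordan_Normal_Form.Char_Poly"
    "Jordan_Normal_Form.DL_Rank"
begin

text \<open>
  Matrices are those of \<^theory>\<open>Jordan_Normal_Form.Matrix\<close>, whose dimensions are natural numbers.
  Type-indexed matrices would not do: constants that are universal in the dimensions have to be
  quantified outside the dimensions. Indices are zero-based.
\<close>

definition l2_norm :: "real vec \<Rightarrow> real" where
  "l2_norm v = sqrt (scalar_prod v v)"

definition frob_norm :: "real mat \<Rightarrow> real" where
  "frob_norm A = sqrt (\<Sum>i<dim_row A. \<Sum>j<dim_col A. (A $$ (i, j))\<^sup>2)"

definition op_norm :: "real mat \<Rightarrow> real" where
  "op_norm A = (SUP v\<in>{v \<in> carrier_vec (dim_col A). l2_norm v \<le> 1}. l2_norm (A *\<^sub>v v))"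

text \<open>Only meaningful for matrices with at least one row.\<close>

definition two_inf_norm :: "real mat \<Rightarrow> real" where
  "two_inf_norm A = Max ((\<lambda>i. l2_norm (Matrix.row A i)) ` {..<dim_row A})"

definition pos_semidef :: "nat \<Rightarrow> real mat \<Rightarrow> bool" where
  "pos_semidef d M \<longleftrightarrow> M \<in> carrier_mat d d \<and> transpose_mat M = M \<and>
     (\<forall>v\<in>carrier_vec d. 0 \<le> scalar_prod v (M *\<^sub>v v))"

definition incoherence :: "real mat \<Rightarrow> real" where
  "incoherence F =
     real (dim_row F) * (two_inf_norm F)\<^sup>2 / (real (dim_col F) * (op_norm F)\<^sup>2)"

definition factor_set :: "nat \<Rightarrow> nat \<Rightarrow> real mat \<Rightarrow> real mat set" where
  "factor_set d r M = {A \<in> carrier_mat d r. A * transpose_mat A = M \<and>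
     (\<forall>i<r. \<forall>j<r. i \<noteq> j \<longrightarrow> scalar_prod (col A i) (col A j) = 0)}"

text \<open>
  The distance of \<open>F\<close> to \<open>factor_set d r M\<close>; this set is compact, so that the infimum is a minimum
  whenever it is nonempty.
\<close>

definition factor_dist :: "nat \<Rightarrow> nat \<Rightarrow> real mat \<Rightarrow> real mat \<Rightarrow> real" where
  "factor_dist d r M F = (INF A\<in>factor_set d r M. frob_norm (F - A))"

definition obs_proj :: "(nat \<times> nat) set \<Rightarrow> real mat \<Rightarrow> real mat" where
  "obs_proj \<Omega> Z = Matrix.mat (dim_row Z) (dim_col Z) (\<lambda>ij. if ij \<in> \<Omega> then Z $$ ij else 0)"

text \<open>
  \<open>P\<close> is the joint law of the pair (observed positions, noise matrix). Using this fixed outcome type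
  instead of an arbitrary sample space keeps constants from depending on the type of the sample
  space. Nothing is required of the noise beyond symmetry and measurability; deterministic noise and
  noise independent of the positions are special cases.
\<close>

locale symmetric_bernoulli_model = prob_space P
  for P :: "((nat \<times> nat) set \<times> real mat) measure" +
  fixes d :: nat and p :: real
  assumes positions: "\<And>\<Omega> E. (\<Omega>, E) \<in> space P \<Longrightarrow> \<Omega> \<subseteq> {..<d} \<times> {..<d} \<and> sym \<Omega>"
    and noise: "\<And>\<Omega> E. (\<Omega>, E) \<in> space P \<Longrightarrow> E \<in> carrier_mat d d \<and> transpose_mat E = E"
    and noise_measurable:
      "\<And>i j. i < d \<Longrightarrow> j < d \<Longrightarrow> (\<lambda>\<omega>. snd \<omega> $$ (i, j)) \<in> borel_measurable P"
    and observed_indep: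
      "indep_events (\<lambda>ij. {\<omega> \<in> space P. ij \<in> fst \<omega>}) {(i, j). j \<le> i \<and> i < d}"
    and observed_prob:
      "\<And>i j. j \<le> i \<Longrightarrow> i < d \<Longrightarrow> prob {\<omega> \<in> space P. (i, j) \<in> fst \<omega>} = p"

text \<open>The sum runs over ordered pairs.\<close>

definition loss :: "real \<Rightarrow> (nat \<times> nat) set \<Rightarrow> real mat \<Rightarrow> real mat \<Rightarrow> real" where
  "loss p \<Omega> Y F =
     1 / (2 * p) * (\<Sum>ij\<in>\<Omega>. ((F * transpose_mat F) $$ ij - Y $$ ij)\<^sup>2)"

text \<open>The matrix of partial derivatives of \<open>L\<close> at \<open>F\<close>.\<close>

definition gradient :: "(real mat \<Rightarrow> real) \<Rightarrow> real mat \<Rightarrow> real mat" where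
  "gradient L F = Matrix.mat (dim_row F) (dim_col F) (\<lambda>ij.
     deriv (\<lambda>x. L (Matrix.mat (dim_row F) (dim_col F) (\<lambda>kl. if kl = ij then x else F $$ kl)))
       (F $$ ij))"

definition feasible_set :: "nat \<Rightarrow> nat \<Rightarrow> real \<Rightarrow> real mat \<Rightarrow> real mat set" where
  "feasible_set d r \<mu> F0 =
     {F \<in> carrier_mat d r. two_inf_norm F \<le> sqrt (2 * \<mu> / real d) * frob_norm F0}"

text \<open>Well defined on nonempty closed convex sets, where the minimizer exists and is unique.\<close>

definition frob_proj :: "real mat set \<Rightarrow> real mat \<Rightarrow> real mat" where
  "frob_proj S Z = arg_min_on (\<lambda>X. frob_norm (Z - X)) S"

fun pgd :: "real mat set \<Rightarrow> (real mat \<Rightarrow> real) \<Rightarrow> real \<Rightarrow> real mat \<Rightarrow> nat \<Rightarrow> real mat" where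
  "pgd S L \<eta> F0 0 = F0"
| "pgd S L \<eta> F0 (Suc t) =
     frob_proj S (pgd S L \<eta> F0 t - \<eta> \<cdot>\<^sub>m gradient L (pgd S L \<eta> F0 t))"

end

theory Submission
  imports Defs
begin

text \<open>
  All nonzero eigenvalues of \<open>M\<close> equal some \<open>\<sigma>\<^sup>2\<close>, so every factor \<open>A\<close> has \<open>A\<^sup>T A = \<sigma>\<^sup>2 I\<close>. Let \<open>A\<close> be the
  factor nearest to the iterate \<open>F\<close> and \<open>H = F - A\<close>; optimality of \<open>A\<close> makes \<open>A\<^sup>T H\<close> symmetric, whence
  \<open>X = A H\<^sup>T + H A\<^sup>T\<close> satisfies \<open>\<parallel>X\<parallel>\<^sup>2 \<ge> 2 \<sigma>\<^sup>2 \<parallel>H\<parallel>\<^sup>2\<close>. With \<open>Z = H H\<^sup>T\<close>, the noiseless gradient \<open>G\<close> satisfies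
  \<open>p \<langle>G, H\<rangle> = \<langle>X + Z, X + 2 Z\<rangle>\<^sub>\<Omega> \<ge> \<parallel>X\<parallel>\<^sub>\<Omega>\<^sup>2 / 2 - 5 \<parallel>Z\<parallel>\<^sub>\<Omega>\<^sup>2 / 2\<close>, while bounded degrees of \<open>\<Omega>\<close> give
  \<open>\<parallel>G\<parallel> \<le> C \<mu> r \<sigma>\<^sup>2 \<parallel>H\<parallel>\<close>; this yields the linear contraction for steps of order \<open>1 / (\<mu> r \<sigma>)\<^sup>2\<close>.

  Three properties of \<open>\<Omega>\<close> are needed, which hold with high probability: bounded degrees,
  \<open>\<parallel>X\<parallel>\<^sub>\<Omega>\<^sup>2 \<ge> p (\<parallel>X\<parallel>\<^sup>2 - \<sigma>\<^sup>2 \<parallel>H\<parallel>\<^sup>2 / 2)\<close> uniformly in \<open>H\<close>, and an upper bound for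
  \<open>\<parallel>Z\<parallel>\<^sub>\<Omega>\<^sup>2 \<le> \<Sum>\<^sub>\<Omega> \<parallel>H\<^sub>i\<parallel>\<^sup>2 \<parallel>H\<^sub>j\<parallel>\<^sup>2\<close> for \<open>H\<close> with short rows. The last one reduces to counting edges between pairs
  of vertex sets, by a union bound. The middle one is a matrix Chernoff bound for rank-one summands, obtained
  from the moments \<open>tr (\<Sum> (\<delta>\<^sub>e - p) v\<^sub>e v\<^sub>e\<^sup>T)\<^sup>2\<^sup>q\<close>: conditioning on all but one selector \<open>\<delta>\<^sub>e\<close> and telescoping
  bounds each of them by the preceding one.
\<close>

section \<open>Bernoulli random subsets of a finite set\<close>

text \<open>The initial matrix is quantified inside the event, so it may depend on the sample, and
  the nearest factor changes with every iterate. Hence the properties of \<Omega> are uniform in the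
  deviation. They are established for one factor only: any other is its image under an orthogonal
  matrix, which can be moved onto the deviation. The noise is arbitrary, so no probability is spent
  on it: it perturbs each gradient by a matrix whose Frobenius norm is controlled through an
  operator norm. The bound on |X|^2 comes from its cross term 2 tr (C C) with C = A^T H, which is 2
  |C|^2 for symmetric C. The size of the step is a balance: a step \<eta> gains about \<eta>
  \<sigma>^2 |H|^2 and loses \<eta>^2 |G|^2, which is of order \<eta>^2 (\<mu> r \<sigma>^2)^2
  |H|^2. The bounds on G and Z require short rows, whereas the initial matrix is not projected. A
  truncated iterate is therefore analysed in place of the true one, and the error made on long rows
  is paid for by the large decrease that the projection causes there.\<close>

definition subset_weight :: "'a set \<Rightarrow> real \<Rightarrow> 'a set \<Rightarrow> real" where
  "subset_weight E p T = p ^ card T * (1 - p) ^ card (E - T)"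

text \<open>A finite sum over the power set rather than an integral: predicates of the selected set
  that quantify over all deviations then raise no question of measurability.
  \<open>lower_part_prob\<close> carries the outcome over to \<open>P\<close>.\<close>

definition subset_expectation :: "'a set \<Rightarrow> real \<Rightarrow> ('a set \<Rightarrow> real) \<Rightarrow> real" where
  "subset_expectation E p f = (\<Sum>T\<in>Pow E. subset_weight E p T * f T)"

definition subset_prob :: "'a set \<Rightarrow> real \<Rightarrow> ('a set \<Rightarrow> bool) \<Rightarrow> real" where
  "subset_prob E p Q = subset_expectation E p (\<lambda>T. if Q T then 1 else 0)"

lemma subset_weight_nonneg: "0 \<le> p \<Longrightarrow> p \<le> 1 \<Longrightarrow> 0 \<le> subset_weight E p T"
  by (simp add: subset_weight_def)

lemma subset_weight_eq_prod:
  assumes "finite E" "T \<subseteq> E"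
  shows "subset_weight E p T = (\<Prod>e\<in>T. p) * (\<Prod>e\<in>E - T. 1 - p)"
  by (simp add: subset_weight_def)

lemma subset_expectation_mono:
  assumes "0 \<le> p" "p \<le> 1" "\<And>T. T \<subseteq> E \<Longrightarrow> f T \<le> g T"
  shows "subset_expectation E p f \<le> subset_expectation E p g"
  unfolding subset_expectation_def
  by (intro sum_mono mult_left_mono) (use assms subset_weight_nonneg in auto)

lemma subset_expectation_cong:
  assumes "\<And>T. T \<subseteq> E \<Longrightarrow> f T = g T"
  shows "subset_expectation E p f = subset_expectation E p g"
  unfolding subset_expectation_def by (intro sum.cong) (use assms in auto)

lemma subset_expectation_add:
  "subset_expectation E p (\<lambda>T. f T + g T) = subset_expectation E p f + subset_expectation E p g"
  by (simp add: subset_expectation_def distrib_left sum.distrib)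

lemma subset_expectation_cmult:
  "subset_expectation E p (\<lambda>T. c * f T) = c * subset_expectation E p f"
  by (simp add: subset_expectation_def sum_distrib_left mult_ac)

lemma subset_expectation_sum:
  "subset_expectation E p (\<lambda>T. \<Sum>x\<in>A. f x T) = (\<Sum>x\<in>A. subset_expectation E p (f x))"
  unfolding subset_expectation_def sum_distrib_left by (rule sum.swap)

text \<open>Conditioning on all selectors but that of \<open>e\<close>; in this form independence
  enters the moment recursion.\<close>

lemma subset_expectation_split:
  assumes "finite E" "e \<in> E"
  shows "subset_expectation E p f
    = subset_expectation (E - {e}) p (\<lambda>T. p * f (insert e T) + (1 - p) * f T)"
proof -
  define D where "D = E - {e}"
  have D: "finite D" "e \<notin> D" "E = insert e D" using assms by (auto simp: D_def)
  have "subset_expectation E p f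
      = (\<Sum>T\<in>Pow D. subset_weight E p T * f T) + (\<Sum>T\<in>insert e ` Pow D. subset_weight E p T * f T)"
    unfolding subset_expectation_def D(3) Pow_insert
    by (rule sum.union_disjoint) (use D in auto)
  also have "(\<Sum>T\<in>insert e ` Pow D. subset_weight E p T * f T)
      = (\<Sum>T\<in>Pow D. subset_weight E p (insert e T) * f (insert e T))"
    by (rule sum.reindex_cong[of "insert e"]) (use D in \<open>auto simp: inj_on_def\<close>)
  also have "\<dots> = (\<Sum>T\<in>Pow D. p * subset_weight D p T * f (insert e T))"
  proof (rule sum.cong[OF refl])
    fix T assume T: "T \<in> Pow D"
    then have "finite T" "e \<notin> T" "E - insert e T = D - T" using D by (auto intro: finite_subset)
    then show "subset_weight E p (insert e T) * f (insert e T) = p * subset_weight D p T * f (insert e T)"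
      by (simp add: subset_weight_def)
  qed
  also have "(\<Sum>T\<in>Pow D. subset_weight E p T * f T)
      = (\<Sum>T\<in>Pow D. (1 - p) * subset_weight D p T * f T)"
  proof (rule sum.cong[OF refl])
    fix T assume T: "T \<in> Pow D"
    then have "E - T = insert e (D - T)" "e \<notin> D - T" "finite (D - T)" using D by auto
    then show "subset_weight E p T * f T = (1 - p) * subset_weight D p T * f T"
      by (simp add: subset_weight_def)
  qed
  finally show ?thesis
    unfolding subset_expectation_def D_def[symmetric]
    by (simp add: sum.distrib[symmetric] algebra_simps)
qed

text \<open>Expanding the product of the factors p g e + (1 - p) gives one term for each subset,
  with its weight. This is independence in the form needed for exponential moments.\<close>

lemma subset_expectation_prod:
  assumes "finite E"
  shows "subset_expectation E p (\<lambda>T. \<Prod>e\<in>T. g e) = (\<Prod>e\<in>E. 1 + p * (g e - 1))"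
proof -
  have "(\<Prod>e\<in>E. 1 + p * (g e - 1)) = (\<Prod>e\<in>E. p * g e + (1 - p))"
    by (intro prod.cong) (auto simp: algebra_simps)
  also have "\<dots> = (\<Sum>T\<in>Pow E. (\<Prod>e\<in>T. p * g e) * (\<Prod>e\<in>E - T. 1 - p))"
    by (rule prod_add[OF assms])
  also have "\<dots> = subset_expectation E p (\<lambda>T. \<Prod>e\<in>T. g e)"
    unfolding subset_expectation_def
    by (intro sum.cong) (auto simp: subset_weight_eq_prod[OF assms] prod.distrib mult_ac subset_weight_def)
  finally show ?thesis by simp
qed

lemma subset_expectation_one: "finite E \<Longrightarrow> subset_expectation E p (\<lambda>_. 1) = 1"
  using subset_expectation_prod[of E p "\<lambda>_. 1"] by simp

lemma subset_prob_markov: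
  assumes "0 \<le> p" "p \<le> 1" "0 < t"
    and "\<And>T. T \<subseteq> E \<Longrightarrow> 0 \<le> f T" "\<And>T. T \<subseteq> E \<Longrightarrow> Q T \<Longrightarrow> t \<le> f T"
  shows "subset_prob E p Q \<le> subset_expectation E p f / t"
proof -
  have "subset_prob E p Q \<le> subset_expectation E p (\<lambda>T. (1 / t) * f T)"
    unfolding subset_prob_def by (rule subset_expectation_mono) (use assms in \<open>auto simp: field_simps\<close>)
  then show ?thesis by (simp only: subset_expectation_cmult) simp
qed

lemma subset_prob_mono:
  assumes "0 \<le> p" "p \<le> 1" "\<And>T. T \<subseteq> E \<Longrightarrow> Q T \<Longrightarrow> R T"
  shows "subset_prob E p Q \<le> subset_prob E p R"
  unfolding subset_prob_def by (rule subset_expectation_mono) (use assms in auto)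

lemma subset_prob_disj:
  assumes "0 \<le> p" "p \<le> 1"
  shows "subset_prob E p (\<lambda>T. Q T \<or> R T) \<le> subset_prob E p Q + subset_prob E p R"
  unfolding subset_prob_def subset_expectation_add[symmetric]
  by (rule subset_expectation_mono) (use assms in auto)

lemma subset_prob_bex:
  assumes "0 \<le> p" "p \<le> 1" "finite A"
  shows "subset_prob E p (\<lambda>T. \<exists>x\<in>A. Q x T) \<le> (\<Sum>x\<in>A. subset_prob E p (Q x))"
  unfolding subset_prob_def subset_expectation_sum[symmetric]
proof (rule subset_expectation_mono[OF assms(1,2)])
  fix T
  show "(if \<exists>x\<in>A. Q x T then 1 else 0) \<le> (\<Sum>x\<in>A. if Q x T then 1 else (0::real))"
  proof (cases "\<exists>x\<in>A. Q x T")
    case True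
    then obtain x where x: "x \<in> A" "Q x T" by blast
    have "(if Q x T then 1 else (0::real)) \<le> (\<Sum>x\<in>A. if Q x T then 1 else 0)"
      by (rule member_le_sum) (use x assms in auto)
    then show ?thesis using x by auto
  qed (auto intro: sum_nonneg)
qed

lemma subset_prob_not:
  assumes "finite E"
  shows "subset_prob E p (\<lambda>T. \<not> Q T) = 1 - subset_prob E p Q"
proof -
  have "subset_prob E p (\<lambda>T. \<not> Q T) + subset_prob E p Q = subset_expectation E p (\<lambda>_. 1)"
    unfolding subset_prob_def subset_expectation_add[symmetric]
    by (rule subset_expectation_cong) auto
  then show ?thesis using subset_expectation_one[OF assms] by simp
qed

text \<open>The chord of the convex exponential over [0, 1/2], with exp (1/2) bounded by 7/4.
  Weights range up to 2 because an off-diagonal position is counted twice. The slope 3/8 is 3/2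
  times the rate 1/4, whence the factor 3/2 in the Chernoff bounds.\<close>

lemma exp_quarter_le:
  assumes "0 \<le> w" "w \<le> (2::real)"
  shows "exp (w / 4) \<le> 1 + 3/8 * w"
proof -
  have *: "exp ((1 - w/2) * 0 + (w/2) * (1/2)) \<le> (1 - w/2) * exp 0 + (w/2) * exp (1/2::real)"
    using convex_onD[OF exp_convex, of "w/2" 0 "1/2"] assms by simp
  have "exp (1/2::real) \<le> 7/4" 
  proof -
    have "exp (1/2::real) ^ 2 = exp 1" by (simp add: exp_double[symmetric])
    also have "\<dots> \<le> 3" using e_less_272 by simp
    also have "\<dots> \<le> (7/4)^2" by (simp add: power2_eq_square)
    finally show ?thesis by (rule power2_le_imp_le) auto
  qed
  then have "(w/2) * exp (1/2::real) \<le> (w/2) * (7/4)" using assms by (intro mult_left_mono) auto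
  then show ?thesis using * by simp
qed

lemma subset_expectation_exp_sum:
  assumes "finite E" "0 \<le> p" "\<And>e. e \<in> E \<Longrightarrow> 0 \<le> w e \<and> w e \<le> 2"
  shows "subset_expectation E p (\<lambda>T. exp ((\<Sum>e\<in>T. w e) / 4)) \<le> exp (3/2 * p * (\<Sum>e\<in>E. w e) / 4)"
proof -
  have "subset_expectation E p (\<lambda>T. exp ((\<Sum>e\<in>T. w e) / 4))
      = subset_expectation E p (\<lambda>T. \<Prod>e\<in>T. exp (w e / 4))"
    by (intro subset_expectation_cong)
      (auto simp: sum_divide_distrib exp_sum finite_subset[OF _ assms(1)])
  also have "\<dots> = (\<Prod>e\<in>E. 1 + p * (exp (w e / 4) - 1))"
    by (rule subset_expectation_prod[OF assms(1)])
  also have "\<dots> \<le> (\<Prod>e\<in>E. exp (p * (3/8 * w e)))"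
  proof (rule prod_mono)
    fix e assume e: "e \<in> E"
    have "p * (exp (w e / 4) - 1) \<le> p * (3/8 * w e)"
      using exp_quarter_le[of "w e"] assms e by (intro mult_left_mono) auto
    moreover have "0 \<le> p * (exp (w e / 4) - 1)" using assms e by auto
    moreover have "1 + p * (3/8 * w e) \<le> exp (p * (3/8 * w e))" by simp
    ultimately show "0 \<le> 1 + p * (exp (w e / 4) - 1) \<and> 1 + p * (exp (w e / 4) - 1) \<le> exp (p * (3/8 * w e))"
      by linarith
  qed
  also have "\<dots> = exp (3/2 * p * (\<Sum>e\<in>E. w e) / 4)"
    by (simp add: exp_sum[OF assms(1), symmetric] sum_distrib_left sum_divide_distrib sum_distrib_right mult_ac)
  finally show ?thesis .
qed

section \<open>Random sums of rank-one operators\<close>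

text \<open>Vectors are functions on any index type, so that rows (over \<open>{..<r}\<close>) and
  whole matrices (over \<open>{..<d} \<times> {..<r}\<close>) share one inner product.\<close>

definition ip :: "'i set \<Rightarrow> ('i \<Rightarrow> real) \<Rightarrow> ('i \<Rightarrow> real) \<Rightarrow> real" where
  "ip I u v = (\<Sum>i\<in>I. u i * v i)"

lemma ip_commute: "ip I u v = ip I v u"
  by (simp add: ip_def mult.commute)

lemma ip_add_left: "ip I (\<lambda>i. u i + v i) w = ip I u w + ip I v w"
  by (simp add: ip_def distrib_right sum.distrib)

lemma ip_add_right: "ip I w (\<lambda>i. u i + v i) = ip I w u + ip I w v"
  by (simp add: ip_def distrib_left sum.distrib)

lemma ip_scale_left: "ip I (\<lambda>i. c * u i) w = c * ip I u w"
  by (simp add: ip_def sum_distrib_left mult_ac)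

lemma ip_scale_right: "ip I w (\<lambda>i. c * u i) = c * ip I w u"
  by (simp add: ip_def sum_distrib_left mult_ac)

lemma ip_minus_left: "ip I (\<lambda>i. u i - v i) w = ip I u w - ip I v w"
  by (simp add: ip_def left_diff_distrib sum_subtractf)

lemma ip_minus_right: "ip I w (\<lambda>i. u i - v i) = ip I w u - ip I w v"
  by (simp add: ip_def right_diff_distrib sum_subtractf)

lemma ip_sum_left: "ip I (\<lambda>i. \<Sum>x\<in>X. f x i) w = (\<Sum>x\<in>X. ip I (f x) w)"
  unfolding ip_def sum_distrib_right by (rule sum.swap)

lemma ip_sum_right: "ip I w (\<lambda>i. \<Sum>x\<in>X. f x i) = (\<Sum>x\<in>X. ip I w (f x))"
  unfolding ip_def sum_distrib_left by (rule sum.swap)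

lemma ip_self_nonneg: "0 \<le> ip I u u"
  by (auto simp: ip_def intro: sum_nonneg)

lemma ip_Cauchy_Schwarz: "(ip I u v)\<^sup>2 \<le> ip I u u * ip I v v"
  using Cauchy_Schwarz_ineq_sum[of u v I] by (simp add: ip_def power2_eq_square)

lemma ip_Young: "2 * ip I u v \<le> c * ip I u u + ip I v v / c" if "0 < c"
proof -
  have "0 \<le> ip I (\<lambda>i. c * u i - v i) (\<lambda>i. c * u i - v i)" by (rule ip_self_nonneg)
  then have "0 \<le> c * (c * ip I u u) - 2 * (c * ip I u v) + ip I v v"
    by (simp add: ip_minus_left ip_minus_right ip_scale_left ip_scale_right ip_commute[of I v u])
  then have "c * (2 * ip I u v) \<le> c * (c * ip I u u + ip I v v / c)"
    using that by (simp add: distrib_left)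
  then show ?thesis using that by (simp add: mult_le_cancel_left)
qed

text \<open>The matrix \<Sum> c e v e (v e)^T, given by its action on \<open>h\<close>; its powers
  are then iterates.\<close>

definition rank_one_sum :: "'i set \<Rightarrow> 'e set \<Rightarrow> ('e \<Rightarrow> 'i \<Rightarrow> real) \<Rightarrow> ('e \<Rightarrow> real) \<Rightarrow> ('i \<Rightarrow> real) \<Rightarrow> ('i \<Rightarrow> real)"
  where "rank_one_sum I E v c h = (\<lambda>i. \<Sum>e\<in>E. c e * ip I (v e) h * v e i)"

text \<open>A log-convex sequence has no peak strictly inside: at the least maximiser the left
  neighbour is strictly smaller, so the product of both neighbours falls below the square of the
  maximum. Terms may vanish, which is why no logarithm is taken.\<close>

lemma log_convex_le_endpoints:
  fixes x :: "nat \<Rightarrow> real"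
  assumes nonneg: "\<And>j. j \<le> s \<Longrightarrow> 0 \<le> x j"
    and conv: "\<And>j. 0 < j \<Longrightarrow> j < s \<Longrightarrow> (x j)\<^sup>2 \<le> x (j - 1) * x (j + 1)"
    and "j \<le> s"
  shows "x j \<le> x 0 + x s"
proof (rule ccontr)
  assume neg: "\<not> x j \<le> x 0 + x s"
  define M where "M = Max (x ` {..s})"
  define k where "k = (LEAST k. k \<le> s \<and> x k = M)"
  have "M \<in> x ` {..s}" unfolding M_def by (rule Max_in) auto
  then have "\<exists>k. k \<le> s \<and> x k = M" by auto
  then have k: "k \<le> s" "x k = M" unfolding k_def by (metis (mono_tags, lifting) LeastI_ex)+
  have le_M: "x i \<le> M" if "i \<le> s" for i
    unfolding M_def by (rule Max_ge) (use that in auto)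
  have big: "x 0 + x s < M" using neg le_M[OF \<open>j \<le> s\<close>] by simp
  have "0 \<le> x 0" "0 \<le> x s" using nonneg by auto
  then have "k \<noteq> 0" "k \<noteq> s" using big k by (metis add_increasing2 add_increasing not_less order_refl)+
  then have ks: "0 < k" "k < s" using k by auto
  have "x (k - 1) \<noteq> M"
  proof
    assume "x (k - 1) = M"
    then have "k \<le> k - 1" unfolding k_def using ks k_def by (intro Least_le) auto
    then show False using ks by simp
  qed
  then have lt: "x (k - 1) < M" using le_M[of "k - 1"] ks by linarith
  have "0 < M" using big \<open>0 \<le> x 0\<close> \<open>0 \<le> x s\<close> by simp
  have "x (k - 1) * x (k + 1) \<le> x (k - 1) * M"
    using le_M[of "k + 1"] nonneg[of "k - 1"] ks by (intro mult_left_mono) auto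
  also have "\<dots> < M * M" using lt \<open>0 < M\<close> by simp
  finally show False using conv[OF ks] k by (simp add: power2_eq_square)
qed

text \<open>Log-convexity makes the ratios of consecutive terms nondecreasing, so each is at least x
  1 / x 0; \<open>ratio\<close> is this statement with denominators cleared. Multiplying the ratios
  gives the claim.\<close>

lemma log_convex_power_le:
  fixes x :: "nat \<Rightarrow> real"
  assumes nonneg: "\<And>j. 0 \<le> x j"
    and conv: "\<And>j. (x (Suc j))\<^sup>2 \<le> x j * x (Suc (Suc j))"
  shows "x 1 ^ Suc j \<le> x 0 ^ j * x (Suc j)"
proof -
  have ratio: "x 1 * x j \<le> x 0 * x (Suc j)" for j
  proof (induction j)
    case (Suc j)
    show ?case
    proof (cases "x (Suc j) = 0")
      case False
      then have pos: "0 < x (Suc j)" using nonneg[of "Suc j"] by simp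
      have "x (Suc j) * (x 1 * x (Suc j)) = x 1 * (x (Suc j))\<^sup>2" by (simp add: power2_eq_square)
      also have "\<dots> \<le> x 1 * (x j * x (Suc (Suc j)))" by (intro mult_left_mono conv nonneg)
      also have "\<dots> = (x 1 * x j) * x (Suc (Suc j))" by simp
      also have "\<dots> \<le> (x 0 * x (Suc j)) * x (Suc (Suc j))" by (intro mult_right_mono Suc nonneg)
      finally have "x (Suc j) * (x 1 * x (Suc j)) \<le> x (Suc j) * (x 0 * x (Suc (Suc j)))" by (simp add: mult_ac)
      then show ?thesis using pos by (simp add: mult_le_cancel_left)
    qed (use nonneg in simp)
  qed simp
  show ?thesis
  proof (induction j)
    case (Suc j)
    have "x 1 ^ Suc (Suc j) = x 1 * x 1 ^ Suc j" by simp
    also have "\<dots> \<le> x 1 * (x 0 ^ j * x (Suc j))" by (intro mult_left_mono Suc nonneg)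
    also have "\<dots> = x 0 ^ j * (x 1 * x (Suc j))" by simp
    also have "\<dots> \<le> x 0 ^ j * (x 0 * x (Suc (Suc j)))" by (intro mult_left_mono ratio zero_le_power nonneg)
    finally show ?case by (simp add: mult_ac)
  qed simp
qed

section \<open>Quadratic forms and traces of powers of a sum of rank-one operators\<close>

locale rank_one_family =
  fixes I :: "'i set" and E :: "'e set" and v :: "'e \<Rightarrow> 'i \<Rightarrow> real"
  assumes finite_I: "finite I" and finite_E: "finite E"
begin

abbreviation W :: "('e \<Rightarrow> real) \<Rightarrow> ('i \<Rightarrow> real) \<Rightarrow> 'i \<Rightarrow> real" where
  "W \<equiv> rank_one_sum I E v"

abbreviation basis :: "'i \<Rightarrow> 'i \<Rightarrow> real" where
  "basis a \<equiv> (\<lambda>i. if i = a then 1 else 0)"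

text \<open>The k-th moment of the spectral measure of the operator at \<open>h\<close>. Even
  moments are squared norms, and Cauchy-Schwarz makes them log-convex, which replaces any use of
  eigenvalues.\<close>

definition mom :: "('e \<Rightarrow> real) \<Rightarrow> ('i \<Rightarrow> real) \<Rightarrow> nat \<Rightarrow> real" where
  "mom c h k = ip I h ((W c ^^ k) h)"

definition trace_pow :: "('e \<Rightarrow> real) \<Rightarrow> nat \<Rightarrow> real" where
  "trace_pow c k = (\<Sum>a\<in>I. mom c (basis a) k)"

lemma ip_basis: "a \<in> I \<Longrightarrow> ip I (basis a) u = u a"
  unfolding ip_def using finite_I by (simp add: if_distrib[of "\<lambda>x. x * _"] cong: if_cong)

lemma W_linear: "W c (\<lambda>i. x i + t * y i) = (\<lambda>i. W c x i + t * W c y i)"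
  unfolding rank_one_sum_def
  by (intro ext) (simp add: ip_add_right ip_scale_right algebra_simps sum.distrib sum_distrib_left)

lemma W_pow_linear: "(W c ^^ k) (\<lambda>i. x i + t * y i) = (\<lambda>i. (W c ^^ k) x i + t * (W c ^^ k) y i)"
  by (induction k) (simp_all add: W_linear)

lemma ip_W: "ip I u (W c h) = (\<Sum>e\<in>E. c e * ip I (v e) h * ip I u (v e))"
  unfolding rank_one_sum_def by (simp add: ip_sum_right ip_scale_right)

lemma W_sym: "ip I u (W c h) = ip I (W c u) h"
  by (simp add: ip_commute[of I "W c u"] ip_W ip_commute[of I _ "v _"] mult_ac)

lemma W_pow_sym: "ip I u ((W c ^^ k) h) = ip I ((W c ^^ k) u) h"
proof (induction k arbitrary: u h)
  case (Suc k)
  have "ip I u ((W c ^^ Suc k) h) = ip I (W c u) ((W c ^^ k) h)" by (simp add: W_sym)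
  also have "\<dots> = ip I ((W c ^^ Suc k) u) h" by (simp add: Suc funpow_swap1)
  finally show ?case .
qed simp

lemma ip_W_pow_basis: "a \<in> I \<Longrightarrow> ip I u ((W c ^^ k) (basis a)) = (W c ^^ k) u a"
  by (subst W_pow_sym, subst ip_commute) (rule ip_basis)

lemma ip_W_pow_add: "ip I u ((W c ^^ (j + k)) h) = ip I ((W c ^^ j) u) ((W c ^^ k) h)"
  by (simp add: funpow_add W_pow_sym)

lemma mom_add: "mom c h (j + k) = ip I ((W c ^^ j) h) ((W c ^^ k) h)"
  by (simp add: mom_def ip_W_pow_add)

lemma mom_double: "mom c h (2 * j) = ip I ((W c ^^ j) h) ((W c ^^ j) h)"
  using mom_add[of c h j j] by (simp add: mult_2)

lemma mom_0: "mom c h 0 = ip I h h"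
  by (simp add: mom_def)

lemma mom_even_nonneg: "0 \<le> mom c h (2 * j)"
  by (simp add: mom_double ip_self_nonneg)

lemma mom_Cauchy_Schwarz: "(mom c h (i + j))\<^sup>2 \<le> mom c h (2 * i) * mom c h (2 * j)"
  unfolding mom_add mom_double by (rule ip_Cauchy_Schwarz)

text \<open>The products \<open>x j\<close> of even moments form a log-convex sequence in
  \<open>j\<close>, because each factor does; hence they are bounded by the two ends, where one
  moment is just |h|^2. If \<open>k\<close> and \<open>l\<close> are odd, each moment is at most the
  geometric mean of its even neighbours, which leads back to \<open>x j\<close> and
  \<open>x (Suc j)\<close>.\<close>

lemma mom_mult_le:
  assumes "k + l = 2 * s"
  shows "\<bar>mom c h k * mom c' h l\<bar> \<le> ip I h h * (mom c h (2 * s) + mom c' h (2 * s))"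
proof -
  define x where "x j = mom c h (2 * j) * mom c' h (2 * (s - j))" for j
  have x_nonneg: "0 \<le> x j" for j unfolding x_def by (intro mult_nonneg_nonneg mom_even_nonneg)
  have "x j \<le> x 0 + x s" if "j \<le> s" for j
  proof (rule log_convex_le_endpoints[OF x_nonneg _ that])
    fix j assume j: "0 < j" "j < s"
    have "(mom c h (2 * j))\<^sup>2 \<le> mom c h (2 * (j - 1)) * mom c h (2 * (j + 1))"
      using mom_Cauchy_Schwarz[of c h "j - 1" "j + 1"] j by (simp add: mult_2)
    moreover have "(mom c' h (2 * (s - j)))\<^sup>2 \<le> mom c' h (2 * (s - (j - 1))) * mom c' h (2 * (s - (j + 1)))"
      using mom_Cauchy_Schwarz[of c' h "s - (j - 1)" "s - (j + 1)"] j by (simp add: mult_2)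
    ultimately have "(mom c h (2 * j))\<^sup>2 * (mom c' h (2 * (s - j)))\<^sup>2
      \<le> (mom c h (2 * (j - 1)) * mom c h (2 * (j + 1))) * (mom c' h (2 * (s - (j - 1))) * mom c' h (2 * (s - (j + 1))))"
      by (intro mult_mono mult_nonneg_nonneg mom_even_nonneg zero_le_power2)
    then show "(x j)\<^sup>2 \<le> x (j - 1) * x (j + 1)"
      by (simp add: x_def power_mult_distrib mult_ac)
  qed
  then have x_le: "x j \<le> x 0 + x s" if "j \<le> s" for j using that by blast
  have ends: "x 0 + x s = ip I h h * (mom c h (2 * s) + mom c' h (2 * s))"
    by (simp add: x_def mom_0 algebra_simps)
  show ?thesis
  proof (cases "even k")
    case True
    then obtain j where j: "k = 2 * j" by blast
    then have "l = 2 * (s - j)" "j \<le> s" using assms by auto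
    then have "\<bar>mom c h k * mom c' h l\<bar> = x j" using x_nonneg[of j] by (simp add: x_def j)
    then show ?thesis using x_le[OF \<open>j \<le> s\<close>] ends by simp
  next
    case False
    then obtain j where j: "k = 2 * j + 1" using oddE by blast
    then have l: "l = (s - j) + (s - Suc j)" "Suc j \<le> s" using assms by auto
    have "(mom c h k)\<^sup>2 * (mom c' h l)\<^sup>2
       \<le> (mom c h (2 * j) * mom c h (2 * Suc j)) * (mom c' h (2 * (s - j)) * mom c' h (2 * (s - Suc j)))"
      using mom_Cauchy_Schwarz[of c h j "Suc j"] mom_Cauchy_Schwarz[of c' h "s - j" "s - Suc j"]
      unfolding l by (intro mult_mono mult_nonneg_nonneg mom_even_nonneg zero_le_power2) (simp_all add: j mult_2)
    also have "\<dots> = x j * x (Suc j)" by (simp add: x_def)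
    also have "\<dots> \<le> (x 0 + x s) * (x 0 + x s)"
      by (intro mult_mono x_le) (use l x_nonneg in auto)
    finally have "\<bar>mom c h k * mom c' h l\<bar>\<^sup>2 \<le> (x 0 + x s)\<^sup>2"
      by (simp add: power_mult_distrib power2_eq_square mult_ac)
    then have "\<bar>mom c h k * mom c' h l\<bar> \<le> x 0 + x s"
      by (rule power2_le_imp_le) (use x_nonneg in auto)
    then show ?thesis using ends by simp
  qed
qed

lemma W_update:
  assumes "e \<in> E"
  shows "W (c(e := c e + 1)) h = (\<lambda>i. W c h i + ip I (v e) h * v e i)"
proof
  fix i
  have "W (c(e := c e + 1)) h i = (\<Sum>f\<in>E. c f * ip I (v f) h * v f i + (if f = e then ip I (v f) h * v f i else 0))"
    unfolding rank_one_sum_def by (intro sum.cong) (auto simp: algebra_simps)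
  then show "W (c(e := c e + 1)) h i = W c h i + ip I (v e) h * v e i"
    using assms finite_E by (simp add: sum.distrib rank_one_sum_def)
qed

text \<open>The telescoping identity for the difference of m-th powers of two noncommuting
  operators. Raising one coefficient by 1 adds the rank-one operator of \<open>v e\<close>, so each
  summand breaks up into a product of two numbers.\<close>

lemma W_pow_update_diff:
  assumes "e \<in> E" and c'_def: "c' = c(e := c e + 1)"
  shows "ip I u ((W c' ^^ m) h) - ip I u ((W c ^^ m) h)
    = (\<Sum>k<m. ip I u ((W c' ^^ k) (v e)) * ip I (v e) ((W c ^^ (m - 1 - k)) h))"
proof (induction m arbitrary: h)
  case (Suc m)
  have upd: "W c' h = (\<lambda>i. W c h i + ip I (v e) h * v e i)"
    unfolding c'_def by (rule W_update[OF assms(1)])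
  have "ip I u ((W c' ^^ Suc m) h) = ip I u ((W c' ^^ m) (W c' h))"
    by (simp add: funpow_swap1)
  also have "\<dots> = ip I u ((W c' ^^ m) (W c h)) + ip I (v e) h * ip I u ((W c' ^^ m) (v e))"
    unfolding upd W_pow_linear by (simp add: ip_add_right ip_scale_right)
  finally have "ip I u ((W c' ^^ Suc m) h) - ip I u ((W c ^^ Suc m) h)
     = (ip I u ((W c' ^^ m) (W c h)) - ip I u ((W c ^^ m) (W c h)))
       + ip I u ((W c' ^^ m) (v e)) * ip I (v e) h"
    by (simp add: funpow_swap1)
  also have "ip I u ((W c' ^^ m) (W c h)) - ip I u ((W c ^^ m) (W c h))
    = (\<Sum>k<m. ip I u ((W c' ^^ k) (v e)) * ip I (v e) ((W c ^^ (m - k)) h))"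
    unfolding Suc
  proof (intro sum.cong refl)
    fix k assume "k \<in> {..<m}"
    then have "(W c ^^ (m - 1 - k)) (W c h) = (W c ^^ (m - k)) h"
      by (metis Suc_diff_Suc diff_diff_left funpow_Suc_right lessThan_iff o_apply plus_1_eq_Suc)
    then show "ip I u ((W c' ^^ k) (v e)) * ip I (v e) ((W c ^^ (m - 1 - k)) (W c h))
        = ip I u ((W c' ^^ k) (v e)) * ip I (v e) ((W c ^^ (m - k)) h)" by simp
  qed
  finally show ?case by simp
qed simp

text \<open>The orders of the two moments in each of the 2 s + 1 telescoping terms add up to 2 s, so
  one bound serves them all.\<close>

lemma mom_update_diff_le:
  assumes "e \<in> E"
  shows "mom (c(e := c e + 1)) (v e) (2 * s + 1) - mom c (v e) (2 * s + 1)
    \<le> real (2 * s + 1) * (ip I (v e) (v e) * (mom (c(e := c e + 1)) (v e) (2 * s) + mom c (v e) (2 * s)))"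
proof -
  have "mom (c(e := c e + 1)) (v e) (2 * s + 1) - mom c (v e) (2 * s + 1)
    = (\<Sum>k<2 * s + 1. mom (c(e := c e + 1)) (v e) k * mom c (v e) (2 * s + 1 - 1 - k))"
    unfolding mom_def by (rule W_pow_update_diff[OF assms refl])
  also have "\<dots> \<le> (\<Sum>k<2 * s + 1. ip I (v e) (v e) * (mom (c(e := c e + 1)) (v e) (2 * s) + mom c (v e) (2 * s)))"
    by (rule sum_mono, rule order_trans[OF abs_ge_self mom_mult_le]) auto
  finally show ?thesis by simp
qed

text \<open>Splitting off one operator from the power puts each coefficient in front of a quadratic
  form, ready for conditioning on its selector.\<close>

lemma trace_pow_Suc: "trace_pow c (Suc m) = (\<Sum>e\<in>E. c e * mom c (v e) m)"
proof -
  have "mom c (basis a) (Suc m) = (\<Sum>e\<in>E. c e * (((W c ^^ m) (v e)) a * v e a))" if "a \<in> I" for a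
  proof -
    have "mom c (basis a) (Suc m) = (\<Sum>e\<in>E. c e * ip I (v e) ((W c ^^ m) (basis a)) * v e a)"
      using that by (simp add: mom_def ip_basis rank_one_sum_def)
    then show ?thesis
      using that by (simp add: ip_W_pow_basis mult_ac)
  qed
  then have "trace_pow c (Suc m) = (\<Sum>a\<in>I. \<Sum>e\<in>E. c e * (((W c ^^ m) (v e)) a * v e a))"
    by (simp add: trace_pow_def)
  also have "\<dots> = (\<Sum>e\<in>E. c e * (\<Sum>a\<in>I. ((W c ^^ m) (v e)) a * v e a))"
    by (subst sum.swap) (simp add: sum_distrib_left)
  finally show ?thesis by (simp add: mom_def ip_def mult.commute)
qed

lemma trace_pow_even_nonneg: "0 \<le> trace_pow c (2 * s)"
  unfolding trace_pow_def by (intro sum_nonneg mom_even_nonneg)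

lemma trace_pow_0: "trace_pow c 0 = real (card I)"
proof -
  have "trace_pow c 0 = (\<Sum>a\<in>I. 1)" unfolding trace_pow_def
    by (intro sum.cong refl) (simp add: mom_0 ip_basis)
  then show ?thesis by simp
qed

lemma trace_pow_odd_le:
  assumes "0 < \<theta>"
  shows "2 * trace_pow c (2 * s + 1) \<le> \<theta> * trace_pow c (2 * (s + 1)) + trace_pow c (2 * s) / \<theta>"
proof -
  have "2 * mom c h (2 * s + 1) \<le> \<theta> * mom c h (2 * (s + 1)) + mom c h (2 * s) / \<theta>" for h
  proof -
    have "mom c h (2 * s + 1) = mom c h ((s + 1) + s)" by (simp add: mult_2)
    then show ?thesis
      unfolding mom_double using ip_Young[OF assms] mom_add[of c h "s + 1" s] by simp
  qed
  then have "(\<Sum>a\<in>I. 2 * mom c (basis a) (2 * s + 1))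
    \<le> (\<Sum>a\<in>I. \<theta> * mom c (basis a) (2 * (s + 1)) + mom c (basis a) (2 * s) / \<theta>)" by (intro sum_mono)
  then show ?thesis
    by (simp add: trace_pow_def sum_distrib_left sum.distrib sum_divide_distrib)
qed

text \<open>With V = \<Sum> v e (v e)^T, the left-hand side is the trace of W^s V W^s, and
  \<open>frame\<close> says that V is at most S times the identity.\<close>

lemma sum_mom_le_trace:
  assumes frame: "\<And>h. (\<Sum>e\<in>E. (ip I (v e) h)\<^sup>2) \<le> S * ip I h h"
  shows "(\<Sum>e\<in>E. mom c (v e) (2 * s)) \<le> S * trace_pow c (2 * s)"
proof -
  have "mom c (v e) (2 * s) = (\<Sum>a\<in>I. (ip I (v e) ((W c ^^ s) (basis a)))\<^sup>2)" for e
  proof -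
    have "mom c (v e) (2 * s) = (\<Sum>a\<in>I. ((W c ^^ s) (v e) a)\<^sup>2)"
      by (simp add: mom_double ip_def power2_eq_square)
    also have "\<dots> = (\<Sum>a\<in>I. (ip I (v e) ((W c ^^ s) (basis a)))\<^sup>2)"
      by (intro sum.cong) (simp_all add: ip_W_pow_basis)
    finally show ?thesis .
  qed
  then have "(\<Sum>e\<in>E. mom c (v e) (2 * s)) = (\<Sum>a\<in>I. \<Sum>e\<in>E. (ip I (v e) ((W c ^^ s) (basis a)))\<^sup>2)"
    using sum.swap by simp
  also have "\<dots> \<le> (\<Sum>a\<in>I. S * mom c (basis a) (2 * s))"
    unfolding mom_double by (intro sum_mono frame)
  finally show ?thesis by (simp add: trace_pow_def sum_distrib_left)
qed

text \<open>The largest eigenvalue is bounded by the trace of a high even power, without mentioning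
  eigenvalues: log-convexity passes from the first moment to the moment of order 2 (j + 1), which is
  a squared norm and is bounded by |h|^2 times the squared Frobenius norm of the power.\<close>

lemma abs_mom_power_le_trace:
  "(mom c h 1)\<^sup>2 ^ Suc j \<le> (ip I h h)\<^sup>2 ^ Suc j * trace_pow c (2 * Suc j)"
proof -
  define x where "x j = mom c h (2 * j)" for j
  have x: "0 \<le> x j" for j by (simp add: x_def mom_even_nonneg)
  have "(mom c h 1)\<^sup>2 \<le> x 0 * x 1"
    using mom_Cauchy_Schwarz[of c h 0 1] by (simp add: x_def)
  then have "(mom c h 1)\<^sup>2 ^ Suc j \<le> (x 0 * x 1) ^ Suc j" by (intro power_mono) auto
  also have "\<dots> = x 0 ^ Suc j * x 1 ^ Suc j" by (rule power_mult_distrib)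
  also have "\<dots> \<le> x 0 ^ Suc j * (x 0 ^ j * x (Suc j))"
  proof (intro mult_left_mono log_convex_power_le x zero_le_power)
    fix j
    show "(x (Suc j))\<^sup>2 \<le> x j * x (Suc (Suc j))"
      using mom_Cauchy_Schwarz[of c h j "Suc (Suc j)"] by (simp add: x_def mult_2)
  qed
  also have "x (Suc j) \<le> x 0 * trace_pow c (2 * Suc j)"
  proof -
    have "((W c ^^ Suc j) h a)\<^sup>2 \<le> mom c (basis a) (2 * Suc j) * ip I h h" if "a \<in> I" for a
    proof -
      have "(W c ^^ Suc j) h a = ip I ((W c ^^ Suc j) (basis a)) h"
        using that by (simp only: ip_W_pow_basis[symmetric] ip_commute)
      then show ?thesis unfolding mom_double by (simp only: ip_Cauchy_Schwarz)
    qed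
    then have "(\<Sum>a\<in>I. ((W c ^^ Suc j) h a)\<^sup>2) \<le> (\<Sum>a\<in>I. mom c (basis a) (2 * Suc j) * ip I h h)"
      by (intro sum_mono)
    also have "\<dots> = x 0 * trace_pow c (2 * Suc j)"
      by (simp add: x_def mom_0 trace_pow_def sum_distrib_left mult.commute)
    also have "(\<Sum>a\<in>I. ((W c ^^ Suc j) h a)\<^sup>2) = x (Suc j)"
      by (simp only: x_def mom_double[of c h "Suc j"] ip_def power2_eq_square)
    finally show ?thesis .
  qed
  finally have "(mom c h 1)\<^sup>2 ^ Suc j \<le> x 0 ^ Suc j * (x 0 ^ j * (x 0 * trace_pow c (2 * Suc j)))"
    using x[of 0] by (simp add: mult_left_mono)
  also have "\<dots> = (x 0)\<^sup>2 ^ Suc j * trace_pow c (2 * Suc j)"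
    by (simp add: power2_eq_square power_mult_distrib mult_ac)
  finally show ?thesis by (simp add: x_def mom_0)
qed

end

section \<open>The moment recursion for centred selectors and the tail bound\<close>

context rank_one_family
begin

definition centred :: "real \<Rightarrow> 'e set \<Rightarrow> 'e \<Rightarrow> real" where
  "centred p T e = (if e \<in> T then 1 else 0) - p"

lemma mom_1: "mom c h 1 = (\<Sum>e\<in>E. c e * (ip I (v e) h)\<^sup>2)"
  by (simp add: mom_def ip_W ip_commute[of I h] power2_eq_square mult_ac)

text \<open>A centred selector times a function of the selector has conditional mean p (1 - p) times
  the increment of that function, and the increment is bounded by even moments. The weight
  \<open>centred p T e + 2 * p\<close>, that is 1 + p or p, is nonnegative and makes the bound an
  expectation over all of \<open>T\<close> again; the sum over \<open>e\<close> of its centred part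
  is a trace.\<close>

lemma expectation_centred_mom_le:
  assumes p: "0 \<le> p" "p \<le> 1" and e: "e \<in> E"
  shows "subset_expectation E p (\<lambda>T. centred p T e * mom (centred p T) (v e) (2 * s + 1))
    \<le> subset_expectation E p (\<lambda>T. real (2 * s + 1) *
        ((centred p T e + 2 * p) * (ip I (v e) (v e) * mom (centred p T) (v e) (2 * s))))"
proof -
  let ?N = "ip I (v e) (v e)" and ?m = "real (2 * s + 1)"
  define a where "a T k = mom (centred p (insert e T)) (v e) k" for T k
  define b where "b T k = mom (centred p T) (v e) k" for T k
  have ab: "a T (2 * s) \<ge> 0" "b T (2 * s) \<ge> 0" for T
    by (simp_all add: a_def b_def mom_even_nonneg)
  have N: "?N \<ge> 0" by (rule ip_self_nonneg)
  have "subset_expectation E p (\<lambda>T. centred p T e * mom (centred p T) (v e) (2 * s + 1))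
      = subset_expectation (E - {e}) p (\<lambda>T. p * (1 - p) * (a T (2 * s + 1) - b T (2 * s + 1)))"
    unfolding subset_expectation_split[OF finite_E e]
    by (intro subset_expectation_cong) (auto simp: centred_def a_def b_def algebra_simps)
  also have "\<dots> \<le> subset_expectation (E - {e}) p (\<lambda>T.
      p * (?m * ((1 + p) * (?N * a T (2 * s)))) + (1 - p) * (?m * (p * (?N * b T (2 * s)))))"
  proof (rule subset_expectation_mono[OF p])
    fix T assume T: "T \<subseteq> E - {e}"
    have upd: "centred p (insert e T) = (centred p T)(e := centred p T e + 1)"
      using T by (auto simp: centred_def fun_eq_iff)
    have "p * (1 - p) * (a T (2 * s + 1) - b T (2 * s + 1))
        \<le> p * (1 - p) * (?m * (?N * (a T (2 * s) + b T (2 * s))))"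
      unfolding a_def b_def upd by (intro mult_left_mono mom_update_diff_le e) (use p in simp)
    also have "\<dots> = p * (?m * ((1 - p) * (?N * a T (2 * s)))) + (1 - p) * (?m * (p * (?N * b T (2 * s))))"
      by (simp add: algebra_simps)
    also have "\<dots> \<le> p * (?m * ((1 + p) * (?N * a T (2 * s)))) + (1 - p) * (?m * (p * (?N * b T (2 * s))))"
      by (intro add_right_mono mult_left_mono mult_right_mono mult_nonneg_nonneg N ab) (use p in auto)
    finally show "p * (1 - p) * (a T (2 * s + 1) - b T (2 * s + 1)) \<le> \<dots>" .
  qed
  also have "\<dots> = subset_expectation E p (\<lambda>T. ?m *
        ((centred p T e + 2 * p) * (?N * mom (centred p T) (v e) (2 * s))))"
    unfolding subset_expectation_split[OF finite_E e]
    by (intro subset_expectation_cong) (auto simp: centred_def a_def b_def)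
  finally show ?thesis .
qed

text \<open>Summing the conditional bound over \<open>e\<close> produces a trace of odd order 2 s +
  1. Young's inequality distributes it over its even neighbours, and half of the moment to be
  bounded reappears on the right, where it is absorbed.\<close>

lemma expectation_trace_pow_step:
  assumes p: "0 \<le> p" "p \<le> 1" and R: "0 < R" "\<And>e. e \<in> E \<Longrightarrow> ip I (v e) (v e) \<le> R"
    and frame: "\<And>h. (\<Sum>e\<in>E. (ip I (v e) h)\<^sup>2) \<le> S * ip I h h"
  shows "subset_expectation E p (\<lambda>T. trace_pow (centred p T) (2 * (s + 1)))
    \<le> ((real (2 * s + 1) * R)\<^sup>2 + 4 * (real (2 * s + 1) * R) * p * S)
        * subset_expectation E p (\<lambda>T. trace_pow (centred p T) (2 * s))"
proof -
  let ?Ex = "subset_expectation E p" and ?c = "centred p"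
  define m where "m = real (2 * s + 1)"
  \<comment> \<open>Chosen so that the coefficient m R \<theta> / 2 of the moment to be absorbed is
    1/2.\<close>
  define \<theta> where "\<theta> = 1 / (m * R)"
  have m: "0 < m" by (simp add: m_def)
  have \<theta>: "0 < \<theta>" using m R by (simp add: \<theta>_def)
  have "?Ex (\<lambda>T. trace_pow (?c T) (2 * (s + 1)))
      = (\<Sum>e\<in>E. ?Ex (\<lambda>T. ?c T e * mom (?c T) (v e) (2 * s + 1)))"
    using trace_pow_Suc[of _ "2 * s + 1"] by (simp add: subset_expectation_sum)
  also have "\<dots> \<le> (\<Sum>e\<in>E. ?Ex (\<lambda>T. m * ((?c T e + 2 * p) * (ip I (v e) (v e) * mom (?c T) (v e) (2 * s)))))"
    unfolding m_def by (intro sum_mono expectation_centred_mom_le p)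
  also have "\<dots> = ?Ex (\<lambda>T. \<Sum>e\<in>E. m * ((?c T e + 2 * p) * (ip I (v e) (v e) * mom (?c T) (v e) (2 * s))))"
    by (simp add: subset_expectation_sum)
  also have "\<dots> \<le> ?Ex (\<lambda>T. 1/2 * trace_pow (?c T) (2 * (s + 1))
      + ((m * R)\<^sup>2 / 2 + 2 * (m * R) * p * S) * trace_pow (?c T) (2 * s))"
  proof (rule subset_expectation_mono[OF p])
    fix T
    have "(\<Sum>e\<in>E. m * ((?c T e + 2 * p) * (ip I (v e) (v e) * mom (?c T) (v e) (2 * s))))
        \<le> (\<Sum>e\<in>E. m * ((?c T e + 2 * p) * (R * mom (?c T) (v e) (2 * s))))"
      by (intro sum_mono mult_left_mono mult_right_mono R mom_even_nonneg)
        (use m p in \<open>auto simp: centred_def\<close>)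
    also have "\<dots> = (m * R) * ((\<Sum>e\<in>E. ?c T e * mom (?c T) (v e) (2 * s)) + 2 * p * (\<Sum>e\<in>E. mom (?c T) (v e) (2 * s)))"
    proof -
      have "(\<Sum>e\<in>E. m * ((?c T e + 2 * p) * (R * mom (?c T) (v e) (2 * s))))
        = (\<Sum>e\<in>E. (m * R) * (?c T e * mom (?c T) (v e) (2 * s)) + (m * R) * (2 * p * mom (?c T) (v e) (2 * s)))"
        by (intro sum.cong) (simp_all add: algebra_simps)
      then show ?thesis by (simp only: sum.distrib sum_distrib_left[symmetric] distrib_left)
    qed
    also have "\<dots> \<le> (m * R) * ((\<theta> * trace_pow (?c T) (2 * (s + 1)) + trace_pow (?c T) (2 * s) / \<theta>) / 2
        + 2 * p * (S * trace_pow (?c T) (2 * s)))"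
    proof (intro mult_left_mono add_mono sum_mom_le_trace frame)
      show "(\<Sum>e\<in>E. ?c T e * mom (?c T) (v e) (2 * s))
          \<le> (\<theta> * trace_pow (?c T) (2 * (s + 1)) + trace_pow (?c T) (2 * s) / \<theta>) / 2"
        using trace_pow_odd_le[OF \<theta>, of "?c T" s] trace_pow_Suc[of "?c T" "2 * s"] by simp
    qed (use m p R in auto)
    also have "\<dots> = 1/2 * trace_pow (?c T) (2 * (s + 1))
      + ((m * R)\<^sup>2 / 2 + 2 * (m * R) * p * S) * trace_pow (?c T) (2 * s)"
    proof -
      define z where "z = m * R"
      have "0 < z" using m R by (simp add: z_def)
      then have "z * ((1 / z * X + Y / (1 / z)) / 2 + 2 * p * (S * Y)) = 1/2 * X + (z\<^sup>2 / 2 + 2 * z * p * S) * Y" for X Y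
        by (simp add: distrib_left distrib_right add_divide_distrib power2_eq_square)
      then show ?thesis unfolding \<theta>_def z_def .
    qed
    finally show "(\<Sum>e\<in>E. m * ((?c T e + 2 * p) * (ip I (v e) (v e) * mom (?c T) (v e) (2 * s)))) \<le> \<dots>" .
  qed
  also have "\<dots> = 1/2 * ?Ex (\<lambda>T. trace_pow (?c T) (2 * (s + 1)))
      + ((m * R)\<^sup>2 / 2 + 2 * (m * R) * p * S) * ?Ex (\<lambda>T. trace_pow (?c T) (2 * s))"
    by (simp only: subset_expectation_add subset_expectation_cmult)
  finally show ?thesis unfolding m_def[symmetric] by (simp add: algebra_simps)
qed

lemma expectation_trace_pow_le:
  assumes p: "0 \<le> p" "p \<le> 1" and R: "0 < R" "\<And>e. e \<in> E \<Longrightarrow> ip I (v e) (v e) \<le> R"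
    and S: "0 \<le> S" "\<And>h. (\<Sum>e\<in>E. (ip I (v e) h)\<^sup>2) \<le> S * ip I h h"
    and "s \<le> q"
  shows "subset_expectation E p (\<lambda>T. trace_pow (centred p T) (2 * s))
    \<le> ((2 * real q * R)\<^sup>2 + 8 * real q * R * p * S) ^ s * real (card I)"
  using \<open>s \<le> q\<close>
proof (induction s)
  case 0
  then show ?case
    by (simp add: trace_pow_0 subset_expectation_cmult[of E p "real (card I)" "\<lambda>_. 1", simplified]
      subset_expectation_one[OF finite_E])
next
  case (Suc s)
  let ?Ex = "subset_expectation E p"
  define G where "G = (2 * real q * R)\<^sup>2 + 8 * real q * R * p * S"
  define m where "m = real (2 * s + 1)"
  have m: "0 \<le> m" "m \<le> 2 * real q" using Suc.prems by (simp_all add: m_def)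
  have "0 \<le> G" unfolding G_def using p R S by simp
  have "(m * R)\<^sup>2 \<le> (2 * real q * R)\<^sup>2" using m R by (intro power_mono mult_right_mono) auto
  moreover have "4 * (m * R) * p * S \<le> 4 * ((2 * real q) * R) * p * S"
    using m R p S by (intro mult_right_mono mult_left_mono) auto
  ultimately have G: "(m * R)\<^sup>2 + 4 * (m * R) * p * S \<le> G" unfolding G_def by linarith
  have "?Ex (\<lambda>T. trace_pow (centred p T) (2 * Suc s))
     \<le> ((m * R)\<^sup>2 + 4 * (m * R) * p * S) * ?Ex (\<lambda>T. trace_pow (centred p T) (2 * s))"
    using expectation_trace_pow_step[OF p R(1) R(2) S(2), of s] by (simp add: m_def)
  also have "\<dots> \<le> G * ?Ex (\<lambda>T. trace_pow (centred p T) (2 * s))"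
    using G by (intro mult_right_mono)
      (auto simp: subset_expectation_def intro!: sum_nonneg mult_nonneg_nonneg subset_weight_nonneg p trace_pow_even_nonneg)
  also have "\<dots> \<le> G * (G ^ s * real (card I))"
    using Suc \<open>0 \<le> G\<close> unfolding G_def[symmetric] by (intro mult_left_mono) auto
  finally show ?case unfolding G_def by simp
qed

text \<open>A matrix Chernoff inequality. Since every summand has rank one, the proof by moments needs
  neither exponentials nor eigenvalues of matrices.\<close>

theorem rank_one_sum_concentration:
  assumes p: "0 \<le> p" "p \<le> 1" and R: "0 < R" "\<And>e. e \<in> E \<Longrightarrow> ip I (v e) (v e) \<le> R"
    and S: "0 \<le> S" "\<And>h. (\<Sum>e\<in>E. (ip I (v e) h)\<^sup>2) \<le> S * ip I h h"
    and a: "0 < a" and q: "0 < q"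
  shows "subset_prob E p (\<lambda>T. \<exists>h. a * ip I h h < \<bar>(\<Sum>e\<in>T. (ip I (v e) h)\<^sup>2) - p * (\<Sum>e\<in>E. (ip I (v e) h)\<^sup>2)\<bar>)
    \<le> real (card I) * (((2 * real q * R)\<^sup>2 + 8 * real q * R * p * S) / a\<^sup>2) ^ q"
proof -
  define f where "f T = trace_pow (centred p T) (2 * q)" for T
  have "subset_prob E p (\<lambda>T. \<exists>h. a * ip I h h < \<bar>(\<Sum>e\<in>T. (ip I (v e) h)\<^sup>2) - p * (\<Sum>e\<in>E. (ip I (v e) h)\<^sup>2)\<bar>)
      \<le> subset_expectation E p f / (a\<^sup>2) ^ q"
  proof (rule subset_prob_markov[OF p])
    fix T assume T: "T \<subseteq> E"
      and "\<exists>h. a * ip I h h < \<bar>(\<Sum>e\<in>T. (ip I (v e) h)\<^sup>2) - p * (\<Sum>e\<in>E. (ip I (v e) h)\<^sup>2)\<bar>"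
    then obtain h where h: "a * ip I h h < \<bar>(\<Sum>e\<in>T. (ip I (v e) h)\<^sup>2) - p * (\<Sum>e\<in>E. (ip I (v e) h)\<^sup>2)\<bar>"
      by blast
    have "mom (centred p T) h 1 = (\<Sum>e\<in>E. if e \<in> T then (ip I (v e) h)\<^sup>2 else 0) - p * (\<Sum>e\<in>E. (ip I (v e) h)\<^sup>2)"
      unfolding mom_1 sum_distrib_left sum_subtractf[symmetric]
      by (intro sum.cong) (auto simp: centred_def algebra_simps)
    also have "(\<Sum>e\<in>E. if e \<in> T then (ip I (v e) h)\<^sup>2 else 0) = (\<Sum>e\<in>T. (ip I (v e) h)\<^sup>2)"
      using T finite_E by (simp add: sum.If_cases Int_absorb1)
    finally have less: "a * ip I h h < \<bar>mom (centred p T) h 1\<bar>" using h by simp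
    obtain j where j: "q = Suc j" using q by (cases q) auto
    have le: "(mom (centred p T) h 1)\<^sup>2 ^ q \<le> (ip I h h)\<^sup>2 ^ q * f T"
      unfolding f_def j by (rule abs_mom_power_le_trace)
    have nn: "0 \<le> ip I h h" by (rule ip_self_nonneg)
    have "(a * ip I h h)\<^sup>2 < \<bar>mom (centred p T) h 1\<bar>\<^sup>2"
      using less nn a by (intro power_strict_mono) auto
    then have "(a * ip I h h)\<^sup>2 < (mom (centred p T) h 1)\<^sup>2" by simp
    then have less2: "((a * ip I h h)\<^sup>2) ^ q < ((mom (centred p T) h 1)\<^sup>2) ^ q"
      by (rule power_strict_mono) (use q in auto)
    have pos: "0 < ip I h h"
    proof (rule ccontr)
      assume "\<not> 0 < ip I h h"
      then have "ip I h h = 0" using nn by simp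
      then have "(mom (centred p T) h 1)\<^sup>2 ^ q \<le> 0" using le q by (simp add: zero_power)
      moreover have "0 < (mom (centred p T) h 1)\<^sup>2 ^ q"
        using less2 by (rule le_less_trans[rotated]) simp
      ultimately show False by simp
    qed
    have "((a * ip I h h)\<^sup>2) ^ q \<le> (ip I h h)\<^sup>2 ^ q * f T" using less2 le by linarith
    then have "(ip I h h)\<^sup>2 ^ q * (a\<^sup>2) ^ q \<le> (ip I h h)\<^sup>2 ^ q * f T"
      by (simp add: power_mult_distrib mult.commute)
    then show "(a\<^sup>2) ^ q \<le> f T" using pos by (simp add: mult_le_cancel_left)
  qed (use a in \<open>auto simp: f_def trace_pow_even_nonneg\<close>)
  also have "\<dots> \<le> (((2 * real q * R)\<^sup>2 + 8 * real q * R * p * S) ^ q * real (card I)) / (a\<^sup>2) ^ q"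
    unfolding f_def using expectation_trace_pow_le[OF p R S order_refl] a by (intro divide_right_mono) auto
  finally show ?thesis by (simp add: power_divide mult.commute)
qed

end

section \<open>Random symmetric sets of positions\<close>

definition lower_pairs :: "nat \<Rightarrow> (nat \<times> nat) set" where
  "lower_pairs d = {(i, j). j \<le> i \<and> i < d}"

definition sym_cl :: "(nat \<times> nat) set \<Rightarrow> (nat \<times> nat) set" where
  "sym_cl T = T \<union> T\<inverse>"

text \<open>The contribution of a lower pair to a sum over ordered positions. Only lower pairs carry
  independent selectors, so all random sums are rewritten with these weights.\<close>

definition fold_sym :: "(nat \<Rightarrow> nat \<Rightarrow> real) \<Rightarrow> nat \<times> nat \<Rightarrow> real" where
  "fold_sym g = (\<lambda>(i, j). if i = j then g i j else g i j + g j i)"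

lemma finite_lower_pairs: "finite (lower_pairs d)"
  by (rule finite_subset[of _ "{..<d} \<times> {..<d}"]) (auto simp: lower_pairs_def)

lemma sym_cl_subset: "T \<subseteq> lower_pairs d \<Longrightarrow> sym_cl T \<subseteq> {..<d} \<times> {..<d}"
  by (fastforce simp: sym_cl_def lower_pairs_def)

lemma sym_cl_lower_pairs: "sym_cl (lower_pairs d) = {..<d} \<times> {..<d}"
  by (auto simp: sym_cl_def lower_pairs_def)

lemma sum_sym_cl:
  assumes "T \<subseteq> lower_pairs d"
  shows "(\<Sum>(i, j)\<in>sym_cl T. g i j) = (\<Sum>e\<in>T. fold_sym g e)"
proof -
  have fin: "finite T" using assms finite_lower_pairs finite_subset by blast
  define D where "D = {e\<in>T. fst e = snd e}"
  define L where "L = {e\<in>T. fst e \<noteq> snd e}"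
  have T: "T = D \<union> L" "D \<inter> L = {}" "finite D" "finite L" using fin by (auto simp: D_def L_def)
  have "sym_cl T = T \<union> L\<inverse>" by (auto simp: sym_cl_def L_def)
  moreover have "T \<inter> L\<inverse> = {}"
  proof -
    have "False" if "(i, j) \<in> T" "(j, i) \<in> T" "i \<noteq> j" for i j
      using subsetD[OF assms that(1)] subsetD[OF assms that(2)] that(3) by (simp add: lower_pairs_def)
    then show ?thesis unfolding L_def by auto
  qed
  moreover have "finite (L\<inverse>)" using T by simp
  ultimately have cl: "sym_cl T = T \<union> L\<inverse>" "T \<inter> L\<inverse> = {}" "finite (L\<inverse>)" by auto
  have "(\<Sum>(i, j)\<in>L\<inverse>. g i j) = (\<Sum>(i, j)\<in>L. g j i)"
    by (rule sum.reindex_bij_witness[of _ "\<lambda>(i, j). (j, i)" "\<lambda>(i, j). (j, i)"]) auto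
  then have "(\<Sum>(i, j)\<in>sym_cl T. g i j) = (\<Sum>(i, j)\<in>D. g i j) + (\<Sum>(i, j)\<in>L. g i j) + (\<Sum>(i, j)\<in>L. g j i)"
    unfolding cl(1) using fin cl T by (simp add: sum.union_disjoint)
  also have "\<dots> = (\<Sum>e\<in>D. fold_sym g e) + (\<Sum>e\<in>L. fold_sym g e)"
    unfolding add.assoc sum.distrib[symmetric]
    by (intro arg_cong2[where f = "(+)"] sum.cong) (auto simp: D_def L_def fold_sym_def)
  also have "\<dots> = (\<Sum>e\<in>T. fold_sym g e)"
    using T by (subst T(1)) (simp add: sum.union_disjoint)
  finally show ?thesis .
qed

lemma sum_lower_pairs: "(\<Sum>e\<in>lower_pairs d. fold_sym g e) = (\<Sum>i<d. \<Sum>j<d. g i j)"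
  using sum_sym_cl[OF order_refl, of g d] by (simp add: sym_cl_lower_pairs sum.cartesian_product)

text \<open>The exponential Markov inequality at the fixed rate 1/4. The failure probability depends
  on the slack \<open>u\<close> alone, so the bound remains useful when the expected sum is
  small.\<close>

lemma sym_cl_sum_chernoff:
  assumes p: "0 \<le> p" "p \<le> 1" and g: "\<And>i j. 0 \<le> g i j \<and> g i j \<le> 1"
  shows "subset_prob (lower_pairs d) p
      (\<lambda>T. 3/2 * p * (\<Sum>i<d. \<Sum>j<d. g i j) + u < (\<Sum>(i, j)\<in>sym_cl T. g i j)) \<le> exp (- u / 4)"
proof -
  define G where "G = (\<Sum>i<d. \<Sum>j<d. g i j)"
  have "subset_prob (lower_pairs d) p (\<lambda>T. 3/2 * p * G + u < (\<Sum>(i, j)\<in>sym_cl T. g i j))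
      \<le> subset_expectation (lower_pairs d) p (\<lambda>T. exp ((\<Sum>e\<in>T. fold_sym g e) / 4)) / exp ((3/2 * p * G + u) / 4)"
  proof (rule subset_prob_markov[OF p])
    fix T assume T: "T \<subseteq> lower_pairs d" "3/2 * p * G + u < (\<Sum>(i, j)\<in>sym_cl T. g i j)"
    have "(3/2 * p * G + u) / 4 \<le> (\<Sum>e\<in>T. fold_sym g e) / 4"
      by (rule divide_right_mono[OF less_imp_le]) (use T(2) sum_sym_cl[OF T(1), of g] in simp_all)
    then show "exp ((3/2 * p * G + u) / 4) \<le> exp ((\<Sum>e\<in>T. fold_sym g e) / 4)"
      by (simp only: exp_le_cancel_iff)
  qed auto
  also have "\<dots> \<le> exp (3/2 * p * G / 4) / exp ((3/2 * p * G + u) / 4)"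
    unfolding G_def sum_lower_pairs[symmetric]
  proof (intro divide_right_mono subset_expectation_exp_sum finite_lower_pairs p)
    fix e show "0 \<le> fold_sym g e \<and> fold_sym g e \<le> 2"
      using g[of "fst e" "snd e"] g[of "snd e" "fst e"] by (auto simp: fold_sym_def split: prod.split)
  qed auto
  also have "\<dots> = exp (- u / 4)"
    unfolding exp_diff[symmetric] by (simp add: add_divide_distrib)
  finally show ?thesis by (simp add: G_def)
qed

section \<open>Counting edges between pairs of vertex sets\<close>

lemma sum_power_card_subsets:
  fixes z :: real
  shows "(\<Sum>S\<in>Pow {..<d} - {{}}. z ^ card S) = (1 + z) ^ d - 1"
proof -
  have "(1 + z) ^ d = (\<Prod>i\<in>{..<d}. z + 1)" by (simp add: add.commute)
  also have "\<dots> = (\<Sum>S\<in>Pow {..<d}. (\<Prod>i\<in>S. z) * (\<Prod>i\<in>{..<d} - S. 1))"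
    by (rule prod_add) simp
  also have "\<dots> = (\<Sum>S\<in>Pow {..<d}. z ^ card S)" by simp
  also have "\<dots> = z ^ card ({}::nat set) + (\<Sum>S\<in>Pow {..<d} - {{}}. z ^ card S)"
    by (rule sum.remove) auto
  finally show ?thesis by simp
qed

text \<open>With z = exp (- lam / 4), the slack makes the failure probability of one pair at most
  z^|S| z^|S'|; the sum over all pairs factors, and the binomial theorem evaluates it. Empty sets
  cannot violate the bound, hence the subtraction of 1.\<close>

lemma cut_sum_bound:
  assumes p: "0 \<le> p" "p \<le> 1" and lam: "0 \<le> lam"
  shows "subset_prob (lower_pairs d) p (\<lambda>T. \<exists>S\<in>Pow {..<d}. \<exists>S'\<in>Pow {..<d}.
      3/2 * p * (real (card S) * real (card S')) + lam * (real (card S) + real (card S'))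
        < (\<Sum>(i, j)\<in>sym_cl T. of_bool (i \<in> S) * of_bool (j \<in> S')))
    \<le> ((1 + exp (- lam / 4)) ^ d - 1)\<^sup>2"
proof -
  define z where "z = exp (- lam / 4)"
  define A where "A = Pow {..<d} - {{}}"
  define Q where "Q S S' T \<longleftrightarrow> 3/2 * p * (real (card S) * real (card S')) + lam * (real (card S) + real (card S'))
        < (\<Sum>(i, j)\<in>sym_cl T. of_bool (i \<in> S) * of_bool (j \<in> S'))" for S S' and T :: "(nat \<times> nat) set"
  have fin: "finite A" by (simp add: A_def)
  have "subset_prob (lower_pairs d) p (\<lambda>T. \<exists>S\<in>Pow {..<d}. \<exists>S'\<in>Pow {..<d}. Q S S' T)
      \<le> subset_prob (lower_pairs d) p (\<lambda>T. \<exists>S\<in>A. \<exists>S'\<in>A. Q S S' T)"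
  proof (rule subset_prob_mono[OF p])
    fix T :: "(nat \<times> nat) set"
    assume "\<exists>S\<in>Pow {..<d}. \<exists>S'\<in>Pow {..<d}. Q S S' T"
    then obtain S S' where S: "S \<subseteq> {..<d}" "S' \<subseteq> {..<d}" "Q S S' T" by blast
    have "S \<noteq> {}" "S' \<noteq> {}"
      using S(3) mult_nonneg_nonneg[OF lam of_nat_0_le_iff[of "card S"]]
        mult_nonneg_nonneg[OF lam of_nat_0_le_iff[of "card S'"]] by (auto simp: Q_def)
    then show "\<exists>S\<in>A. \<exists>S'\<in>A. Q S S' T" using S unfolding A_def by blast
  qed
  also have "\<dots> \<le> (\<Sum>S\<in>A. \<Sum>S'\<in>A. subset_prob (lower_pairs d) p (Q S S'))"
    by (intro order_trans[OF subset_prob_bex[OF p fin]] sum_mono subset_prob_bex[OF p fin])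
  also have "\<dots> \<le> (\<Sum>S\<in>A. \<Sum>S'\<in>A. z ^ card S * z ^ card S')"
  proof (intro sum_mono)
    fix S S' assume S: "S \<in> A" "S' \<in> A"
    have card: "(\<Sum>i<d. of_bool (i \<in> X)) = real (card X)" if "X \<in> A" for X
      using that by (simp add: A_def Int_absorb1)
    have "(\<Sum>i<d. \<Sum>j<d. of_bool (i \<in> S) * of_bool (j \<in> S')) = real (card S) * real (card S')"
      unfolding sum_product[symmetric] using card S by simp
    then have "subset_prob (lower_pairs d) p (Q S S') \<le> exp (- (lam * (real (card S) + real (card S'))) / 4)"
      using sym_cl_sum_chernoff[OF p, of "\<lambda>i j. of_bool (i \<in> S) * of_bool (j \<in> S')" d
        "lam * (real (card S) + real (card S'))"] unfolding Q_def by simp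
    also have "\<dots> = z ^ (card S + card S')"
      unfolding z_def exp_of_nat_mult[symmetric]
      by (simp add: algebra_simps add_divide_distrib diff_divide_distrib)
    finally show "subset_prob (lower_pairs d) p (Q S S') \<le> z ^ card S * z ^ card S'"
      by (simp add: power_add)
  qed
  also have "\<dots> = ((1 + z) ^ d - 1)\<^sup>2"
    unfolding sum_product[symmetric] A_def sum_power_card_subsets by (simp add: power2_eq_square)
  finally show ?thesis unfolding Q_def z_def .
qed

lemma sum_pattern:
  fixes f :: "nat \<Rightarrow> nat \<Rightarrow> real"
  assumes "\<Omega> \<subseteq> {..<d} \<times> {..<d}"
  shows "(\<Sum>(i, j)\<in>\<Omega>. f i j) = (\<Sum>i<d. \<Sum>j<d. of_bool ((i, j) \<in> \<Omega>) * f i j)"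
proof -
  have "(\<Sum>(i, j)\<in>\<Omega>. f i j) = (\<Sum>e\<in>{..<d} \<times> {..<d}. if e \<in> \<Omega> then (case e of (i, j) \<Rightarrow> f i j) else 0)"
    using assms by (simp add: sum.inter_restrict[symmetric] Int_absorb1)
  also have "\<dots> = (\<Sum>(i, j)\<in>{..<d} \<times> {..<d}. of_bool ((i, j) \<in> \<Omega>) * f i j)"
    by (intro sum.cong) auto
  finally show ?thesis by (simp only: sum.cartesian_product)
qed

text \<open>An affine function on a box is minimal at a vertex; applied in both arguments of the bilinear
  form, this reduces bounded vectors to indicator vectors.\<close>

lemma bilinear_bound_from_cuts:
  fixes \<Omega> :: "(nat \<times> nat) set" and x :: "nat \<Rightarrow> real"
  assumes \<Omega>: "\<Omega> \<subseteq> {..<d} \<times> {..<d}" and B: "0 \<le> B"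
    and cuts: "\<And>S S'. S \<subseteq> {..<d} \<Longrightarrow> S' \<subseteq> {..<d} \<Longrightarrow>
      (\<Sum>(i, j)\<in>\<Omega>. of_bool (i \<in> S) * of_bool (j \<in> S'))
        \<le> c * (real (card S) * real (card S')) + lam * (real (card S) + real (card S'))"
    and x: "\<And>i. i < d \<Longrightarrow> 0 \<le> x i \<and> x i \<le> B"
  shows "(\<Sum>(i, j)\<in>\<Omega>. x i * x j) \<le> c * (\<Sum>i<d. x i)\<^sup>2 + 2 * lam * B * (\<Sum>i<d. x i)"
proof -
  define \<omega> :: "nat \<Rightarrow> nat \<Rightarrow> real" where "\<omega> i j = of_bool ((i, j) \<in> \<Omega>)" for i j
  note sum_\<Omega> = sum_pattern[OF \<Omega>, folded \<omega>_def]
  \<comment> \<open>The slack in the claim, affine in each argument. The factor \<open>B\<close> in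
    the linear part makes it B^2 times the slack in \<open>cuts\<close> when both arguments are B
    times indicators.\<close>
  define \<Phi> where "\<Phi> y w = c * ((\<Sum>i<d. y i) * (\<Sum>j<d. w j)) + lam * B * ((\<Sum>i<d. y i) + (\<Sum>j<d. w j))
      - (\<Sum>i<d. \<Sum>j<d. \<omega> i j * (y i * w j))" for y w :: "nat \<Rightarrow> real"
  have vertex: "\<exists>S\<subseteq>{..<d}. (\<Sum>i<d. (B * of_bool (i \<in> S)) * \<gamma> i) \<le> (\<Sum>i<d. x i * \<gamma> i)" for \<gamma> :: "nat \<Rightarrow> real"
  proof (intro exI[of _ "{i. i < d \<and> \<gamma> i < 0}"] conjI sum_mono)
    fix i assume "i \<in> {..<d}"
    then show "(B * of_bool (i \<in> {i. i < d \<and> \<gamma> i < 0})) * \<gamma> i \<le> x i * \<gamma> i"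
      using x[of i] by (auto simp: mult_right_mono_neg)
  qed auto
  have expand: "(\<Sum>i<d. u i * (K - g i)) = K * (\<Sum>i<d. u i) - (\<Sum>i<d. u i * g i)" for u g :: "nat \<Rightarrow> real" and K
    by (simp add: right_diff_distrib sum_subtractf sum_distrib_left mult.commute)
  have left: "\<Phi> y w = (\<Sum>i<d. y i * (c * (\<Sum>j<d. w j) + lam * B - (\<Sum>j<d. \<omega> i j * w j))) + lam * B * (\<Sum>j<d. w j)" for y w
  proof -
    have "(\<Sum>i<d. y i * (\<Sum>j<d. \<omega> i j * w j)) = (\<Sum>i<d. \<Sum>j<d. \<omega> i j * (y i * w j))"
      by (simp add: sum_distrib_left mult_ac)
    then show ?thesis unfolding \<Phi>_def expand by (simp add: algebra_simps)
  qed
  have right: "\<Phi> y w = (\<Sum>j<d. w j * (c * (\<Sum>i<d. y i) + lam * B - (\<Sum>i<d. \<omega> i j * y i))) + lam * B * (\<Sum>i<d. y i)" for y w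
  proof -
    have "(\<Sum>j<d. w j * (\<Sum>i<d. \<omega> i j * y i)) = (\<Sum>i<d. \<Sum>j<d. \<omega> i j * (y i * w j))"
      unfolding sum.swap[of "\<lambda>i j. \<omega> i j * (y i * w j)"] by (simp add: sum_distrib_left mult_ac)
    then show ?thesis unfolding \<Phi>_def expand by (simp add: algebra_simps)
  qed
  obtain S where S: "S \<subseteq> {..<d}" "\<Phi> (\<lambda>i. B * of_bool (i \<in> S)) x \<le> \<Phi> x x"
    unfolding left using vertex[of "\<lambda>i. c * (\<Sum>j<d. x j) + lam * B - (\<Sum>j<d. \<omega> i j * x j)"] by auto
  obtain S' where S': "S' \<subseteq> {..<d}"
    "\<Phi> (\<lambda>i. B * of_bool (i \<in> S)) (\<lambda>j. B * of_bool (j \<in> S')) \<le> \<Phi> (\<lambda>i. B * of_bool (i \<in> S)) x"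
    unfolding right using vertex[of "\<lambda>j. c * (\<Sum>i<d. B * of_bool (i \<in> S)) + lam * B - (\<Sum>i<d. \<omega> i j * (B * of_bool (i \<in> S)))"] by auto
  have card: "(\<Sum>i<d. B * of_bool (i \<in> X)) = B * real (card X)" if "X \<subseteq> {..<d}" for X
    using that by (simp add: sum_distrib_left[symmetric] Int_absorb1)
  have "(\<Sum>i<d. \<Sum>j<d. \<omega> i j * ((B * of_bool (i \<in> S)) * (B * of_bool (j \<in> S'))))
      = B * B * (\<Sum>(i, j)\<in>\<Omega>. of_bool (i \<in> S) * of_bool (j \<in> S'))"
    unfolding sum_\<Omega> by (simp add: sum_distrib_left mult_ac)
  also have "\<dots> \<le> B * B * (c * (real (card S) * real (card S')) + lam * (real (card S) + real (card S')))"
    using B by (intro mult_left_mono cuts S S') auto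
  finally have "0 \<le> \<Phi> (\<lambda>i. B * of_bool (i \<in> S)) (\<lambda>j. B * of_bool (j \<in> S'))"
    unfolding \<Phi>_def card[OF S(1)] card[OF S'(1)] by (simp add: algebra_simps)
  then have "0 \<le> \<Phi> x x" using S S' by linarith
  then show ?thesis
    unfolding \<Phi>_def sum_\<Omega> by (simp add: power2_eq_square algebra_simps)
qed

section \<open>The three properties of a good pattern and their probability\<close>

lemma sum_split_indicator:
  fixes f :: "nat \<times> nat \<Rightarrow> real"
  assumes "i < d"
  shows "(\<Sum>(x, k)\<in>{..<d} \<times> {..<r}. (if x = i then g k else 0) * f (x, k)) = (\<Sum>k<r. g k * f (i, k))"
proof -
  have "(\<Sum>(x, k)\<in>{..<d} \<times> {..<r}. (if x = i then g k else 0) * f (x, k))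
      = (\<Sum>x<d. if x = i then \<Sum>k<r. g k * f (x, k) else 0)"
    by (subst sum.cartesian_product[symmetric], intro sum.cong) auto
  also have "\<dots> = (\<Sum>k<r. g k * f (i, k))" using assms by simp
  finally show ?thesis .
qed

lemma sum_ip_orthogonal_columns:
  fixes a :: "nat \<Rightarrow> nat \<Rightarrow> real"
  assumes "\<And>k l. k < r \<Longrightarrow> l < r \<Longrightarrow> (\<Sum>i<d. a i k * a i l) = (if k = l then s else 0)"
  shows "(\<Sum>i<d. ip {..<r} (a i) u * ip {..<r} (a i) w) = s * ip {..<r} u w"
proof -
  have "(\<Sum>i<d. ip {..<r} (a i) u * ip {..<r} (a i) w)
      = (\<Sum>i<d. \<Sum>k<r. \<Sum>l<r. u k * w l * (a i k * a i l))"
    by (simp add: ip_def sum_product mult_ac)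
  also have "\<dots> = (\<Sum>k<r. \<Sum>i<d. \<Sum>l<r. u k * w l * (a i k * a i l))"
    by (rule sum.swap)
  also have "\<dots> = (\<Sum>k<r. \<Sum>l<r. u k * w l * (\<Sum>i<d. a i k * a i l))"
    unfolding sum_distrib_left by (intro sum.cong[OF refl] sum.swap)
  also have "\<dots> = (\<Sum>k<r. \<Sum>l<r. u k * w l * (if k = l then s else 0))"
    by (intro sum.cong refl) (simp add: assms)
  also have "\<dots> = (\<Sum>k<r. u k * w k * s)"
    by (intro sum.cong refl) (simp add: if_distrib cong: if_cong)
  finally show ?thesis by (simp add: ip_def sum_distrib_left mult_ac)
qed

text \<open>Entry (i, j) of X = A H^T + H A^T, with \<open>a i\<close> and \<open>h i\<close> the
  rows of A and H; X is the derivative of A A^T in direction H.\<close>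

abbreviation tangent :: "nat \<Rightarrow> (nat \<Rightarrow> nat \<Rightarrow> real) \<Rightarrow> (nat \<Rightarrow> nat \<Rightarrow> real) \<Rightarrow> nat \<Rightarrow> nat \<Rightarrow> real" where
  "tangent r a h i j \<equiv> ip {..<r} (a i) (h j) + ip {..<r} (a j) (h i)"

text \<open>In the second condition \<open>x\<close> stands for the squared row norms of a
  deviation, and \<open>B\<close> caps them. The fractions 1/25 and 1/2 are the losses that the
  descent argument can afford.\<close>

definition good_pattern ::
  "nat \<Rightarrow> nat \<Rightarrow> real \<Rightarrow> real \<Rightarrow> real \<Rightarrow> (nat \<Rightarrow> nat \<Rightarrow> real) \<Rightarrow> (nat \<times> nat) set \<Rightarrow> bool" where
  "good_pattern d r p s B a \<Omega> \<longleftrightarrow>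
    (\<forall>i<d. (\<Sum>j<d. of_bool ((i, j) \<in> \<Omega>)) \<le> 2 * p * real d) \<and>
    (\<forall>x. (\<forall>i<d. 0 \<le> x i \<and> x i \<le> B) \<longrightarrow>
      (\<Sum>(i, j)\<in>\<Omega>. x i * x j) \<le> 3/2 * p * (\<Sum>i<d. x i)\<^sup>2 + p * s / 25 * (\<Sum>i<d. x i)) \<and>
    (\<forall>h. p * (\<Sum>i<d. \<Sum>j<d. (tangent r a h i j)\<^sup>2)
        - p * s / 2 * (\<Sum>i<d. ip {..<r} (h i) (h i))
      \<le> (\<Sum>(i, j)\<in>\<Omega>. (tangent r a h i j)\<^sup>2))"

text \<open>The mean degree is p d: the Chernoff bound 3/2 p d and a slack of p d / 2 add up to 2 p
  d.\<close>

lemma degree_bound: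
  assumes p: "0 \<le> p" "p \<le> 1"
  shows "subset_prob (lower_pairs d) p (\<lambda>T. \<exists>i\<in>{..<d}. 2 * p * real d < (\<Sum>j<d. of_bool ((i, j) \<in> sym_cl T)))
    \<le> real d * exp (- (p * real d) / 8)"
proof -
  have "subset_prob (lower_pairs d) p (\<lambda>T. 2 * p * real d < (\<Sum>j<d. of_bool ((i, j) \<in> sym_cl T)))
      \<le> exp (- (p * real d) / 8)" if i: "i < d" for i
  proof -
    have "subset_prob (lower_pairs d) p (\<lambda>T. 2 * p * real d < (\<Sum>j<d. of_bool ((i, j) \<in> sym_cl T)))
      \<le> subset_prob (lower_pairs d) p (\<lambda>T. 3/2 * p * (\<Sum>x<d. \<Sum>j<d. of_bool (x = i)) + p * real d / 2
          < (\<Sum>(x, j)\<in>sym_cl T. of_bool (x = i)))"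
    proof (rule subset_prob_mono[OF p])
      fix T assume T: "T \<subseteq> lower_pairs d" "2 * p * real d < (\<Sum>j<d. of_bool ((i, j) \<in> sym_cl T))"
      have fin: "finite (sym_cl T)" using sym_cl_subset[OF T(1)] finite_subset by blast
      have "(\<Sum>(x, j)\<in>sym_cl T. of_bool (x = i)) = (\<Sum>(x, j)\<in>Pair i ` {j. (i, j) \<in> sym_cl T}. (1::real))"
        by (rule sum.mono_neutral_cong_right) (use fin in auto)
      also have "\<dots> = (\<Sum>j\<in>{j. (i, j) \<in> sym_cl T}. (1::real))"
        by (subst sum.reindex) (auto simp: inj_on_def)
      also have "\<dots> = (\<Sum>j<d. of_bool ((i, j) \<in> sym_cl T))"
        by (rule sum.mono_neutral_cong_left) (use sym_cl_subset[OF T(1)] in auto)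
      finally have "2 * p * real d < (\<Sum>(x, j)\<in>sym_cl T. of_bool (x = i))" using T by simp
      moreover have "(\<Sum>x<d. \<Sum>j<d. of_bool (x = i)) = real d"
      proof -
        have "(\<Sum>x<d. \<Sum>j<d. of_bool (x = i)) = (\<Sum>x<d. if x = i then real d else 0)"
          by (intro sum.cong) auto
        then show ?thesis using i by simp
      qed
      ultimately show "3/2 * p * (\<Sum>x<d. \<Sum>j<d. of_bool (x = i)) + p * real d / 2
          < (\<Sum>(x, j)\<in>sym_cl T. of_bool (x = i))" by (simp only:)
    qed
    also have "\<dots> \<le> exp (- (p * real d / 2) / 4)"
      by (rule sym_cl_sum_chernoff[OF p]) auto
    finally show ?thesis by simp
  qed
  then have "(\<Sum>i\<in>{..<d}. subset_prob (lower_pairs d) p (\<lambda>T. 2 * p * real d < (\<Sum>j<d. of_bool ((i, j) \<in> sym_cl T))))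
      \<le> (\<Sum>i\<in>{..<d}. exp (- (p * real d) / 8))" by (intro sum_mono) auto
  then show ?thesis
    using subset_prob_bex[OF p, of "{..<d}" "lower_pairs d"
      "\<lambda>i T. 2 * p * real d < (\<Sum>j<d. of_bool ((i, j) \<in> sym_cl T))"] by simp
qed

text \<open>Each entry of X is the inner product of H with a fixed d x r matrix, so the sampled
  square norm of X is a random sum of rank-one forms. The fixed matrices have squared norm at most 4
  b, and (x + y)^2 \<le> 2 x^2 + 2 y^2 together with A^T A = s I bounds the full sum by 4 s |H|^2;
  these are \<open>R\<close> and \<open>S\<close> of the concentration theorem.\<close>

lemma tangent_concentration:
  fixes a :: "nat \<Rightarrow> nat \<Rightarrow> real"
  assumes p: "0 \<le> p" "p \<le> 1" and s: "0 < s" and b: "0 < b" and q: "0 < q"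
    and orth: "\<And>k l. k < r \<Longrightarrow> l < r \<Longrightarrow> (\<Sum>i<d. a i k * a i l) = (if k = l then s else 0)"
    and rows: "\<And>i. i < d \<Longrightarrow> ip {..<r} (a i) (a i) \<le> b"
    and \<epsilon>: "0 < \<epsilon>"
  shows "subset_prob (lower_pairs d) p (\<lambda>T. \<exists>h.
      \<epsilon> * (\<Sum>i<d. ip {..<r} (h i) (h i))
      < \<bar>(\<Sum>(i, j)\<in>sym_cl T. (tangent r a h i j)\<^sup>2)
         - p * (\<Sum>i<d. \<Sum>j<d. (tangent r a h i j)\<^sup>2)\<bar>)
    \<le> real (d * r) * (((2 * real q * (4 * b))\<^sup>2 + 8 * real q * (4 * b) * p * (4 * s)) / \<epsilon>\<^sup>2) ^ q"
proof -
  define I where "I = {..<d} \<times> {..<r}"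
  define E where "E = lower_pairs d"
  \<comment> \<open>The weight sqrt 2 lets one lower pair stand for both ordered positions.\<close>
  define wt :: "nat \<times> nat \<Rightarrow> real" where "wt e = (if fst e = snd e then 1 else sqrt 2)" for e
  define v where "v e = (\<lambda>(x, k). wt e * ((if x = snd e then a (fst e) k else 0) + (if x = fst e then a (snd e) k else 0)))"
    for e :: "nat \<times> nat"
  interpret rank_one_family I E v
    by unfold_locales (simp_all add: I_def E_def finite_lower_pairs)
  define X where "X h i j = tangent r a h i j" for h and i j :: nat
  have ip_v: "ip I (v e) f = wt e * (ip {..<r} (a (fst e)) (\<lambda>k. f (snd e, k)) + ip {..<r} (a (snd e)) (\<lambda>k. f (fst e, k)))"
    if "e \<in> E" for e f
  proof -
    have e: "fst e < d" "snd e < d" using that by (auto simp: E_def lower_pairs_def)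
    have "ip I (v e) f = wt e * ((\<Sum>(x, k)\<in>{..<d} \<times> {..<r}. (if x = snd e then a (fst e) k else 0) * f (x, k))
       + (\<Sum>(x, k)\<in>{..<d} \<times> {..<r}. (if x = fst e then a (snd e) k else 0) * f (x, k)))"
      unfolding sum.distrib[symmetric] sum_distrib_left ip_def I_def v_def
      by (intro sum.cong) (auto simp: algebra_simps)
    then show ?thesis unfolding sum_split_indicator[OF e(1)] sum_split_indicator[OF e(2)] by (simp add: ip_def)
  qed
  have sq_v: "(ip I (v e) f)\<^sup>2 = fold_sym (\<lambda>i j. (X (\<lambda>i k. f (i, k)) i j)\<^sup>2) e" if "e \<in> E" for e f
    unfolding ip_v[OF that]
    by (auto simp: power_mult_distrib wt_def fold_sym_def X_def add.commute split: prod.split)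
  have ip_I: "ip I f f = (\<Sum>i<d. ip {..<r} (\<lambda>k. f (i, k)) (\<lambda>k. f (i, k)))" for f
    unfolding ip_def I_def by (simp add: sum.cartesian_product)
  have norm_v: "ip I (v e) (v e) \<le> 4 * b" if e: "e \<in> E" for e
  proof -
    have d: "fst e < d" "snd e < d" using that by (auto simp: E_def lower_pairs_def)
    show ?thesis
    proof (cases "fst e = snd e")
      case True
      have "ip I (v e) (v e) = 4 * ip {..<r} (a (fst e)) (a (fst e))"
        unfolding ip_v[OF e] using True by (simp add: v_def wt_def ip_def sum_distrib_left sum.distrib[symmetric] algebra_simps)
      then show ?thesis using rows[OF d(1)] by simp
    next
      case False
      have "ip I (v e) (v e) = sqrt 2 * (ip {..<r} (a (fst e)) (\<lambda>k. sqrt 2 * a (fst e) k)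
          + ip {..<r} (a (snd e)) (\<lambda>k. sqrt 2 * a (snd e) k))"
        unfolding ip_v[OF e] using False by (simp add: v_def wt_def)
      also have "\<dots> = 2 * ip {..<r} (a (fst e)) (a (fst e)) + 2 * ip {..<r} (a (snd e)) (a (snd e))"
        by (simp add: ip_scale_right distrib_left mult.assoc[symmetric])
      finally show ?thesis using rows[OF d(1)] rows[OF d(2)] by simp
    qed
  qed
  have frame: "(\<Sum>e\<in>E. (ip I (v e) f)\<^sup>2) \<le> 4 * s * ip I f f" for f
  proof -
    define h where "h i k = f (i, k)" for i k
    have col: "(\<Sum>i<d. (ip {..<r} (a i) u)\<^sup>2) = s * ip {..<r} u u" for u
      using sum_ip_orthogonal_columns[OF orth, of r u u] by (simp add: power2_eq_square)
    have "(\<Sum>e\<in>E. (ip I (v e) f)\<^sup>2) = (\<Sum>e\<in>E. fold_sym (\<lambda>i j. (X h i j)\<^sup>2) e)"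
      by (intro sum.cong) (simp_all add: sq_v h_def[abs_def])
    also have "\<dots> = (\<Sum>i<d. \<Sum>j<d. (X h i j)\<^sup>2)"
      unfolding E_def by (rule sum_lower_pairs)
    also have "\<dots> \<le> (\<Sum>i<d. \<Sum>j<d. 2 * (ip {..<r} (a i) (h j))\<^sup>2 + 2 * (ip {..<r} (a j) (h i))\<^sup>2)"
    proof (intro sum_mono)
      fix i j
      show "(X h i j)\<^sup>2 \<le> 2 * (ip {..<r} (a i) (h j))\<^sup>2 + 2 * (ip {..<r} (a j) (h i))\<^sup>2"
        using sum_squares_ge_zero[of "ip {..<r} (a i) (h j) - ip {..<r} (a j) (h i)" 0]
        unfolding X_def by (simp add: power2_eq_square algebra_simps)
    qed
    also have "\<dots> = 2 * (\<Sum>j<d. \<Sum>i<d. (ip {..<r} (a i) (h j))\<^sup>2) + 2 * (\<Sum>i<d. \<Sum>j<d. (ip {..<r} (a j) (h i))\<^sup>2)"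
      unfolding sum.distrib by (subst sum.swap) (simp add: sum_distrib_left)
    also have "\<dots> = 4 * s * ip I f f"
      unfolding col ip_I by (simp add: h_def[abs_def] sum_distrib_left mult.assoc)
    finally show ?thesis .
  qed
  have "subset_prob E p (\<lambda>T. \<exists>h. \<epsilon> * (\<Sum>i<d. ip {..<r} (h i) (h i))
      < \<bar>(\<Sum>(i, j)\<in>sym_cl T. (X h i j)\<^sup>2) - p * (\<Sum>i<d. \<Sum>j<d. (X h i j)\<^sup>2)\<bar>)
    \<le> subset_prob E p (\<lambda>T. \<exists>f. \<epsilon> * ip I f f < \<bar>(\<Sum>e\<in>T. (ip I (v e) f)\<^sup>2) - p * (\<Sum>e\<in>E. (ip I (v e) f)\<^sup>2)\<bar>)"
  proof (rule subset_prob_mono[OF p])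
    fix T assume T: "T \<subseteq> E" and "\<exists>h. \<epsilon> * (\<Sum>i<d. ip {..<r} (h i) (h i))
      < \<bar>(\<Sum>(i, j)\<in>sym_cl T. (X h i j)\<^sup>2) - p * (\<Sum>i<d. \<Sum>j<d. (X h i j)\<^sup>2)\<bar>"
    then obtain h where h: "\<epsilon> * (\<Sum>i<d. ip {..<r} (h i) (h i))
      < \<bar>(\<Sum>(i, j)\<in>sym_cl T. (X h i j)\<^sup>2) - p * (\<Sum>i<d. \<Sum>j<d. (X h i j)\<^sup>2)\<bar>" by blast
    define f where "f = (\<lambda>(i, k). h i k)"
    have fh: "(\<lambda>i k. f (i, k)) = h" by (simp add: f_def)
    have "(\<Sum>e\<in>T. (ip I (v e) f)\<^sup>2) = (\<Sum>e\<in>T. fold_sym (\<lambda>i j. (X h i j)\<^sup>2) e)" if "T \<subseteq> E" for T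
      using that by (intro sum.cong) (auto simp: sq_v fh)
    then have "(\<Sum>e\<in>T. (ip I (v e) f)\<^sup>2) = (\<Sum>(i, j)\<in>sym_cl T. (X h i j)\<^sup>2)"
      "(\<Sum>e\<in>E. (ip I (v e) f)\<^sup>2) = (\<Sum>i<d. \<Sum>j<d. (X h i j)\<^sup>2)"
      using T by (simp_all add: sum_sym_cl[of _ d] sum_lower_pairs E_def)
    moreover have "ip I f f = (\<Sum>i<d. ip {..<r} (h i) (h i))"
      unfolding ip_I by (simp add: f_def)
    ultimately show "\<exists>f. \<epsilon> * ip I f f < \<bar>(\<Sum>e\<in>T. (ip I (v e) f)\<^sup>2) - p * (\<Sum>e\<in>E. (ip I (v e) f)\<^sup>2)\<bar>"
      using h by (intro exI[of _ f]) simp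
  qed
  also have "\<dots> \<le> real (card I) * (((2 * real q * (4 * b))\<^sup>2 + 8 * real q * (4 * b) * p * (4 * s)) / \<epsilon>\<^sup>2) ^ q"
    by (rule rank_one_sum_concentration) (use p b s q \<epsilon> norm_v frame in auto)
  finally show ?thesis by (simp add: X_def I_def E_def)
qed

lemma exp_minus_mult_ln:
  assumes "0 < x"
  shows "exp (- (real n * ln x)) = 1 / x ^ n"
  using assms by (simp add: exp_minus exp_of_nat_mult inverse_eq_divide)

lemma one_plus_power_le:
  fixes z :: real
  assumes "0 \<le> z" "real n * z \<le> 1"
  shows "(1 + z) ^ n - 1 \<le> 2 * (real n * z)"
proof -
  have "(1 + z) ^ n \<le> exp z ^ n" using assms by (intro power_mono) auto
  also have "\<dots> = exp (real n * z)" by (simp add: exp_of_nat_mult)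
  also have "\<dots> \<le> 1 + real n * z + (real n * z)\<^sup>2" by (rule exp_bound) (use assms in auto)
  also have "(real n * z)\<^sup>2 \<le> real n * z * 1"
    unfolding power2_eq_square by (intro mult_left_mono) (use assms in auto)
  finally show ?thesis by (simp add: mult.commute)
qed

text \<open>Each of the three properties fails with probability at most d^-3. The cap 75 \<beta> s /
  d equals 25 \<tau>^2 at the largest radius that will occur, d \<tau>^2 = 3 \<beta> s; the
  truncated deviation has rows of norm at most 5 \<tau>.\<close>

lemma good_pattern_prob:
  fixes a :: "nat \<Rightarrow> nat \<Rightarrow> real" and \<beta> :: real
  assumes p: "0 < p" "p \<le> 1" and r: "r \<le> d" and s: "0 < s" and \<beta>: "1 \<le> \<beta>"
    and orth: "\<And>k l. k < r \<Longrightarrow> l < r \<Longrightarrow> (\<Sum>i<d. a i k * a i l) = (if k = l then s else 0)"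
    and rows: "\<And>i. i < d \<Longrightarrow> ip {..<r} (a i) (a i) \<le> \<beta> * s / real d"
    and size: "1000000 \<le> p * real d" "1000000 * (\<beta> * ln (real d)) \<le> p * real d"
  shows "subset_prob (lower_pairs d) p (\<lambda>T. \<not> good_pattern d r p s (75 * (\<beta> * s / real d)) a (sym_cl T))
    \<le> 4 / real d ^ 3"
proof -
  define L where "L = ln (real d)"
  have p': "0 \<le> p" "p \<le> 1" using p by auto
  have "p * real d \<le> 1 * real d" using p by (intro mult_right_mono) auto
  then have d6: "1000000 \<le> real d" using size by linarith
  then have d0: "0 < real d" "1 \<le> real d" by auto
  have L1: "1 \<le> L"
  proof -
    have "exp 1 \<le> real d" using e_less_272 d6 by simp
    then show ?thesis unfolding L_def using d0 ln_ge_iff by blast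
  qed
  have \<beta>L: "1000000 * (\<beta> * L) \<le> p * real d" using size by (simp add: L_def)
  have "L \<le> \<beta> * L" using \<beta> L1 by simp
  then have pdL: "1000000 * L \<le> p * real d" using \<beta>L by linarith
  define b where "b = \<beta> * s / real d"
  have b: "0 < b" using \<beta> s d0 by (simp add: b_def)
  \<comment> \<open>The form in which the sample size is used: ln d times the bound on squared row
    norms is small against p s.\<close>
  have Lb: "1000000 * (L * b) \<le> p * s"
  proof -
    have "1000000 * (L * b) = (1000000 * (\<beta> * L)) * s / real d" by (simp add: b_def)
    also have "\<dots> \<le> (p * real d) * s / real d"
      by (intro divide_right_mono mult_right_mono \<beta>L) (use s in auto)
    finally show ?thesis using d0 by simp
  qed
  \<comment> \<open>Makes exp (- lam / 4) equal to d^-6, so that the union bound over all cuts is at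
    most (2 d d^-6)^2 = 4 d^-10.\<close>
  define lam where "lam = 24 * L"
  define Q1 where "Q1 T \<longleftrightarrow> (\<exists>i\<in>{..<d}. 2 * p * real d < (\<Sum>j<d. of_bool ((i, j) \<in> sym_cl T)))" for T
  define Q2 where "Q2 T \<longleftrightarrow> (\<exists>S\<in>Pow {..<d}. \<exists>S'\<in>Pow {..<d}.
      3/2 * p * (real (card S) * real (card S')) + lam * (real (card S) + real (card S'))
        < (\<Sum>(i, j)\<in>sym_cl T. of_bool (i \<in> S) * of_bool (j \<in> S')))" for T
  define Q3 where "Q3 T \<longleftrightarrow> (\<exists>h. p * s / 2 * (\<Sum>i<d. ip {..<r} (h i) (h i))
      < \<bar>(\<Sum>(i, j)\<in>sym_cl T. (tangent r a h i j)\<^sup>2)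
         - p * (\<Sum>i<d. \<Sum>j<d. (tangent r a h i j)\<^sup>2)\<bar>)" for T
  have 1: "subset_prob (lower_pairs d) p Q1 \<le> 1 / real d ^ 3"
  proof -
    have "subset_prob (lower_pairs d) p Q1 \<le> real d * exp (- (p * real d) / 8)"
      unfolding Q1_def by (rule degree_bound[OF p'])
    also have "\<dots> \<le> real d * exp (- (real 4 * ln (real d)))"
      using pdL L1 by (intro mult_left_mono) (auto simp: L_def)
    also have "\<dots> = 1 / real d ^ 3"
      unfolding exp_minus_mult_ln[OF d0(1)] using d0 by (simp add: eval_nat_numeral)
    finally show ?thesis .
  qed
  have 2: "subset_prob (lower_pairs d) p Q2 \<le> 1 / real d ^ 3"
  proof -
    define z where "z = exp (- lam / 4)"
    have z: "z = 1 / real d ^ 6"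
      using exp_minus_mult_ln[OF d0(1), of 6] by (simp add: z_def lam_def L_def)
    have dz: "real d * z = 1 / real d ^ 5" using d0 by (simp add: z eval_nat_numeral)
    have "1 / real d ^ 5 \<le> 1" using d0 by simp
    then have "(1 + z) ^ d - 1 \<le> 2 * (real d * z)"
      using dz by (intro one_plus_power_le) (auto simp: z_def)
    moreover have "0 \<le> (1 + z) ^ d - 1" by (simp add: z_def one_le_power)
    ultimately have "((1 + z) ^ d - 1)\<^sup>2 \<le> (2 * (real d * z))\<^sup>2" by (intro power_mono)
    also have "\<dots> = (4 / real d ^ 7) * (1 / real d ^ 3)" by (simp add: dz power_divide)
    also have "\<dots> \<le> 1 * (1 / real d ^ 3)"
    proof (intro mult_right_mono)
      have "4 \<le> real d ^ 1" using d6 by simp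
      also have "\<dots> \<le> real d ^ 7" using d0 by (intro power_increasing) auto
      finally show "4 / real d ^ 7 \<le> 1" using d0 by simp
    qed auto
    finally have "((1 + z) ^ d - 1)\<^sup>2 \<le> 1 / real d ^ 3" by simp
    moreover have "subset_prob (lower_pairs d) p Q2 \<le> ((1 + z) ^ d - 1)\<^sup>2"
      unfolding Q2_def z_def by (rule cut_sum_bound[OF p']) (use L1 in \<open>simp add: lam_def\<close>)
    ultimately show ?thesis by linarith
  qed
  have 3: "subset_prob (lower_pairs d) p Q3 \<le> 1 / real d ^ 3"
  proof -
    \<comment> \<open>With a ratio of at most exp (-1) per moment, 5 ln d moments give d^-5, which
      outweighs the dimension d r \<le> d^2.\<close>
    define q where "q = nat \<lceil>5 * L\<rceil>"
    have q: "5 * L \<le> real q" "real q \<le> 6 * L" "0 < q" using L1 by (auto simp: q_def) linarith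
    define \<Gamma> where "\<Gamma> = (2 * real q * (4 * b))\<^sup>2 + 8 * real q * (4 * b) * p * (4 * s)"
    define y where "y = real q * b"
    have "y \<le> 6 * (L * b)" using q b by (simp add: y_def)
    then have y: "1000000 * y \<le> 6 * (p * s)" using Lb by linarith
    have y0: "0 \<le> y" using b by (simp add: y_def)
    have "\<Gamma> = 64 * y\<^sup>2 + 128 * (y * (p * s))"
      by (simp add: \<Gamma>_def y_def power2_eq_square)
    also have "\<dots> \<le> 64 * (1/1000 * (p * s))\<^sup>2 + 128 * ((6/1000000 * (p * s)) * (p * s))"
      using y y0 p s by (intro add_mono mult_left_mono power_mono mult_right_mono) auto
    also have "\<dots> \<le> 1/3 * (p * s / 2)\<^sup>2"
    proof -
      have "0 \<le> (p * s) * (p * s)" by simp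
      then show ?thesis by (simp add: power2_eq_square mult_ac)
    qed
    finally have "\<Gamma> / (p * s / 2)\<^sup>2 \<le> 1/3" using p s by (simp add: divide_le_eq)
    also have "1/3 \<le> exp (-1::real)"
    proof -
      have "exp (1::real) \<le> 3" using e_less_272 by simp
      then have "1 / 3 \<le> 1 / exp (1::real)" by (intro divide_left_mono) auto
      then show ?thesis by (simp add: exp_minus inverse_eq_divide)
    qed
    finally have \<Gamma>: "\<Gamma> / (p * s / 2)\<^sup>2 \<le> exp (-1)" .
    have "0 \<le> \<Gamma>" using p s b by (simp add: \<Gamma>_def)
    have "subset_prob (lower_pairs d) p Q3 \<le> real (d * r) * (\<Gamma> / (p * s / 2)\<^sup>2) ^ q"
      unfolding Q3_def \<Gamma>_def
      by (rule tangent_concentration[OF p' s b q(3) orth rows[folded b_def]]) (use p s in auto)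
    also have "\<dots> \<le> real (d * r) * exp (-1) ^ q"
      using \<Gamma> \<open>0 \<le> \<Gamma>\<close> by (intro mult_left_mono power_mono) auto
    also have "exp (-1::real) ^ q = exp (- real q)" by (simp add: exp_of_nat_mult[symmetric])
    also have "real (d * r) * exp (- real q) \<le> real d * real d * exp (- (real 5 * ln (real d)))"
      using q r by (intro mult_mono) (auto simp: L_def intro: mult_left_mono)
    also have "\<dots> = 1 / real d ^ 3"
      unfolding exp_minus_mult_ln[OF d0(1)] using d0 by (simp add: eval_nat_numeral)
    finally show ?thesis .
  qed
  have good: "good_pattern d r p s (75 * (\<beta> * s / real d)) a (sym_cl T)"
    if T: "T \<subseteq> lower_pairs d" and "\<not> (Q1 T \<or> Q2 T \<or> Q3 T)" for T
    unfolding good_pattern_def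
  proof (intro conjI allI impI)
    fix i assume "i < d"
    then show "(\<Sum>j<d. of_bool ((i, j) \<in> sym_cl T)) \<le> 2 * p * real d"
      using that by (auto simp: Q1_def not_less)
  next
    fix x assume x: "\<forall>i<d. 0 \<le> x i \<and> x i \<le> 75 * (\<beta> * s / real d)"
    have "(\<Sum>(i, j)\<in>sym_cl T. x i * x j)
        \<le> 3/2 * p * (\<Sum>i<d. x i)\<^sup>2 + 2 * lam * (75 * b) * (\<Sum>i<d. x i)"
      by (rule bilinear_bound_from_cuts[OF sym_cl_subset[OF T]])
        (use that x b in \<open>auto simp: Q2_def not_less b_def\<close>)
    also have "2 * lam * (75 * b) * (\<Sum>i<d. x i) \<le> p * s / 25 * (\<Sum>i<d. x i)"
    proof (intro mult_right_mono sum_nonneg)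
      have "2 * lam * (75 * b) = 3600 * (L * b)" by (simp add: lam_def)
      then show "2 * lam * (75 * b) \<le> p * s / 25" using Lb mult_pos_pos[OF p(1) s] by linarith
    qed (use x in auto)
    finally show "(\<Sum>(i, j)\<in>sym_cl T. x i * x j)
        \<le> 3/2 * p * (\<Sum>i<d. x i)\<^sup>2 + p * s / 25 * (\<Sum>i<d. x i)" by simp
  next
    fix h :: "nat \<Rightarrow> nat \<Rightarrow> real"
    have "\<bar>(\<Sum>(i, j)\<in>sym_cl T. (tangent r a h i j)\<^sup>2)
         - p * (\<Sum>i<d. \<Sum>j<d. (tangent r a h i j)\<^sup>2)\<bar>
       \<le> p * s / 2 * (\<Sum>i<d. ip {..<r} (h i) (h i))"
      using that unfolding Q3_def not_less[symmetric] by blast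
    then show "p * (\<Sum>i<d. \<Sum>j<d. (tangent r a h i j)\<^sup>2)
        - p * s / 2 * (\<Sum>i<d. ip {..<r} (h i) (h i))
      \<le> (\<Sum>(i, j)\<in>sym_cl T. (tangent r a h i j)\<^sup>2)" by linarith
  qed
  have "subset_prob (lower_pairs d) p (\<lambda>T. \<not> good_pattern d r p s (75 * (\<beta> * s / real d)) a (sym_cl T))
      \<le> subset_prob (lower_pairs d) p (\<lambda>T. Q1 T \<or> Q2 T \<or> Q3 T)"
    by (rule subset_prob_mono[OF p']) (use good in blast)
  also have "\<dots> \<le> subset_prob (lower_pairs d) p Q1 + (subset_prob (lower_pairs d) p Q2 + subset_prob (lower_pairs d) p Q3)"
    by (intro order_trans[OF subset_prob_disj[OF p']] add_left_mono subset_prob_disj[OF p'])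
  also have "\<dots> \<le> 1 / real d ^ 3 + (1 / real d ^ 3 + 1 / real d ^ 3)"
    by (intro add_mono 1 2 3)
  also have "\<dots> \<le> 4 / real d ^ 3" using d0 by (simp add: divide_right_mono)
  finally show ?thesis .
qed

section \<open>One step of projected gradient descent\<close>

definition nm :: "'i set \<Rightarrow> ('i \<Rightarrow> real) \<Rightarrow> real" where
  "nm I u = sqrt (ip I u u)"

lemma nm_nonneg: "0 \<le> nm I u"
  by (simp add: nm_def ip_self_nonneg)

lemma nm_sq: "(nm I u)\<^sup>2 = ip I u u"
  by (simp add: nm_def ip_self_nonneg)

lemma abs_ip_le: "\<bar>ip I u w\<bar> \<le> nm I u * nm I w"
proof (rule power2_le_imp_le)
  show "\<bar>ip I u w\<bar>\<^sup>2 \<le> (nm I u * nm I w)\<^sup>2"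
    using ip_Cauchy_Schwarz[of I u w] by (simp add: power_mult_distrib nm_sq)
qed (simp add: nm_nonneg)

lemma nm_minus_le: "nm I (\<lambda>i. u i - w i) \<le> nm I u + nm I w"
proof (rule power2_le_imp_le)
  have "- ip I u w \<le> nm I u * nm I w" using abs_ip_le[of I u w] by linarith
  then show "(nm I (\<lambda>i. u i - w i))\<^sup>2 \<le> (nm I u + nm I w)\<^sup>2"
    by (simp add: nm_sq power2_sum ip_minus_left ip_minus_right ip_commute[of I w u])
qed (simp add: nm_nonneg)

lemma nm_le_iff: "0 \<le> c \<Longrightarrow> nm I u \<le> c \<longleftrightarrow> ip I u u \<le> c\<^sup>2"
  by (metis nm_nonneg nm_sq power2_le_imp_le power_mono)

lemma nm_le_plus: "nm I (\<lambda>i. u i) \<le> nm I (\<lambda>i. u i - w i) + nm I w"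
  using nm_minus_le[of I "\<lambda>i. u i - w i" "\<lambda>i. - w i"] by (simp add: nm_def ip_def)

lemma weighted_sum_ip_le:
  "ip I (\<lambda>k. \<Sum>i\<in>A. c i * u i k) (\<lambda>k. \<Sum>i\<in>A. c i * u i k)
    \<le> (\<Sum>i\<in>A. (c i)\<^sup>2) * (\<Sum>i\<in>A. ip I (u i) (u i))"
proof -
  have "ip I (\<lambda>k. \<Sum>i\<in>A. c i * u i k) (\<lambda>k. \<Sum>i\<in>A. c i * u i k)
      = (\<Sum>k\<in>I. (\<Sum>i\<in>A. c i * u i k)\<^sup>2)" by (simp add: ip_def power2_eq_square)
  also have "\<dots> \<le> (\<Sum>k\<in>I. (\<Sum>i\<in>A. (c i)\<^sup>2) * (\<Sum>i\<in>A. (u i k)\<^sup>2))"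
    by (intro sum_mono Cauchy_Schwarz_ineq_sum)
  also have "\<dots> = (\<Sum>i\<in>A. (c i)\<^sup>2) * (\<Sum>i\<in>A. ip I (u i) (u i))"
    unfolding ip_def power2_eq_square sum_distrib_left[symmetric] by (subst sum.swap) simp
  finally show ?thesis .
qed

text \<open>The deterministic data of one step, row by row: \<open>a\<close> is the nearest factor,
  \<open>f\<close> the current iterate, \<open>n\<close> the noise part of the gradient (with its
  sign reversed), \<open>f1\<close> the projected iterate. Here s = \<sigma>^2, \<beta> = \<mu> r,
  and \<tau> is the radius of the feasible rows. \<open>aligned\<close> says that A^T H is
  symmetric, and \<open>f1_proj\<close> is the obtuse-angle property of the projection onto a ball,
  tested at the row of the factor, which lies in the ball by \<open>rows\<close>.\<close>

locale descent_step =
  fixes d r :: nat and p s \<beta> \<tau> \<eta> \<nu> B :: real and \<Omega> :: "(nat \<times> nat) set"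
    and a f n f1 :: "nat \<Rightarrow> nat \<Rightarrow> real"
  assumes p: "0 < p" and s: "0 < s" and \<beta>: "1 \<le> \<beta>" and \<tau>: "0 < \<tau>"
    and \<Omega>: "\<Omega> \<subseteq> {..<d} \<times> {..<d}" and sym_\<Omega>: "sym \<Omega>"
    and orth: "\<And>k l. k < r \<Longrightarrow> l < r \<Longrightarrow> (\<Sum>i<d. a i k * a i l) = (if k = l then s else 0)"
    and rows: "\<And>i. i < d \<Longrightarrow> ip {..<r} (a i) (a i) \<le> \<tau>\<^sup>2"
    and radius: "real d * \<tau>\<^sup>2 \<le> 3 * \<beta> * s"
    and good: "good_pattern d r p s B a \<Omega>" and B: "25 * \<tau>\<^sup>2 \<le> B"
    and near: "(\<Sum>i<d. ip {..<r} (\<lambda>k. f i k - a i k) (\<lambda>k. f i k - a i k)) \<le> s / 25"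
    and aligned: "\<And>k l. k < r \<Longrightarrow> l < r \<Longrightarrow>
      (\<Sum>i<d. a i k * (f i l - a i l)) = (\<Sum>i<d. a i l * (f i k - a i k))"
    and \<eta>: "\<eta> * (1000000 * (\<beta>\<^sup>2 * s)) = 1"
    and noise: "(\<Sum>j<d. ip {..<r} (n j) (n j)) \<le> \<nu>"
    and f1_in: "\<And>j. j < d \<Longrightarrow> ip {..<r} (f1 j) (f1 j) \<le> \<tau>\<^sup>2"
    and f1_proj: "\<And>j. j < d \<Longrightarrow> ip {..<r}
      (\<lambda>k. f j k - \<eta> * (2 / p * (\<Sum>i<d. of_bool ((i, j) \<in> \<Omega>) * (ip {..<r} (f i) (f j) - ip {..<r} (a i) (a j)) * f i k)
          - n j k) - f1 j k)
      (\<lambda>k. a j k - f1 j k) \<le> 0"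
begin

abbreviation dt :: "(nat \<Rightarrow> real) \<Rightarrow> (nat \<Rightarrow> real) \<Rightarrow> real" where
  "dt \<equiv> ip {..<r}"

abbreviation nr :: "(nat \<Rightarrow> real) \<Rightarrow> real" where
  "nr \<equiv> nm {..<r}"

definition \<omega> :: "nat \<Rightarrow> nat \<Rightarrow> real" where
  "\<omega> i j = of_bool ((i, j) \<in> \<Omega>)"

text \<open>The initial matrix need not be feasible. On its exceptionally long rows the projection alone
  brings the iterate closer, so these rows are treated separately.\<close>

definition long :: "nat \<Rightarrow> bool" where
  "long i \<longleftrightarrow> 4 * \<tau> < nr (f i)"

definition h :: "nat \<Rightarrow> nat \<Rightarrow> real" where
  "h i k = f i k - a i k"

definition h' :: "nat \<Rightarrow> nat \<Rightarrow> real" where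
  "h' i k = (if long i then 0 else h i k)"

text \<open>The iterate with its long rows replaced by those of the factor. Its rows have norm at
  most 4 \<tau> and deviate by at most 5 \<tau>, as the bounds on the gradient and on Z
  require.\<close>

definition f' :: "nat \<Rightarrow> nat \<Rightarrow> real" where
  "f' i k = a i k + h' i k"

definition resid :: "nat \<Rightarrow> nat \<Rightarrow> real" where
  "resid i j = dt (f i) (f j) - dt (a i) (a j)"

definition resid' :: "nat \<Rightarrow> nat \<Rightarrow> real" where
  "resid' i j = dt (f' i) (f' j) - dt (a i) (a j)"

definition grad' :: "nat \<Rightarrow> nat \<Rightarrow> real" where
  "grad' j k = 2 / p * (\<Sum>i<d. \<omega> i j * resid' i j * f' i k)"

text \<open>What the truncation changes in the noiseless gradient.\<close>

definition bad :: "nat \<Rightarrow> nat \<Rightarrow> real" where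
  "bad j k = 2 / p * (\<Sum>i<d. \<omega> i j * resid i j * f i k) - grad' j k"

text \<open>The squared error carried by the long rows; \<open>hs\<close> is the remainder. The two
  are tracked separately up to the final estimate.\<close>

definition \<kappa> :: real where
  "\<kappa> = (\<Sum>i<d. if long i then dt (h i) (h i) else 0)"

definition hs :: real where
  "hs = (\<Sum>i<d. dt (h' i) (h' i))"

lemma \<omega>_sym: "\<omega> i j = \<omega> j i"
  using sym_\<Omega> by (auto simp: \<omega>_def sym_def)

lemma \<omega>_nonneg: "0 \<le> \<omega> i j"
  by (simp add: \<omega>_def)

lemma \<omega>_sq: "(\<omega> i j)\<^sup>2 = \<omega> i j"
  by (simp add: \<omega>_def)

lemma sum_\<omega>: "(\<Sum>(i, j)\<in>\<Omega>. g i j) = (\<Sum>i<d. \<Sum>j<d. \<omega> i j * g i j)" for g :: "nat \<Rightarrow> nat \<Rightarrow> real"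
  unfolding \<omega>_def by (rule sum_pattern[OF \<Omega>])

lemma good_quadratic:
  assumes "\<forall>i<d. 0 \<le> x i \<and> x i \<le> B"
  shows "(\<Sum>i<d. \<Sum>j<d. \<omega> i j * (x i * x j)) \<le> 3/2 * p * (\<Sum>i<d. x i)\<^sup>2 + p * s / 25 * (\<Sum>i<d. x i)"
proof -
  have "\<forall>x. (\<forall>i<d. 0 \<le> x i \<and> x i \<le> B) \<longrightarrow>
      (\<Sum>(i, j)\<in>\<Omega>. x i * x j) \<le> 3/2 * p * (\<Sum>i<d. x i)\<^sup>2 + p * s / 25 * (\<Sum>i<d. x i)"
    using good unfolding good_pattern_def by (elim conjE)
  then show ?thesis using assms unfolding sum_\<omega> by (elim allE[of _ x] impE)
qed

lemma degree: "i < d \<Longrightarrow> (\<Sum>j<d. \<omega> i j) \<le> 2 * p * real d"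
  using good unfolding good_pattern_def \<omega>_def by blast

lemma degree': "j < d \<Longrightarrow> (\<Sum>i<d. \<omega> i j) \<le> 2 * p * real d"
  using degree[of j] by (simp add: \<omega>_sym[of j])

lemma \<eta>_pos: "0 < \<eta>"
proof -
  have "0 < \<eta> * (1000000 * (\<beta>\<^sup>2 * s))" using \<eta> by simp
  moreover have "0 < 1000000 * (\<beta>\<^sup>2 * s)" using \<beta> s by simp
  ultimately show ?thesis by (rule zero_less_mult_pos2)
qed

lemma \<eta>s: "1000000 * (\<eta> * \<beta> * s) \<le> 1" "1000000 * (\<eta> * s) \<le> 1"
proof -
  have "\<beta> \<le> \<beta>\<^sup>2" using \<beta> by (simp add: power2_eq_square)
  then have "\<eta> * (1000000 * (\<beta> * s)) \<le> \<eta> * (1000000 * (\<beta>\<^sup>2 * s))"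
    "\<eta> * (1000000 * (1 * s)) \<le> \<eta> * (1000000 * (\<beta>\<^sup>2 * s))"
    using \<eta>_pos s \<beta> by (intro mult_left_mono mult_right_mono; simp)+
  then show "1000000 * (\<eta> * \<beta> * s) \<le> 1" "1000000 * (\<eta> * s) \<le> 1"
    using \<eta> by (simp_all add: mult_ac)
qed

lemma nr_a: "i < d \<Longrightarrow> nr (a i) \<le> \<tau>"
  using rows \<tau> by (simp add: nm_le_iff)

lemma nr_f1: "i < d \<Longrightarrow> nr (f1 i) \<le> \<tau>"
  using f1_in \<tau> by (simp add: nm_le_iff)

lemma nr_f1_a: "i < d \<Longrightarrow> nr (\<lambda>k. f1 i k - a i k) \<le> 2 * \<tau>"
  using nm_minus_le[of "{..<r}" "f1 i" "a i"] nr_a[of i] nr_f1[of i] by simp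

lemma nr_h_le: "i < d \<Longrightarrow> nr (h i) \<le> nr (f i) + \<tau>"
  using nm_minus_le[of "{..<r}" "f i" "a i"] nr_a[of i] by (simp add: h_def[abs_def])

lemma nr_f_le: "i < d \<Longrightarrow> nr (f i) \<le> nr (h i) + \<tau>"
  using nm_le_plus[of "{..<r}" "f i" "a i"] nr_a[of i] by (simp add: h_def[abs_def])

lemma long_h: "i < d \<Longrightarrow> long i \<Longrightarrow> 3 * \<tau> \<le> nr (h i)"
  using nr_f_le[of i] by (simp add: long_def)

lemma long_f_le:
  assumes "i < d" "long i"
  shows "dt (f i) (f i) \<le> 2 * dt (h i) (h i)"
proof -
  have "nr (f i) \<le> 4/3 * nr (h i)" using nr_f_le[OF assms(1)] long_h[OF assms] by simp
  then have "(nr (f i))\<^sup>2 \<le> (4/3 * nr (h i))\<^sup>2" by (intro power_mono nm_nonneg)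
  then show ?thesis using ip_self_nonneg[of "{..<r}" "h i"] by (simp add: power_mult_distrib nm_sq power_divide)
qed

lemma long_a_le:
  assumes "i < d" "long i"
  shows "dt (a i) (a i) \<le> dt (h i) (h i) / 9"
proof -
  have "nr (a i) \<le> 1/3 * nr (h i)" using nr_a[OF assms(1)] long_h[OF assms] by simp
  then have "(nr (a i))\<^sup>2 \<le> (1/3 * nr (h i))\<^sup>2" by (intro power_mono nm_nonneg)
  then show ?thesis by (simp add: power_mult_distrib nm_sq power_divide)
qed

text \<open>The new row and the row of the factor lie in the ball of radius \<tau>, so the new error
  is at most 2 \<tau>, against at least 3 \<tau> before. The threshold 4 \<tau> for long rows is
  chosen for this gap.\<close>

lemma long_step:
  assumes "i < d" "long i"
  shows "dt (\<lambda>k. f1 i k - a i k) (\<lambda>k. f1 i k - a i k) \<le> 4/9 * dt (h i) (h i)"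
proof -
  have "nr (\<lambda>k. f1 i k - a i k) \<le> 2/3 * nr (h i)" using nr_f1_a[OF assms(1)] long_h[OF assms] by simp
  then have "(nr (\<lambda>k. f1 i k - a i k))\<^sup>2 \<le> (2/3 * nr (h i))\<^sup>2" by (intro power_mono nm_nonneg)
  then show ?thesis by (simp add: power_mult_distrib nm_sq power_divide)
qed

lemma f'_long: "long i \<Longrightarrow> f' i = a i" and f'_short: "\<not> long i \<Longrightarrow> f' i = f i"
  and h'_long: "long i \<Longrightarrow> h' i = (\<lambda>k. 0)" and h'_short: "\<not> long i \<Longrightarrow> h' i = h i"
  by (auto simp: f'_def h'_def h_def)

lemma nr_f': "i < d \<Longrightarrow> nr (f' i) \<le> 4 * \<tau>"
  using nr_a[of i] \<tau> by (cases "long i") (auto simp: f'_long f'_short long_def)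

lemma nr_h': "i < d \<Longrightarrow> nr (h' i) \<le> 5 * \<tau>"
  using nr_h_le[of i] \<tau> by (cases "long i") (auto simp: h'_long h'_short long_def nm_def ip_def)

lemma h_split: "(\<Sum>i<d. dt (h i) (h i)) = hs + \<kappa>"
  unfolding hs_def \<kappa>_def sum.distrib[symmetric]
  by (intro sum.cong) (auto simp: h'_long h'_short ip_def)

lemma hs_nonneg: "0 \<le> hs" and \<kappa>_nonneg: "0 \<le> \<kappa>"
  by (auto simp: hs_def \<kappa>_def ip_self_nonneg intro!: sum_nonneg)

lemma hs_\<kappa>_le: "hs + \<kappa> \<le> s / 25"
  using near unfolding h_split[symmetric] by (simp add: h_def[abs_def])

section \<open>Lower bound for the inner product of the truncated gradient and deviation\<close>

lemma off_diagonal_sum_eq: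
  "(\<Sum>i<d. \<Sum>j<d. dt (a i) (h' j) * dt (a j) (h' i))
    = (\<Sum>k<r. \<Sum>l<r. (\<Sum>i<d. a i k * h' i l) * (\<Sum>i<d. a i l * h' i k))"
proof -
  have "(\<Sum>i<d. \<Sum>j<d. dt (a i) (h' j) * dt (a j) (h' i))
      = (\<Sum>i<d. \<Sum>j<d. \<Sum>k<r. \<Sum>l<r. (a i k * h' i l) * (a j l * h' j k))"
    by (simp add: ip_def sum_product mult_ac)
  also have "\<dots> = (\<Sum>i<d. \<Sum>k<r. \<Sum>j<d. \<Sum>l<r. (a i k * h' i l) * (a j l * h' j k))"
    by (intro sum.cong[OF refl] sum.swap)
  also have "\<dots> = (\<Sum>i<d. \<Sum>k<r. \<Sum>l<r. \<Sum>j<d. (a i k * h' i l) * (a j l * h' j k))"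
    by (intro sum.cong[OF refl] sum.swap)
  also have "\<dots> = (\<Sum>k<r. \<Sum>i<d. \<Sum>l<r. \<Sum>j<d. (a i k * h' i l) * (a j l * h' j k))"
    by (rule sum.swap)
  also have "\<dots> = (\<Sum>k<r. \<Sum>l<r. \<Sum>i<d. \<Sum>j<d. (a i k * h' i l) * (a j l * h' j k))"
    by (intro sum.cong[OF refl] sum.swap)
  finally show ?thesis by (simp add: sum_product)
qed

text \<open>Alignment makes the matrix \<open>C\<close> below symmetric up to the contribution \<open>N\<close> of the long rows,
  and the sum over \<open>C k l * C l k\<close> is nonnegative for symmetric \<open>C\<close>.\<close>

lemma off_diagonal_sum_ge:
  "- (s * \<kappa> / 225) \<le> (\<Sum>i<d. \<Sum>j<d. dt (a i) (h' j) * dt (a j) (h' i))"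
proof -
  define C where "C k l = (\<Sum>i<d. a i k * h' i l)" for k l
  define N where "N k l = (\<Sum>i | i < d \<and> long i. a i k * h i l)" for k l
  define S where "S k l = (\<Sum>i<d. a i k * h i l)" for k l
  have C: "C k l = S k l - N k l" for k l
  proof -
    have "N k l = (\<Sum>i<d. if long i then a i k * h i l else 0)"
      unfolding N_def by (simp add: sum.If_cases Int_def)
    then show ?thesis unfolding C_def S_def h'_def
      by (simp add: sum_subtractf[symmetric]) (intro sum.cong, auto)
  qed
  have S_sym: "S k l = S l k" if "k < r" "l < r" for k l
    using aligned[OF that] by (simp add: S_def h_def)
  have pt: "- (1/2 * (N k l)\<^sup>2 + 1/2 * (N l k)\<^sup>2) \<le> C k l * C l k" if "k < r" "l < r" for k l
  proof -
    \<comment> \<open>Completing the square in the symmetric \<open>S\<close> leaves a bound in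
      terms of \<open>N\<close> alone.\<close>
    have "0 \<le> (2 * S k l - N k l - N l k)\<^sup>2 + (N k l + N l k)\<^sup>2" by simp
    then show ?thesis unfolding C S_sym[OF that] by (simp add: power2_eq_square algebra_simps)
  qed
  have \<kappa>_eq: "\<kappa> = (\<Sum>i | i < d \<and> long i. dt (h i) (h i))"
    unfolding \<kappa>_def by (simp add: sum.If_cases Int_def)
  have "(\<Sum>k<r. \<Sum>l<r. (N k l)\<^sup>2)
      \<le> (\<Sum>k<r. \<Sum>l<r. (\<Sum>i | i < d \<and> long i. (a i k)\<^sup>2) * (\<Sum>i | i < d \<and> long i. (h i l)\<^sup>2))"
    unfolding N_def by (intro sum_mono Cauchy_Schwarz_ineq_sum)
  also have "\<dots> = (\<Sum>i | i < d \<and> long i. dt (a i) (a i)) * (\<Sum>i | i < d \<and> long i. dt (h i) (h i))"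
    unfolding sum_product[symmetric] ip_def power2_eq_square by (simp add: sum.swap[of _ "{..<r}"])
  also have "\<dots> \<le> (\<kappa> / 9) * \<kappa>"
    unfolding \<kappa>_eq[symmetric]
  proof (intro mult_right_mono \<kappa>_nonneg)
    show "(\<Sum>i | i < d \<and> long i. dt (a i) (a i)) \<le> \<kappa> / 9"
      unfolding \<kappa>_eq sum_divide_distrib by (intro sum_mono) (use long_a_le in auto)
  qed
  \<comment> \<open>The 9 comes from \<open>long_a_le\<close>, the 25 from \<open>near\<close>;
    their product is the 225 of the claim.\<close>
  also have "\<dots> \<le> (s / 25 / 9) * \<kappa>"
    using hs_\<kappa>_le hs_nonneg \<kappa>_nonneg by (intro mult_right_mono) auto
  finally have N: "(\<Sum>k<r. \<Sum>l<r. (N k l)\<^sup>2) \<le> s * \<kappa> / 225" by simp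
  have "- (\<Sum>k<r. \<Sum>l<r. (N k l)\<^sup>2) = (\<Sum>k<r. \<Sum>l<r. - (1/2 * (N k l)\<^sup>2 + 1/2 * (N l k)\<^sup>2))"
  proof -
    have "(\<Sum>k<r. \<Sum>l<r. (N l k)\<^sup>2) = (\<Sum>k<r. \<Sum>l<r. (N k l)\<^sup>2)" by (rule sum.swap)
    then show ?thesis by (simp add: sum_negf sum.distrib sum_subtractf sum_divide_distrib[symmetric])
  qed
  also have "\<dots> \<le> (\<Sum>k<r. \<Sum>l<r. C k l * C l k)" by (intro sum_mono pt) auto
  finally show ?thesis using N unfolding off_diagonal_sum_eq C_def by linarith
qed

lemma sum_dt_a: "(\<Sum>i<d. (dt (a i) u)\<^sup>2) = s * dt u u"
  using sum_ip_orthogonal_columns[OF orth, of r u u] by (simp add: power2_eq_square)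

text \<open>By A^T A = s I each of the two pure squares equals s times \<open>hs\<close>; the
  doubled cross term accounts for the loss 2/225.\<close>

lemma tangent_ge:
  "2 * s * hs - 2 / 225 * s * \<kappa> \<le> (\<Sum>i<d. \<Sum>j<d. (tangent r a h' i j)\<^sup>2)"
proof -
  have "(\<Sum>i<d. \<Sum>j<d. (tangent r a h' i j)\<^sup>2)
     = (\<Sum>i<d. \<Sum>j<d. (dt (a i) (h' j))\<^sup>2) + (\<Sum>i<d. \<Sum>j<d. (dt (a j) (h' i))\<^sup>2)
       + 2 * (\<Sum>i<d. \<Sum>j<d. dt (a i) (h' j) * dt (a j) (h' i))"
    by (simp add: power2_sum sum.distrib sum_distrib_left mult.assoc)
  also have "(\<Sum>i<d. \<Sum>j<d. (dt (a i) (h' j))\<^sup>2) = (\<Sum>j<d. \<Sum>i<d. (dt (a i) (h' j))\<^sup>2)"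
    by (rule sum.swap)
  finally show ?thesis
    using off_diagonal_sum_ge by (simp add: sum_dt_a sum_distrib_left[symmetric] hs_def[symmetric])
qed

lemma sampled_tangent_ge:
  "p * (3/2 * s * hs - 2 / 225 * s * \<kappa>) \<le> (\<Sum>i<d. \<Sum>j<d. \<omega> i j * (tangent r a h' i j)\<^sup>2)"
proof -
  have "p * (\<Sum>i<d. \<Sum>j<d. (tangent r a h' i j)\<^sup>2) - p * s / 2 * hs
     \<le> (\<Sum>i<d. \<Sum>j<d. \<omega> i j * (tangent r a h' i j)\<^sup>2)"
    using good unfolding good_pattern_def sum_\<omega> hs_def by blast
  moreover have "p * (2 * s * hs - 2 / 225 * s * \<kappa>) \<le> p * (\<Sum>i<d. \<Sum>j<d. (tangent r a h' i j)\<^sup>2)"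
    using p by (intro mult_left_mono tangent_ge) auto
  ultimately show ?thesis by (simp add: algebra_simps)
qed

text \<open>Cauchy-Schwarz reduces the claim to the quadratic form in the squared row norms, which
  the truncation keeps below \<open>B\<close>. Since \<open>hs\<close> is at most s / 25, the
  constant is 3/2 * 1/25 + 1/25 = 1/10.\<close>

lemma sampled_quartic_le:
  "(\<Sum>i<d. \<Sum>j<d. \<omega> i j * (dt (h' i) (h' j))\<^sup>2) \<le> p * s * hs / 10"
proof -
  have "(\<Sum>i<d. \<Sum>j<d. \<omega> i j * (dt (h' i) (h' j))\<^sup>2)
     \<le> (\<Sum>i<d. \<Sum>j<d. \<omega> i j * (dt (h' i) (h' i) * dt (h' j) (h' j)))"
    by (intro sum_mono mult_left_mono ip_Cauchy_Schwarz \<omega>_nonneg)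
  also have "\<dots> \<le> 3/2 * p * hs\<^sup>2 + p * s / 25 * hs"
  proof -
    have "\<forall>i<d. 0 \<le> dt (h' i) (h' i) \<and> dt (h' i) (h' i) \<le> B"
    proof (intro allI impI conjI ip_self_nonneg)
      fix i assume "i < d"
      then have "dt (h' i) (h' i) \<le> (5 * \<tau>)\<^sup>2" using nr_h' \<tau> nm_le_iff[of "5 * \<tau>"] by auto
      then show "dt (h' i) (h' i) \<le> B" using B by (simp add: power_mult_distrib)
    qed
    then show ?thesis unfolding hs_def by (rule good_quadratic)
  qed
  also have "3/2 * p * hs\<^sup>2 + p * s / 25 * hs \<le> p * s * hs / 10"
  proof -
    have "hs * hs \<le> s / 25 * hs"
      using hs_nonneg hs_\<kappa>_le \<kappa>_nonneg by (intro mult_right_mono) auto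
    then have "3/2 * p * (hs * hs) \<le> 3/2 * p * (s / 25 * hs)"
      using p by (intro mult_left_mono) auto
    then show ?thesis by (simp add: power2_eq_square)
  qed
  finally show ?thesis .
qed

lemma resid'_eq: "resid' i j = (tangent r a h' i j) + dt (h' i) (h' j)"
  unfolding resid'_def f'_def by (simp add: ip_add_left ip_add_right ip_commute)

text \<open>Residual and pattern are symmetric, so the inner product may be averaged over (i, j) and
  (j, i); this turns the factor \<open>Y i j\<close> into half of X + 2 Z. The constant is 1/2 * 3/2
  - 5/2 * 1/10 = 1/2.\<close>

lemma ip_grad'_ge: "1/2 * s * hs - s * \<kappa> / 225 \<le> (\<Sum>j<d. dt (grad' j) (h' j))"
proof -
  define X where "X i j = dt (a i) (h' j) + dt (a j) (h' i)" for i j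
  define Z where "Z i j = dt (h' i) (h' j)" for i j
  have sym: "X i j = X j i" "Z i j = Z j i" for i j by (simp_all add: X_def Z_def ip_commute)
  have res: "resid' i j = X i j + Z i j" for i j by (simp add: resid'_eq X_def Z_def)
  define Y where "Y i j = dt (f' i) (h' j)" for i j
  have "dt (grad' j) (h' j) = 2 / p * (\<Sum>i<d. \<omega> i j * resid' i j * Y i j)" for j
    unfolding grad'_def ip_scale_left ip_sum_left Y_def ..
  then have "(\<Sum>j<d. dt (grad' j) (h' j)) = 2 / p * (\<Sum>j<d. \<Sum>i<d. \<omega> i j * resid' i j * Y i j)"
    by (simp add: sum_distrib_left)
  also have "(\<Sum>j<d. \<Sum>i<d. \<omega> i j * resid' i j * Y i j) = (\<Sum>i<d. \<Sum>j<d. \<omega> i j * resid' i j * Y i j)"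
    by (rule sum.swap)
  also have "\<dots> = 1/2 * ((\<Sum>i<d. \<Sum>j<d. \<omega> i j * resid' i j * Y i j) + (\<Sum>j<d. \<Sum>i<d. \<omega> i j * resid' i j * Y i j))"
    by (simp add: sum.swap[of "\<lambda>j i. \<omega> i j * resid' i j * Y i j"])
  also have "(\<Sum>j<d. \<Sum>i<d. \<omega> i j * resid' i j * Y i j) = (\<Sum>j<d. \<Sum>i<d. \<omega> j i * resid' j i * Y i j)"
    by (simp add: \<omega>_sym res sym)
  also have "(\<Sum>i<d. \<Sum>j<d. \<omega> i j * resid' i j * Y i j) + (\<Sum>j<d. \<Sum>i<d. \<omega> j i * resid' j i * Y i j)
      = (\<Sum>i<d. \<Sum>j<d. \<omega> i j * ((X i j + Z i j) * (X i j + 2 * Z i j)))"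
    unfolding sum.distrib[symmetric]
  proof (intro sum.cong refl)
    fix i j
    have "Y i j + Y j i = X i j + 2 * Z i j"
      by (simp add: Y_def X_def Z_def f'_def[abs_def] ip_add_left ip_commute[of _ "h' j" "h' i"])
    then show "\<omega> i j * resid' i j * Y i j + \<omega> i j * resid' i j * Y j i
      = \<omega> i j * ((X i j + Z i j) * (X i j + 2 * Z i j))"
      by (simp add: res distrib_left[symmetric] mult.assoc)
  qed
  finally have eq: "(\<Sum>j<d. dt (grad' j) (h' j))
      = 1 / p * (\<Sum>i<d. \<Sum>j<d. \<omega> i j * ((X i j + Z i j) * (X i j + 2 * Z i j)))" by simp
  have "p * (1/2 * s * hs - s * \<kappa> / 225) = 1/2 * (p * (3/2 * s * hs - 2 / 225 * s * \<kappa>)) - 5/2 * (p * s * hs / 10)"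
    by (simp add: algebra_simps)
  also have "\<dots> \<le> 1/2 * (\<Sum>i<d. \<Sum>j<d. \<omega> i j * (X i j)\<^sup>2) - 5/2 * (\<Sum>i<d. \<Sum>j<d. \<omega> i j * (Z i j)\<^sup>2)"
    unfolding X_def Z_def by (intro diff_mono mult_left_mono sampled_tangent_ge sampled_quartic_le) auto
  also have "\<dots> = (\<Sum>i<d. \<Sum>j<d. \<omega> i j * (1/2 * (X i j)\<^sup>2 - 5/2 * (Z i j)\<^sup>2))"
    by (simp add: sum_distrib_left right_diff_distrib sum_subtractf mult_ac)
  also have "\<dots> \<le> (\<Sum>i<d. \<Sum>j<d. \<omega> i j * ((X i j + Z i j) * (X i j + 2 * Z i j)))"
  proof (intro sum_mono mult_left_mono \<omega>_nonneg)
    fix i j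
    \<comment> \<open>Exactly the difference of the two sides of the claim.\<close>
    have "0 \<le> 1/2 * (X i j + 3 * Z i j)\<^sup>2" by simp
    then show "1/2 * (X i j)\<^sup>2 - 5/2 * (Z i j)\<^sup>2 \<le> (X i j + Z i j) * (X i j + 2 * Z i j)"
      by (simp add: power2_eq_square algebra_simps)
  qed
  finally have "p * (1/2 * s * hs - s * \<kappa> / 225) \<le> p * (\<Sum>j<d. dt (grad' j) (h' j))"
    unfolding eq using p by simp
  then show ?thesis using p by (simp add: mult_le_cancel_left)
qed

section \<open>Upper bound for the truncated gradient\<close>

lemma sum_\<omega>_rows_le:
  assumes "\<And>i. i < d \<Longrightarrow> 0 \<le> c i"
  shows "(\<Sum>j<d. \<Sum>i<d. \<omega> i j * c i) \<le> 2 * p * real d * (\<Sum>i<d. c i)"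
proof -
  have "(\<Sum>j<d. \<Sum>i<d. \<omega> i j * c i) = (\<Sum>i<d. (\<Sum>j<d. \<omega> i j) * c i)"
    by (subst sum.swap) (simp add: sum_distrib_right)
  also have "\<dots> \<le> (\<Sum>i<d. 2 * p * real d * c i)"
    by (intro sum_mono mult_right_mono degree assms) auto
  finally show ?thesis by (simp add: sum_distrib_left)
qed

text \<open>Two uses of bounded degrees, each worth a factor p d: one for the rows of the iterate in
  a row of the gradient, one for the sum of squared residuals. With d \<tau>^2 \<le> 3 \<beta> s the
  constant is 4 * 32 * 68 * 9.\<close>

lemma norm_grad'_le: "(\<Sum>j<d. dt (grad' j) (grad' j)) \<le> 78336 * (\<beta>\<^sup>2 * s\<^sup>2) * hs"
proof -
  define c where "c i j = \<omega> i j * (resid' i j)\<^sup>2" for i j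
  have row: "dt (grad' j) (grad' j) \<le> 4 / p\<^sup>2 * ((\<Sum>i<d. c i j) * (32 * p * real d * \<tau>\<^sup>2))" if j: "j < d" for j
  proof -
    \<comment> \<open>The idempotent \<omega> is attached to both factors, so that Cauchy-Schwarz
      sees observed positions only.\<close>
    define g where "g k = (\<Sum>i<d. (\<omega> i j * resid' i j) * (\<omega> i j * f' i k))" for k
    have "grad' j = (\<lambda>k. 2 / p * g k)"
    proof
      fix k
      have "\<omega> i j * resid' i j * f' i k = (\<omega> i j * resid' i j) * (\<omega> i j * f' i k)" for i
        by (simp add: \<omega>_def)
      then show "grad' j k = 2 / p * g k" by (simp only: grad'_def g_def)
    qed
    then have eq: "dt (grad' j) (grad' j) = 4 / p\<^sup>2 * dt g g"
      by (simp only: ip_scale_left ip_scale_right) (simp add: power2_eq_square)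
    have "dt g g \<le> (\<Sum>i<d. (\<omega> i j * resid' i j)\<^sup>2) * (\<Sum>i<d. dt (\<lambda>k. \<omega> i j * f' i k) (\<lambda>k. \<omega> i j * f' i k))"
      unfolding g_def
      by (rule weighted_sum_ip_le[where c = "\<lambda>i. \<omega> i j * resid' i j" and u = "\<lambda>i k. \<omega> i j * f' i k"])
    also have "(\<Sum>i<d. (\<omega> i j * resid' i j)\<^sup>2) = (\<Sum>i<d. c i j)"
      by (simp add: c_def power_mult_distrib \<omega>_sq)
    also have "(\<Sum>i<d. dt (\<lambda>k. \<omega> i j * f' i k) (\<lambda>k. \<omega> i j * f' i k)) = (\<Sum>i<d. \<omega> i j * dt (f' i) (f' i))"
      by (intro sum.cong) (auto simp: ip_scale_left ip_scale_right \<omega>_def)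
    also have "\<dots> \<le> (\<Sum>i<d. \<omega> i j * (16 * \<tau>\<^sup>2))"
    proof (intro sum_mono mult_left_mono \<omega>_nonneg)
      fix i assume "i \<in> {..<d}"
      then have "dt (f' i) (f' i) \<le> (4 * \<tau>)\<^sup>2" using nr_f' \<tau> nm_le_iff[of "4 * \<tau>"] by auto
      then show "dt (f' i) (f' i) \<le> 16 * \<tau>\<^sup>2" by (simp add: power_mult_distrib)
    qed
    also have "\<dots> = (\<Sum>i<d. \<omega> i j) * (16 * \<tau>\<^sup>2)" by (simp add: sum_distrib_right)
    also have "\<dots> \<le> (2 * p * real d) * (16 * \<tau>\<^sup>2)" by (intro mult_right_mono degree' j) auto
    finally have "dt g g \<le> (\<Sum>i<d. c i j) * ((2 * p * real d) * (16 * \<tau>\<^sup>2))"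
      by (simp add: mult_left_mono c_def sum_nonneg \<omega>_nonneg)
    then have "4 / p\<^sup>2 * dt g g \<le> 4 / p\<^sup>2 * ((\<Sum>i<d. c i j) * (32 * p * real d * \<tau>\<^sup>2))"
      by (intro mult_left_mono) (auto simp: mult_ac)
    then show ?thesis unfolding eq .
  qed
  have c_le: "c i j \<le> \<omega> i j * (2 * \<tau>\<^sup>2 * dt (h' i) (h' i)) + \<omega> i j * (32 * \<tau>\<^sup>2 * dt (h' j) (h' j))"
    if "i < d" "j < d" for i j
  proof -
    \<comment> \<open>X + Z is regrouped so that each product pairs one deviation with one row of
      bounded norm.\<close>
    have "resid' i j = dt (f' i) (h' j) + dt (h' i) (a j)"
      unfolding resid'_eq f'_def by (simp add: ip_add_left ip_commute)
    then have "(resid' i j)\<^sup>2 \<le> 2 * (dt (f' i) (h' j))\<^sup>2 + 2 * (dt (h' i) (a j))\<^sup>2"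
      using sum_squares_ge_zero[of "dt (f' i) (h' j) - dt (h' i) (a j)" 0]
      by (simp add: power2_eq_square algebra_simps)
    also have "\<dots> \<le> 2 * (dt (f' i) (f' i) * dt (h' j) (h' j)) + 2 * (dt (h' i) (h' i) * dt (a j) (a j))"
      by (intro add_mono mult_left_mono ip_Cauchy_Schwarz) auto
    also have "\<dots> \<le> 2 * ((4 * \<tau>)\<^sup>2 * dt (h' j) (h' j)) + 2 * (dt (h' i) (h' i) * \<tau>\<^sup>2)"
      using that nr_f'[of i] rows[of j] \<tau>
      by (intro add_mono mult_left_mono mult_right_mono ip_self_nonneg) (auto simp: nm_le_iff)
    finally have "\<omega> i j * (resid' i j)\<^sup>2 \<le> \<omega> i j * (2 * ((4 * \<tau>)\<^sup>2 * dt (h' j) (h' j)) + 2 * (dt (h' i) (h' i) * \<tau>\<^sup>2))"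
      by (intro mult_left_mono \<omega>_nonneg)
    then show ?thesis by (simp add: c_def power_mult_distrib algebra_simps)
  qed
  have "(\<Sum>j<d. \<Sum>i<d. c i j) \<le> (\<Sum>j<d. \<Sum>i<d. \<omega> i j * (2 * \<tau>\<^sup>2 * dt (h' i) (h' i)) + \<omega> i j * (32 * \<tau>\<^sup>2 * dt (h' j) (h' j)))"
    by (intro sum_mono c_le) auto
  also have "\<dots> = (\<Sum>j<d. \<Sum>i<d. \<omega> i j * (2 * \<tau>\<^sup>2 * dt (h' i) (h' i)))
      + (\<Sum>j<d. \<Sum>i<d. \<omega> i j * (32 * \<tau>\<^sup>2 * dt (h' j) (h' j)))"
    by (simp only: sum.distrib)
  also have "(\<Sum>j<d. \<Sum>i<d. \<omega> i j * (32 * \<tau>\<^sup>2 * dt (h' j) (h' j)))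
      = (\<Sum>j<d. \<Sum>i<d. \<omega> i j * (32 * \<tau>\<^sup>2 * dt (h' i) (h' i)))"
    by (rule trans[OF sum.swap]) (intro sum.cong refl arg_cong2[where f = "(*)"] \<omega>_sym)
  also have "(\<Sum>j<d. \<Sum>i<d. \<omega> i j * (2 * \<tau>\<^sup>2 * dt (h' i) (h' i)))
        + (\<Sum>j<d. \<Sum>i<d. \<omega> i j * (32 * \<tau>\<^sup>2 * dt (h' i) (h' i)))
      \<le> 2 * p * real d * (\<Sum>i<d. 2 * \<tau>\<^sup>2 * dt (h' i) (h' i)) + 2 * p * real d * (\<Sum>i<d. 32 * \<tau>\<^sup>2 * dt (h' i) (h' i))"
    by (intro add_mono sum_\<omega>_rows_le) (simp_all add: ip_self_nonneg)
  also have "\<dots> = 68 * p * real d * \<tau>\<^sup>2 * hs"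
    unfolding sum_distrib_left[symmetric] hs_def[symmetric] by simp
  finally have c_sum: "(\<Sum>j<d. \<Sum>i<d. c i j) \<le> 68 * p * real d * \<tau>\<^sup>2 * hs" .
  have "(\<Sum>j<d. dt (grad' j) (grad' j)) \<le> (\<Sum>j<d. 4 / p\<^sup>2 * ((\<Sum>i<d. c i j) * (32 * p * real d * \<tau>\<^sup>2)))"
    by (intro sum_mono row) auto
  also have "\<dots> = 4 / p\<^sup>2 * (32 * p * real d * \<tau>\<^sup>2) * (\<Sum>j<d. \<Sum>i<d. c i j)"
  proof -
    have "4 / p\<^sup>2 * (S * K) = 4 / p\<^sup>2 * K * S" for S K by simp
    then show ?thesis by (simp only: sum_distrib_left[symmetric])
  qed
  also have "\<dots> \<le> 4 / p\<^sup>2 * (32 * p * real d * \<tau>\<^sup>2) * (68 * p * real d * \<tau>\<^sup>2 * hs)"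
    using p by (intro mult_left_mono c_sum) auto
  also have "\<dots> = 8704 * (real d * \<tau>\<^sup>2)\<^sup>2 * hs"
    using p by (simp add: power2_eq_square)
  also have "\<dots> \<le> 8704 * (3 * \<beta> * s)\<^sup>2 * hs"
    by (intro mult_left_mono mult_right_mono power_mono radius hs_nonneg) auto
  also have "\<dots> = 78336 * (\<beta>\<^sup>2 * s\<^sup>2) * hs" by (simp add: power_mult_distrib)
  finally show ?thesis .
qed

end

section \<open>The influence of long rows and the contraction in one step\<close>

context descent_step
begin

text \<open>In a short row \<open>j\<close>, truncation alters only the terms of long rows
  \<open>i\<close>, and each such term is of order \<tau>^2 |h i|^2. The bound is linear in the
  squared error of the long rows, so after multiplication by \<eta> it is negligible against the
  decrease there.\<close>

lemma bad_ip_le: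
  assumes j: "j < d" "\<not> long j" and w: "nr w \<le> 2 * \<tau>"
  shows "\<bar>dt (bad j) w\<bar> \<le> 2 / p * (\<Sum>i<d. \<omega> i j * (if long i then 20 * \<tau>\<^sup>2 * dt (h i) (h i) else 0))"
proof -
  define t where "t i = resid i j * dt (f i) w - resid' i j * dt (f' i) w" for i
  have "bad j = (\<lambda>k. 2 / p * (\<Sum>i<d. \<omega> i j * resid i j * f i k) - 2 / p * (\<Sum>i<d. \<omega> i j * resid' i j * f' i k))"
    by (simp add: bad_def grad'_def fun_eq_iff)
  then have "dt (bad j) w = 2 / p * ((\<Sum>i<d. \<omega> i j * resid i j * dt (f i) w) - (\<Sum>i<d. \<omega> i j * resid' i j * dt (f' i) w))"
    by (simp only: ip_minus_left ip_scale_left ip_sum_left right_diff_distrib)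
  also have "\<dots> = 2 / p * (\<Sum>i<d. \<omega> i j * t i)"
    by (simp add: t_def right_diff_distrib sum_subtractf mult.assoc)
  finally have "\<bar>dt (bad j) w\<bar> = 2 / p * \<bar>\<Sum>i<d. \<omega> i j * t i\<bar>"
    using p by (simp add: abs_mult)
  moreover have "\<bar>\<Sum>i<d. \<omega> i j * t i\<bar> \<le> (\<Sum>i<d. \<omega> i j * (if long i then 20 * \<tau>\<^sup>2 * dt (h i) (h i) else 0))"
  proof (rule order_trans[OF sum_abs], intro sum_mono)
    fix i assume "i \<in> {..<d}"
    then have i: "i < d" by simp
    have "\<bar>t i\<bar> \<le> (if long i then 20 * \<tau>\<^sup>2 * dt (h i) (h i) else 0)"
    proof (cases "long i")
      case False
      then have "resid' i j = resid i j" "f' i = f i"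
        using j by (simp_all add: resid_def resid'_def f'_short)
      then show ?thesis using False by (simp add: t_def)
    next
      case True
      define F where "F = nr (f i)"
      have F: "4 * \<tau> \<le> F" using True by (simp add: long_def F_def)
      have "F\<^sup>2 \<le> 2 * dt (h i) (h i)" using long_f_le[OF i True] by (simp add: F_def nm_sq)
      \<comment> \<open>As \<tau> \<le> F / 4 on a long row, every term becomes a multiple of F^2
        \<tau>^2; the multiples add up to less than 10, and F^2 is at most 2 |h i|^2.\<close>
      have tF: "\<tau> * \<tau> \<le> F / 4 * \<tau>" "(\<tau> * \<tau>) * (\<tau> * \<tau>) \<le> (F / 4 * (F / 4)) * (\<tau> * \<tau>)"
        using F \<tau> by (intro mult_right_mono mult_mono; simp)+
      have "\<bar>dt (f i) (f j)\<bar> \<le> 4 * (F * \<tau>)"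
        using abs_ip_le[of "{..<r}" "f i" "f j"] j nm_nonneg[of "{..<r}" "f i"]
          mult_left_mono[of "nr (f j)" "4 * \<tau>" F] by (simp add: long_def F_def)
      moreover have "\<bar>dt (a i) (a j)\<bar> \<le> \<tau> * \<tau>"
        using abs_ip_le[of "{..<r}" "a i" "a j"] mult_mono[OF nr_a[OF i] nr_a[OF j(1)]] \<tau> nm_nonneg[of "{..<r}" "a j"] by simp
      ultimately have "\<bar>resid i j\<bar> \<le> 17/4 * (F * \<tau>)"
        using tF(1) abs_triangle_ineq4[of "dt (f i) (f j)" "dt (a i) (a j)"]
        unfolding resid_def by linarith
      moreover have "\<bar>dt (f i) w\<bar> \<le> F * (2 * \<tau>)"
        using abs_ip_le[of "{..<r}" "f i" w] w nm_nonneg[of "{..<r}" "f i"]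
          mult_left_mono[of "nr w" "2 * \<tau>" F] by (simp add: F_def)
      ultimately have 1: "\<bar>resid i j * dt (f i) w\<bar> \<le> 17/4 * (F * \<tau>) * (F * (2 * \<tau>))"
        unfolding abs_mult using F \<tau> by (intro mult_mono) auto
      have "resid' i j = dt (a i) (h j)"
        using j True by (simp add: resid'_def f'_long f'_short h_def[abs_def] ip_minus_right)
      moreover have "nr (h j) \<le> 5 * \<tau>" using nr_h'[OF j(1)] j by (simp add: h'_short)
      ultimately have "\<bar>resid' i j\<bar> \<le> \<tau> * (5 * \<tau>)"
        using abs_ip_le[of "{..<r}" "a i" "h j"] mult_mono[OF nr_a[OF i], of "nr (h j)" "5 * \<tau>"] \<tau> nm_nonneg[of "{..<r}" "h j"] by simp
      moreover have "\<bar>dt (a i) w\<bar> \<le> \<tau> * (2 * \<tau>)"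
        using abs_ip_le[of "{..<r}" "a i" w] mult_mono[OF nr_a[OF i] w] \<tau> nm_nonneg[of "{..<r}" w] by simp
      ultimately have 2: "\<bar>resid' i j * dt (f' i) w\<bar> \<le> \<tau> * (5 * \<tau>) * (\<tau> * (2 * \<tau>))"
        unfolding abs_mult f'_long[OF True] using \<tau> by (intro mult_mono) auto
      have "\<bar>t i\<bar> \<le> 17/4 * (F * \<tau>) * (F * (2 * \<tau>)) + \<tau> * (5 * \<tau>) * (\<tau> * (2 * \<tau>))"
        unfolding t_def using 1 2 by linarith
      also have "\<dots> = 17/2 * (F\<^sup>2 * \<tau>\<^sup>2) + 10 * ((\<tau> * \<tau>) * (\<tau> * \<tau>))"
        by (simp add: power2_eq_square)
      also have "\<dots> \<le> 17/2 * (F\<^sup>2 * \<tau>\<^sup>2) + 10 * ((F / 4 * (F / 4)) * (\<tau> * \<tau>))"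
        using tF(2) by simp
      also have "\<dots> \<le> 10 * (F\<^sup>2 * \<tau>\<^sup>2)"
        using mult_nonneg_nonneg[OF zero_le_power2[of F] zero_le_power2[of \<tau>]]
        by (simp add: power2_eq_square mult_ac)
      also have "\<dots> \<le> 10 * ((2 * dt (h i) (h i)) * \<tau>\<^sup>2)"
        by (intro mult_left_mono mult_right_mono \<open>F\<^sup>2 \<le> _\<close>) auto
      finally show ?thesis using True by (simp add: mult_ac)
    qed
    then show "\<bar>\<omega> i j * t i\<bar> \<le> \<omega> i j * (if long i then 20 * \<tau>\<^sup>2 * dt (h i) (h i) else 0)"
      unfolding abs_mult by (simp add: \<omega>_nonneg mult_left_mono)
  qed
  ultimately show ?thesis using p by (simp only:) (intro mult_left_mono, auto)
qed

definition move :: "nat \<Rightarrow> nat \<Rightarrow> real" where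
  "move j k = h' j k - \<eta> * (grad' j k - n j k)"

definition new :: "nat \<Rightarrow> nat \<Rightarrow> real" where
  "new j k = f1 j k - a j k"

text \<open>The obtuse angle gives |new|^2 \<le> \<langle>move - \<eta> bad, new\<rangle>. Young's
  inequality is applied to \<open>move\<close> only; \<open>bad\<close> stays paired with
  \<open>new\<close>, whose norm is at most 2 \<tau>, and so is never squared.\<close>

lemma short_step:
  assumes j: "j < d" "\<not> long j"
  shows "dt (new j) (new j) \<le> dt (move j) (move j) + 2 * \<eta> * \<bar>dt (bad j) (new j)\<bar>"
proof -
  have eq: "(\<lambda>k. f j k - \<eta> * (2 / p * (\<Sum>i<d. of_bool ((i, j) \<in> \<Omega>) * (dt (f i) (f j) - dt (a i) (a j)) * f i k)
          - n j k) - f1 j k) = (\<lambda>k. move j k - \<eta> * bad j k - new j k)"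
    using j by (simp add: fun_eq_iff move_def bad_def new_def h'_def h_def \<omega>_def resid_def algebra_simps)
  have "dt (\<lambda>k. move j k - \<eta> * bad j k - new j k) (\<lambda>k. (-1) * new j k) \<le> 0"
    using f1_proj[OF j(1)] unfolding eq by (simp add: new_def)
  then have "dt (new j) (new j) \<le> dt (move j) (new j) - \<eta> * dt (bad j) (new j)"
    unfolding ip_scale_right by (simp add: ip_minus_left ip_scale_left)
  moreover have "2 * dt (move j) (new j) \<le> dt (move j) (move j) + dt (new j) (new j)"
    using ip_Young[of 1 "{..<r}" "move j" "new j"] by simp
  moreover have "- (\<eta> * dt (bad j) (new j)) \<le> \<eta> * \<bar>dt (bad j) (new j)\<bar>"
    using mult_left_mono[OF abs_ge_minus_self[of "dt (bad j) (new j)"], of \<eta>] \<eta>_pos by simp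
  ultimately show ?thesis by linarith
qed

text \<open>The budget in units of \<eta> s hs: the gradient gains 1, pairing the noise with the
  deviation costs 1/4 by Young's inequality, the squared gradient costs 2 * 78336 / 10^6. More than
  1/2 remains because the step carries the factor 10^-6. The noise term collects 4 from Young's
  inequality and at most 1 from its square.\<close>

lemma move_le: "(\<Sum>j<d. dt (move j) (move j)) \<le> (1 - \<eta> * s / 2) * hs + 2 / 225 * (\<eta> * s) * \<kappa> + 5 * \<eta> * \<nu> / s"
proof -
  define u where "u j k = grad' j k - n j k" for j k
  have u2: "dt (u j) (u j) \<le> 2 * dt (grad' j) (grad' j) + 2 * dt (n j) (n j)" for j
  proof -
    have "2 * dt (\<lambda>k. (-1) * grad' j k) (n j) \<le> dt (grad' j) (grad' j) + dt (n j) (n j)"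
      using ip_Young[of 1 "{..<r}" "\<lambda>k. (-1) * grad' j k" "n j"] unfolding ip_scale_left ip_scale_right by simp
    then show ?thesis unfolding u_def ip_scale_left
      by (simp add: ip_minus_left ip_minus_right ip_commute[of _ "n j" "grad' j"])
  qed
  have nh: "2 * dt (n j) (h' j) \<le> 4 / s * dt (n j) (n j) + s / 4 * dt (h' j) (h' j)" for j
    using ip_Young[of "4 / s" "{..<r}" "n j" "h' j"] s by (simp add: mult.commute)
  have row: "dt (move j) (move j) \<le> dt (h' j) (h' j) - 2 * \<eta> * dt (grad' j) (h' j)
      + \<eta> * (4 / s * dt (n j) (n j) + s / 4 * dt (h' j) (h' j))
      + \<eta>\<^sup>2 * (2 * dt (grad' j) (grad' j) + 2 * dt (n j) (n j))" for j
  proof -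
    have "move j = (\<lambda>k. h' j k - \<eta> * u j k)" by (simp add: move_def u_def fun_eq_iff)
    then have "dt (move j) (move j) = dt (h' j) (h' j) - 2 * \<eta> * dt (u j) (h' j) + \<eta>\<^sup>2 * dt (u j) (u j)"
      by (simp add: ip_minus_left ip_minus_right ip_scale_left ip_scale_right power2_eq_square
        ip_commute[of _ "h' j" "u j"])
    also have "\<dots> = dt (h' j) (h' j) - 2 * \<eta> * dt (grad' j) (h' j) + \<eta> * (2 * dt (n j) (h' j)) + \<eta>\<^sup>2 * dt (u j) (u j)"
      by (simp add: u_def[abs_def] ip_minus_left algebra_simps)
    also have "\<dots> \<le> dt (h' j) (h' j) - 2 * \<eta> * dt (grad' j) (h' j)
      + \<eta> * (4 / s * dt (n j) (n j) + s / 4 * dt (h' j) (h' j))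
      + \<eta>\<^sup>2 * (2 * dt (grad' j) (grad' j) + 2 * dt (n j) (n j))"
      using \<eta>_pos by (intro add_mono mult_left_mono nh u2 order_refl) auto
    finally show ?thesis .
  qed
  define N where "N = (\<Sum>j<d. dt (n j) (n j))"
  define G where "G = (\<Sum>j<d. dt (grad' j) (grad' j))"
  define GH where "GH = (\<Sum>j<d. dt (grad' j) (h' j))"
  have "(\<Sum>j<d. dt (move j) (move j)) \<le> (\<Sum>j<d. dt (h' j) (h' j) - 2 * \<eta> * dt (grad' j) (h' j)
      + \<eta> * (4 / s * dt (n j) (n j) + s / 4 * dt (h' j) (h' j))
      + \<eta>\<^sup>2 * (2 * dt (grad' j) (grad' j) + 2 * dt (n j) (n j)))"
    by (intro sum_mono row)
  also have "\<dots> = hs - 2 * \<eta> * GH + \<eta> * (4 / s * N + s / 4 * hs) + \<eta>\<^sup>2 * (2 * G + 2 * N)"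
    by (simp only: sum.distrib sum_subtractf sum_distrib_left[symmetric] hs_def N_def G_def GH_def)
  also have "\<dots> \<le> hs - 2 * \<eta> * (1/2 * s * hs - s * \<kappa> / 225) + \<eta> * (4 / s * \<nu> + s / 4 * hs)
      + \<eta>\<^sup>2 * (2 * (78336 * (\<beta>\<^sup>2 * s\<^sup>2) * hs) + 2 * \<nu>)"
    using \<eta>_pos s ip_grad'_ge norm_grad'_le noise unfolding N_def G_def GH_def
    by (intro add_mono diff_mono mult_left_mono order_refl) (auto intro: divide_nonneg_nonneg)
  finally have le: "(\<Sum>j<d. dt (move j) (move j)) \<le> hs - 2 * \<eta> * (1/2 * s * hs - s * \<kappa> / 225) + \<eta> * (4 / s * \<nu> + s / 4 * hs)
      + \<eta>\<^sup>2 * (2 * (78336 * (\<beta>\<^sup>2 * s\<^sup>2) * hs) + 2 * \<nu>)" .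
  have "\<eta>\<^sup>2 * (2 * (78336 * (\<beta>\<^sup>2 * s\<^sup>2) * hs) + 2 * \<nu>)
      = 156672 * (\<eta> * (\<beta>\<^sup>2 * s)) * (\<eta> * s * hs) + 2 * (\<eta> * s) * (\<eta> * \<nu> / s)"
    using s by (simp add: power2_eq_square algebra_simps)
  moreover have "\<eta> * (\<beta>\<^sup>2 * s) = 1/1000000" using \<eta> by simp
  ultimately have eq1: "\<eta>\<^sup>2 * (2 * (78336 * (\<beta>\<^sup>2 * s\<^sup>2) * hs) + 2 * \<nu>)
      = 156672/1000000 * (\<eta> * s * hs) + 2 * (\<eta> * s) * (\<eta> * \<nu> / s)" by simp
  have eq2: "hs - 2 * \<eta> * (1/2 * s * hs - s * \<kappa> / 225) + \<eta> * (4 / s * \<nu> + s / 4 * hs)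
      = hs - 3/4 * (\<eta> * s * hs) + 2 / 225 * (\<eta> * s) * \<kappa> + 4 * (\<eta> * \<nu> / s)"
    by (simp add: algebra_simps)
  have "0 \<le> N" unfolding N_def by (intro sum_nonneg ip_self_nonneg)
  then have "0 \<le> \<nu>" using noise unfolding N_def by linarith
  then have "0 \<le> \<eta> * \<nu> / s" using \<eta>_pos s by simp
  moreover have "2 * (\<eta> * s) \<le> 1" using \<eta>s(2) by linarith
  ultimately have "2 * (\<eta> * s) * (\<eta> * \<nu> / s) \<le> 1 * (\<eta> * \<nu> / s)" by (intro mult_right_mono)
  moreover have "0 \<le> \<eta> * s * hs" using \<eta>_pos s hs_nonneg by simp
  moreover have "(1 - \<eta> * s / 2) * hs = hs - 1/2 * (\<eta> * s * hs)" "5 * \<eta> * \<nu> / s = 5 * (\<eta> * \<nu> / s)"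
    by (simp_all add: algebra_simps)
  ultimately show ?thesis using le unfolding eq1 eq2 by linarith
qed

text \<open>On long rows at most 4/9 of the squared error survives, and their influence on short
  rows adds only 480 * 10^-6 of it; the sum leaves ample room below 1 - \<eta> s / 2. The short rows
  alone determine the rate.\<close>

theorem contraction:
  "(\<Sum>j<d. dt (\<lambda>k. f1 j k - a j k) (\<lambda>k. f1 j k - a j k))
    \<le> (1 - \<eta> * s / 2) * (\<Sum>j<d. dt (\<lambda>k. f j k - a j k) (\<lambda>k. f j k - a j k)) + 5 * \<eta> * \<nu> / s"
proof -
  define b where "b j = 2 / p * (\<Sum>i<d. \<omega> i j * (if long i then 20 * \<tau>\<^sup>2 * dt (h i) (h i) else 0))" for j
  have b_nonneg: "0 \<le> b j" for j
    unfolding b_def using p by (intro mult_nonneg_nonneg sum_nonneg) (auto simp: \<omega>_nonneg ip_self_nonneg)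
  have row: "dt (new j) (new j) \<le> dt (move j) (move j) + 2 * \<eta> * b j + (if long j then 4/9 * dt (h j) (h j) else 0)"
    if j: "j < d" for j
  proof (cases "long j")
    case True
    have "dt (new j) (new j) \<le> 4/9 * dt (h j) (h j)"
      unfolding new_def by (rule long_step[OF j True])
    moreover have "0 \<le> dt (move j) (move j) + 2 * \<eta> * b j"
      using b_nonneg \<eta>_pos ip_self_nonneg by (intro add_nonneg_nonneg) auto
    ultimately show ?thesis using True by simp
  next
    case False
    have "nr (new j) \<le> 2 * \<tau>" unfolding new_def by (rule nr_f1_a[OF j])
    then have "\<bar>dt (bad j) (new j)\<bar> \<le> b j" unfolding b_def by (rule bad_ip_le[OF j False])
    then have "2 * \<eta> * \<bar>dt (bad j) (new j)\<bar> \<le> 2 * \<eta> * b j" using \<eta>_pos by simp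
    then show ?thesis using short_step[OF j False] False by simp
  qed
  have "(\<Sum>j<d. b j) \<le> 80 * (real d * \<tau>\<^sup>2) * \<kappa>"
  proof -
    have "(\<Sum>j<d. b j) = 2 / p * (\<Sum>j<d. \<Sum>i<d. \<omega> i j * (if long i then 20 * \<tau>\<^sup>2 * dt (h i) (h i) else 0))"
      by (simp only: b_def sum_distrib_left[symmetric])
    also have "\<dots> \<le> 2 / p * (2 * p * real d * (\<Sum>i<d. if long i then 20 * \<tau>\<^sup>2 * dt (h i) (h i) else 0))"
      using p by (intro mult_left_mono sum_\<omega>_rows_le) (auto simp: ip_self_nonneg)
    also have "(\<Sum>i<d. if long i then 20 * \<tau>\<^sup>2 * dt (h i) (h i) else 0) = 20 * \<tau>\<^sup>2 * \<kappa>"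
      unfolding \<kappa>_def sum_distrib_left by (intro sum.cong) auto
    finally show ?thesis using p by simp
  qed
  also have "\<dots> \<le> 80 * (3 * \<beta> * s) * \<kappa>"
    by (intro mult_left_mono mult_right_mono radius \<kappa>_nonneg) auto
  finally have "2 * \<eta> * (\<Sum>j<d. b j) \<le> 2 * \<eta> * (80 * (3 * \<beta> * s) * \<kappa>)"
    using \<eta>_pos by (intro mult_left_mono) auto
  also have "\<dots> = 480 * (\<eta> * \<beta> * s) * \<kappa>" by simp
  also have "\<dots> \<le> 480 * (1/1000000) * \<kappa>"
    using \<eta>s(1) by (intro mult_left_mono mult_right_mono \<kappa>_nonneg) auto
  finally have b_sum: "2 * \<eta> * (\<Sum>j<d. b j) \<le> 480 * (1/1000000) * \<kappa>" .
  have "(\<Sum>j<d. dt (new j) (new j))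
      \<le> (\<Sum>j<d. dt (move j) (move j) + 2 * \<eta> * b j + (if long j then 4/9 * dt (h j) (h j) else 0))"
    by (intro sum_mono row) auto
  also have "\<dots> = (\<Sum>j<d. dt (move j) (move j)) + 2 * \<eta> * (\<Sum>j<d. b j) + 4/9 * \<kappa>"
    unfolding \<kappa>_def sum_distrib_left sum.distrib[symmetric] by (intro sum.cong) auto
  also have "\<dots> \<le> (1 - \<eta> * s / 2) * hs + 2 / 225 * (\<eta> * s) * \<kappa> + 5 * \<eta> * \<nu> / s + 480 * (1/1000000) * \<kappa> + 4/9 * \<kappa>"
    using b_sum move_le by linarith
  also have "\<dots> \<le> (1 - \<eta> * s / 2) * (hs + \<kappa>) + 5 * \<eta> * \<nu> / s"
  proof -
    have "\<eta> * s * \<kappa> \<le> 1/1000000 * \<kappa>" using \<eta>s(2) by (intro mult_right_mono \<kappa>_nonneg) simp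
    then show ?thesis using \<kappa>_nonneg by (simp add: algebra_simps)
  qed
  finally show ?thesis
    unfolding h_split[symmetric] by (simp add: new_def[abs_def] h_def[abs_def])
qed

end

section \<open>The set of factors\<close>

lemma mult_transpose_index:
  assumes "A \<in> carrier_mat d r" "i < d" "j < d"
  shows "(A * transpose_mat A) $$ (i, j) = (\<Sum>k<r. A $$ (i, k) * A $$ (j, k))"
  using assms by (simp add: scalar_prod_def atLeast0LessThan)

lemma col_scalar_prod:
  fixes A :: "real mat"
  assumes "A \<in> carrier_mat d r" "k < r" "l < r"
  shows "scalar_prod (col A k) (col A l) = (\<Sum>i<d. A $$ (i, k) * A $$ (i, l))"
  using assms by (simp add: scalar_prod_def atLeast0LessThan)

lemma factor_set_iff:
  assumes "M \<in> carrier_mat d d"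
  shows "A \<in> factor_set d r M \<longleftrightarrow> A \<in> carrier_mat d r \<and>
    (\<forall>i<d. \<forall>j<d. (\<Sum>k<r. A $$ (i, k) * A $$ (j, k)) = M $$ (i, j)) \<and>
    (\<forall>k<r. \<forall>l<r. k \<noteq> l \<longrightarrow> (\<Sum>i<d. A $$ (i, k) * A $$ (i, l)) = 0)"
proof (cases "A \<in> carrier_mat d r")
  case True
  then have "A * transpose_mat A = M \<longleftrightarrow>
      (\<forall>i<d. \<forall>j<d. (\<Sum>k<r. A $$ (i, k) * A $$ (j, k)) = M $$ (i, j))"
    using assms mult_transpose_index[OF True] by (auto intro!: eq_matI)
  then show ?thesis
    unfolding factor_set_def using True by (auto simp: col_scalar_prod)
qed (simp add: factor_set_def)

lemma frob_norm_sq: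
  assumes "A \<in> carrier_mat d r"
  shows "(frob_norm A)\<^sup>2 = (\<Sum>i<d. \<Sum>k<r. (A $$ (i, k))\<^sup>2)"
  using assms by (simp add: frob_norm_def sum_nonneg)

lemma frob_norm_nonneg: "0 \<le> frob_norm A"
  by (simp add: frob_norm_def sum_nonneg)

lemma frob_norm_diff_sq:
  assumes "A \<in> carrier_mat d r" "F \<in> carrier_mat d r"
  shows "(frob_norm (F - A))\<^sup>2 = (\<Sum>i<d. \<Sum>k<r. (F $$ (i, k) - A $$ (i, k))\<^sup>2)"
proof -
  have "F - A \<in> carrier_mat d r" using assms by auto
  then have "(frob_norm (F - A))\<^sup>2 = (\<Sum>i<d. \<Sum>k<r. ((F - A) $$ (i, k))\<^sup>2)" by (rule frob_norm_sq)
  also have "\<dots> = (\<Sum>i<d. \<Sum>k<r. (F $$ (i, k) - A $$ (i, k))\<^sup>2)"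
    by (intro sum.cong refl) (use assms in auto)
  finally show ?thesis .
qed

text \<open>Compactness. Matrices are represented by functions on all index pairs that vanish
  outside the box, so that the factors form a closed subset of a product of compact intervals. A
  true minimiser is needed for the optimality condition below.\<close>

lemma factor_dist_attained:
  assumes M: "M \<in> carrier_mat d d" and F: "F \<in> carrier_mat d r" and ne: "factor_set d r M \<noteq> {}"
  obtains A where "A \<in> factor_set d r M" "factor_dist d r M F = frob_norm (F - A)"
    "\<And>A'. A' \<in> factor_set d r M \<Longrightarrow> frob_norm (F - A) \<le> frob_norm (F - A')"
proof -
  define box where "box = {..<d} \<times> {..<r}"
  define C :: "(nat \<times> nat \<Rightarrow> real) set" where "C = {a. (\<forall>e\<in>- box. a e = 0) \<and>
      (\<forall>i\<in>{..<d}. \<forall>j\<in>{..<d}. (\<Sum>k<r. a (i, k) * a (j, k)) = M $$ (i, j)) \<and>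
      (\<forall>k\<in>{..<r}. \<forall>l\<in>{..<r} - {k}. (\<Sum>i<d. a (i, k) * a (i, l)) = 0)}"
  \<comment> \<open>At least 1, so that c^2 \<ge> c; the squared entries of a factor are bounded by
    the diagonal of \<open>M\<close>, hence by \<open>c\<close>.\<close>
  define c where "c = 1 + (\<Sum>i<d. \<bar>M $$ (i, i)\<bar>)"
  define K :: "(nat \<times> nat \<Rightarrow> real) set" where "K = (\<Pi>\<^sub>E e\<in>UNIV. if e \<in> box then {-c..c} else {0})"
  have "compactin (product_topology (\<lambda>_. euclidean) UNIV) K"
    unfolding K_def compactin_PiE by auto
  then have K: "compact K" by (simp add: euclidean_product_topology)
  have cont: "continuous_on UNIV (\<lambda>a::nat \<times> nat \<Rightarrow> real. a e)" for e by simp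
  have "closed C"
  proof -
    have "C = (\<Inter>e\<in>- box. {a. a e = 0}) \<inter>
      (\<Inter>i\<in>{..<d}. \<Inter>j\<in>{..<d}. {a. (\<Sum>k<r. a (i, k) * a (j, k)) = M $$ (i, j)}) \<inter>
      (\<Inter>k\<in>{..<r}. \<Inter>l\<in>{..<r} - {k}. {a. (\<Sum>i<d. a (i, k) * a (i, l)) = 0})"
      unfolding C_def by auto
    also have "closed \<dots>"
      by (intro closed_Int closed_INT ballI closed_Collect_eq continuous_intros cont)
    finally show ?thesis .
  qed
  moreover have "C \<subseteq> K"
  proof
    fix a assume a: "a \<in> C"
    show "a \<in> K"
      unfolding K_def PiE_UNIV_domain
    proof (rule Pi_I)
      fix e :: "nat \<times> nat"
      show "a e \<in> (if e \<in> box then {-c..c} else {0})"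
      proof (cases "e \<in> box")
        case True
        then obtain i k where e: "e = (i, k)" "i < d" "k < r" by (auto simp: box_def)
        have "(a (i, k))\<^sup>2 \<le> (\<Sum>k<r. (a (i, k))\<^sup>2)"
          by (rule member_le_sum) (use e in auto)
        also have "\<dots> = M $$ (i, i)" using a e by (simp add: C_def power2_eq_square)
        also have "\<dots> \<le> \<bar>M $$ (i, i)\<bar>" by simp
        also have "\<dots> \<le> (\<Sum>i<d. \<bar>M $$ (i, i)\<bar>)"
          by (rule member_le_sum[of i]) (use e in auto)
        also have "\<dots> \<le> c * 1" by (simp add: c_def)
        also have "\<dots> \<le> c * c" by (intro mult_left_mono) (auto simp: c_def sum_nonneg)
        finally have "(a (i, k))\<^sup>2 \<le> c\<^sup>2" by (simp add: power2_eq_square)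
        moreover have "0 \<le> c" by (simp add: c_def sum_nonneg)
        ultimately have "\<bar>a (i, k)\<bar> \<le> c" using abs_le_square_iff[of "a (i, k)" c] by simp
        then show ?thesis using True e by (simp add: abs_le_iff)
      qed (use a in \<open>simp add: C_def\<close>)
    qed
  qed
  ultimately have "compact C" using K compact_Int_closed[of K C] by (simp add: Int_absorb1)
  have mat_C: "Matrix.mat d r a \<in> factor_set d r M" if "a \<in> C" for a
    using that unfolding factor_set_iff[OF M] by (simp add: C_def)
  have C_mat: "(\<lambda>e. if e \<in> box then A $$ e else 0) \<in> C" if "A \<in> factor_set d r M" for A
    using that unfolding factor_set_iff[OF M] by (auto simp: C_def box_def)
  have "C \<noteq> {}" using ne C_mat by blast
  define f where "f a = (\<Sum>i<d. \<Sum>k<r. (F $$ (i, k) - a (i, k))\<^sup>2)" for a :: "nat \<times> nat \<Rightarrow> real"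
  have "continuous_on C f"
    unfolding f_def by (intro continuous_intros continuous_on_subset[OF cont]) auto
  then obtain a where a: "a \<in> C" "\<And>b. b \<in> C \<Longrightarrow> f a \<le> f b"
    using continuous_attains_inf[OF \<open>compact C\<close> \<open>C \<noteq> {}\<close>] by blast
  define A where "A = Matrix.mat d r a"
  have A: "A \<in> factor_set d r M" unfolding A_def by (rule mat_C[OF a(1)])
  have min: "frob_norm (F - A) \<le> frob_norm (F - A')" if A': "A' \<in> factor_set d r M" for A'
  proof (rule power2_le_imp_le[OF _ frob_norm_nonneg])
    have "(frob_norm (F - A))\<^sup>2 = f a"
      using frob_norm_diff_sq[of A d r F] F by (simp add: A_def f_def)
    also have "\<dots> \<le> f (\<lambda>e. if e \<in> box then A' $$ e else 0)" by (rule a(2)[OF C_mat[OF A']])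
    also have "\<dots> = (frob_norm (F - A'))\<^sup>2"
      using frob_norm_diff_sq[of A' d r F] F A' by (simp add: f_def factor_set_def box_def)
    finally show "(frob_norm (F - A))\<^sup>2 \<le> (frob_norm (F - A'))\<^sup>2" .
  qed
  have "factor_dist d r M F = frob_norm (F - A)"
    unfolding factor_dist_def by (rule cInf_eq_minimum) (use A min in auto)
  with A min show ?thesis using that by blast
qed

section \<open>First-order optimality of the nearest factor\<close>

lemma sum_split_two:
  fixes X :: "nat \<Rightarrow> real"
  assumes "k < r" "l < r" "k \<noteq> l"
  shows "(\<Sum>m<r. X m) = X k + X l + (\<Sum>m\<in>{..<r} - {k, l}. X m)"
proof -
  have "(\<Sum>m<r. X m) = X k + (\<Sum>m\<in>{..<r} - {k}. X m)"
    by (rule sum.remove) (use assms in auto)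
  also have "(\<Sum>m\<in>{..<r} - {k}. X m) = X l + (\<Sum>m\<in>{..<r} - {k} - {l}. X m)"
    by (rule sum.remove) (use assms in auto)
  also have "{..<r} - {k} - {l} = {..<r} - {k, l}" by auto
  finally show ?thesis by simp
qed

text \<open>The functional attains its maximum, the norm of (P, Q), at the normalised vector (P, Q);
  a maximum of \<open>P\<close> forces Q = 0. No derivative with respect to the angle is
  required.\<close>

lemma linear_max_on_circle:
  fixes P Q :: real
  assumes "\<And>c \<sigma>. c\<^sup>2 + \<sigma>\<^sup>2 = 1 \<Longrightarrow> c * P + \<sigma> * Q \<le> P"
  shows "Q = 0"
proof (rule ccontr)
  assume "Q \<noteq> 0"
  define R where "R = sqrt (P\<^sup>2 + Q\<^sup>2)"
  have R2: "R\<^sup>2 = P\<^sup>2 + Q\<^sup>2" by (simp add: R_def)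
  have "0 < P\<^sup>2 + Q\<^sup>2" using \<open>Q \<noteq> 0\<close> by (simp add: add_nonneg_pos)
  then have R: "0 < R" by (simp add: R_def)
  have "(P / R)\<^sup>2 + (Q / R)\<^sup>2 = 1"
    unfolding power_divide add_divide_distrib[symmetric] R2[symmetric] using R by simp
  then have "P / R * P + Q / R * Q \<le> P" by (rule assms)
  then have "(P\<^sup>2 + Q\<^sup>2) / R \<le> P" by (simp add: power2_eq_square add_divide_distrib)
  moreover have "(P\<^sup>2 + Q\<^sup>2) / R = R"
    unfolding R2[symmetric] using R by (simp add: power2_eq_square)
  ultimately have "R \<le> P" by simp
  then have "R\<^sup>2 \<le> P\<^sup>2" using R by (intro power_mono) auto
  then show False using R2 \<open>Q \<noteq> 0\<close> by simp
qed

text \<open>The first-order optimality condition of a nearest factor, obtained by rotating two of its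
  columns; these have equal norms, so that the rotation stays inside the set of factors.\<close>

lemma nearest_factor_aligned:
  assumes M: "M \<in> carrier_mat d d" and F: "F \<in> carrier_mat d r" and A: "A \<in> factor_set d r M"
    and min: "\<And>A'. A' \<in> factor_set d r M \<Longrightarrow> frob_norm (F - A) \<le> frob_norm (F - A')"
    and orth: "\<And>k l. k < r \<Longrightarrow> l < r \<Longrightarrow> (\<Sum>i<d. A $$ (i, k) * A $$ (i, l)) = (if k = l then s else 0)"
    and kl: "k < r" "l < r"
  shows "(\<Sum>i<d. A $$ (i, k) * F $$ (i, l)) = (\<Sum>i<d. A $$ (i, l) * F $$ (i, k))"
proof (cases "k = l")
  case False
  have Ac: "A \<in> carrier_mat d r" using A by (simp add: factor_set_def)
  define P where "P = (\<Sum>i<d. A $$ (i, k) * F $$ (i, k)) + (\<Sum>i<d. A $$ (i, l) * F $$ (i, l))"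
  define Q where "Q = (\<Sum>i<d. A $$ (i, l) * F $$ (i, k)) - (\<Sum>i<d. A $$ (i, k) * F $$ (i, l))"
  have "Q = 0"
  proof (rule linear_max_on_circle)
    fix c \<sigma> :: real assume c: "c\<^sup>2 + \<sigma>\<^sup>2 = 1"
    define R where "R = Matrix.mat d r (\<lambda>(i, m). if m = k then c * A $$ (i, k) + \<sigma> * A $$ (i, l)
        else if m = l then c * A $$ (i, l) - \<sigma> * A $$ (i, k) else A $$ (i, m))"
    have Rc: "R \<in> carrier_mat d r" by (simp add: R_def)
    have Rk: "R $$ (i, k) = c * A $$ (i, k) + \<sigma> * A $$ (i, l)"
      and Rl: "R $$ (i, l) = c * A $$ (i, l) - \<sigma> * A $$ (i, k)" if "i < d" for i
      using that kl False by (simp_all add: R_def)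
    have Rm: "R $$ (i, m) = A $$ (i, m)" if "i < d" "m < r" "m \<noteq> k" "m \<noteq> l" for i m
      using that by (simp add: R_def)
    have rowdot: "(\<Sum>m<r. R $$ (i, m) * R $$ (j, m)) = (\<Sum>m<r. A $$ (i, m) * A $$ (j, m))" if "i < d" "j < d" for i j
    proof -
      have "R $$ (i, k) * R $$ (j, k) + R $$ (i, l) * R $$ (j, l)
          = (c\<^sup>2 + \<sigma>\<^sup>2) * (A $$ (i, k) * A $$ (j, k) + A $$ (i, l) * A $$ (j, l))"
        using that by (simp add: Rk Rl power2_eq_square algebra_simps)
      moreover have "(\<Sum>m\<in>{..<r} - {k, l}. R $$ (i, m) * R $$ (j, m)) = (\<Sum>m\<in>{..<r} - {k, l}. A $$ (i, m) * A $$ (j, m))"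
        using that by (intro sum.cong) (auto simp: Rm)
      ultimately show ?thesis unfolding sum_split_two[OF kl False] c by simp
    qed
    have coldot: "(\<Sum>i<d. R $$ (i, m) * R $$ (i, n)) = 0" if mn: "m < r" "n < r" "m \<noteq> n" for m n
    proof -
      define cp where "cp m n = (\<Sum>i<d. A $$ (i, m) * A $$ (i, n))" for m n
      have cp: "cp m n = (if m = n then s else 0)" if "m < r" "n < r" for m n
        unfolding cp_def by (rule orth[OF that])
      have lin: "(\<Sum>i<d. (x * A $$ (i, m) + y * A $$ (i, n)) * (x' * A $$ (i, m') + y' * A $$ (i, n')))
         = x * x' * cp m m' + x * y' * cp m n' + y * x' * cp n m' + y * y' * cp n n'" for x y x' y' m n m' n'
        by (simp add: cp_def sum_distrib_left sum.distrib algebra_simps)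
      \<comment> \<open>Every column of \<open>R\<close> is written as a combination of column
        \<open>k\<close> and one more column \<open>t m\<close>, so that a single bilinear expansion
        covers all cases of \<open>m\<close> and \<open>n\<close>.\<close>
      define x where "x m = (if m = k then c else if m = l then - \<sigma> else 0)" for m
      define y where "y m = (if m = k then \<sigma> else if m = l then c else 1)" for m
      define t where "t m = (if m = k \<or> m = l then l else m)" for m
      have R_eq: "R $$ (i, m) = x m * A $$ (i, k) + y m * A $$ (i, t m)" if "i < d" "m < r" for i m
        using that Rk Rl Rm False by (auto simp: x_def y_def t_def)
      have t: "t m < r" if "m < r" for m using that kl by (simp add: t_def)
      have "(\<Sum>i<d. R $$ (i, m) * R $$ (i, n))
          = (\<Sum>i<d. (x m * A $$ (i, k) + y m * A $$ (i, t m)) * (x n * A $$ (i, k) + y n * A $$ (i, t n)))"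
        using mn by (intro sum.cong) (auto simp: R_eq)
      also have "\<dots> = x m * x n * cp k k + x m * y n * cp k (t n) + y m * x n * cp (t m) k + y m * y n * cp (t m) (t n)"
        by (rule lin)
      also have "\<dots> = 0"
        using mn kl t[OF mn(1)] t[OF mn(2)] False by (auto simp: cp x_def y_def t_def)
      finally show ?thesis .
    qed
    have "R \<in> factor_set d r M"
      unfolding factor_set_iff[OF M]
      using A Rc rowdot coldot unfolding factor_set_iff[OF M] by auto
    then have "(frob_norm (F - A))\<^sup>2 \<le> (frob_norm (F - R))\<^sup>2"
      by (intro power_mono min frob_norm_nonneg)
    then have le: "(\<Sum>i<d. \<Sum>m<r. (F $$ (i, m) - A $$ (i, m))\<^sup>2) \<le> (\<Sum>i<d. \<Sum>m<r. (F $$ (i, m) - R $$ (i, m))\<^sup>2)"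
      using F Ac Rc by (simp add: frob_norm_diff_sq)
    \<comment> \<open>The rotation preserves row norms, so the quadratic terms cancel and the change
      of the squared distance is affine in c and \<sigma>.\<close>
    have row: "(\<Sum>m<r. (F $$ (i, m) - R $$ (i, m))\<^sup>2) - (\<Sum>m<r. (F $$ (i, m) - A $$ (i, m))\<^sup>2)
        = 2 * ((1 - c) * (A $$ (i, k) * F $$ (i, k) + A $$ (i, l) * F $$ (i, l))
           - \<sigma> * (A $$ (i, l) * F $$ (i, k) - A $$ (i, k) * F $$ (i, l)))" if i: "i < d" for i
    proof -
      have exp: "(\<Sum>m<r. (F $$ (i, m) - X $$ (i, m))\<^sup>2)
        = (\<Sum>m<r. (F $$ (i, m))\<^sup>2) - 2 * (\<Sum>m<r. X $$ (i, m) * F $$ (i, m)) + (\<Sum>m<r. X $$ (i, m) * X $$ (i, m))" for X :: "real mat"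
        by (simp add: power2_eq_square algebra_simps sum.distrib sum_subtractf sum_distrib_left)
      have "(\<Sum>m\<in>{..<r} - {k, l}. R $$ (i, m) * F $$ (i, m)) = (\<Sum>m\<in>{..<r} - {k, l}. A $$ (i, m) * F $$ (i, m))"
        using i by (intro sum.cong) (auto simp: Rm)
      then show ?thesis
        unfolding exp rowdot[OF i i] unfolding sum_split_two[OF kl False, of "\<lambda>m. _ $$ (i, m) * F $$ (i, m)"] Rk[OF i] Rl[OF i]
        by (simp add: algebra_simps)
    qed
    have "0 \<le> (\<Sum>i<d. (\<Sum>m<r. (F $$ (i, m) - R $$ (i, m))\<^sup>2) - (\<Sum>m<r. (F $$ (i, m) - A $$ (i, m))\<^sup>2))"
      using le by (simp add: sum_subtractf)
    also have "\<dots> = (\<Sum>i<d. 2 * ((1 - c) * (A $$ (i, k) * F $$ (i, k) + A $$ (i, l) * F $$ (i, l))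
           - \<sigma> * (A $$ (i, l) * F $$ (i, k) - A $$ (i, k) * F $$ (i, l))))"
      by (intro sum.cong) (auto simp: row)
    also have "\<dots> = 2 * ((1 - c) * P - \<sigma> * Q)"
      unfolding P_def Q_def by (simp only: sum_distrib_left[symmetric] sum_subtractf sum.distrib)
    finally show "c * P + \<sigma> * Q \<le> P" by (simp add: algebra_simps)
  qed
  then show ?thesis by (simp add: Q_def)
qed simp

text \<open>Used to show that a factor has no zero column: otherwise \<open>M\<close> would be a sum
  of r - 1 matrices of rank at most one.\<close>

lemma rank_sum_products_le:
  fixes f :: "nat \<Rightarrow> nat \<Rightarrow> real"
  assumes "finite S"
  shows "vec_space.rank d (Matrix.mat d d (\<lambda>(x, y). \<Sum>k\<in>S. f k x * f k y)) \<le> card S"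
  using assms
proof (induction S)
  case empty
  interpret vec_space "TYPE(real)" d .
  have "Matrix.mat d d (\<lambda>(x, y). \<Sum>k\<in>{}. f k x * f k y) = 0\<^sub>m d d" by (intro eq_matI) auto
  then show ?case by (simp only: rank_0I card.empty order_refl)
next
  case (insert k S)
  interpret vec_space "TYPE(real)" d .
  let ?A = "Matrix.mat d d (\<lambda>(x, y). f k x * f k y)" and ?B = "Matrix.mat d d (\<lambda>(x, y). \<Sum>k\<in>S. f k x * f k y)"
  have "Matrix.mat d d (\<lambda>(x, y). \<Sum>k\<in>insert k S. f k x * f k y) = ?A + ?B"
    using insert by (intro eq_matI) auto
  moreover have "rank (?A + ?B) \<le> rank ?A + rank ?B" by (rule rank_subadditive) auto
  moreover have "rank ?A \<le> 1" by (rule rank_le_1_product_entries[of _ d "f k" "f k"]) auto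
  ultimately show ?case using insert by simp
qed

text \<open>By orthogonality A A^T maps a column to its squared norm times itself, so the squared
  norms of the columns are nonzero eigenvalues of \<open>M\<close>. There is only one, hence
  \<open>s\<close> is the same for all columns of all factors.\<close>

lemma factor_columns:
  assumes M: "M \<in> carrier_mat d d" and rank: "vec_space.rank d M = r" and r: "1 \<le> r"
    and eig: "\<forall>k l. eigenvalue M k \<and> k \<noteq> 0 \<and> eigenvalue M l \<and> l \<noteq> 0 \<longrightarrow> k = l"
    and ne: "factor_set d r M \<noteq> {}"
  obtains s where "0 < s" "\<And>A k l. A \<in> factor_set d r M \<Longrightarrow> k < r \<Longrightarrow> l < r \<Longrightarrow>
    (\<Sum>i<d. A $$ (i, k) * A $$ (i, l)) = (if k = l then s else 0)"
proof -
  define c where "c A k = (\<Sum>i<d. A $$ (i, k) * A $$ (i, k))" for A :: "real mat" and k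
  have pos: "0 < c A k" if A: "A \<in> factor_set d r M" and k: "k < r" for A k
  proof (rule ccontr)
    assume "\<not> 0 < c A k"
    moreover have "0 \<le> c A k" unfolding c_def by (intro sum_nonneg) simp
    ultimately have "c A k = 0" by simp
    then have "\<forall>i<d. A $$ (i, k) = 0"
      unfolding c_def by (subst (asm) sum_nonneg_eq_0_iff) auto
    then have "M = Matrix.mat d d (\<lambda>(x, y). \<Sum>m\<in>{..<r} - {k}. A $$ (x, m) * A $$ (y, m))"
      using A M k unfolding factor_set_iff[OF M]
      by (intro eq_matI) (auto simp: sum.remove[of "{..<r}" k])
    then have "vec_space.rank d M \<le> card ({..<r} - {k})"
      using rank_sum_products_le[of "{..<r} - {k}" d "\<lambda>m x. A $$ (x, m)"] by simp
    then show False using rank r k by simp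
  qed
  have eigen: "eigenvalue M (c A k)" if A: "A \<in> factor_set d r M" and k: "k < r" for A k
  proof -
    have Ac: "A \<in> carrier_mat d r" using A by (simp add: factor_set_def)
    have "M *\<^sub>v col A k = c A k \<cdot>\<^sub>v col A k"
    proof (rule eq_vecI)
      fix x assume "x < dim_vec (c A k \<cdot>\<^sub>v col A k)"
      then have x: "x < d" using Ac by simp
      have "(M *\<^sub>v col A k) $ x = (\<Sum>y<d. M $$ (x, y) * A $$ (y, k))"
        using x M Ac k by (simp add: scalar_prod_def atLeast0LessThan)
      also have "\<dots> = (\<Sum>y<d. (\<Sum>l<r. A $$ (x, l) * A $$ (y, l)) * A $$ (y, k))"
        using A x unfolding factor_set_iff[OF M] by (intro sum.cong) auto
      also have "\<dots> = (\<Sum>l<r. A $$ (x, l) * (\<Sum>y<d. A $$ (y, l) * A $$ (y, k)))"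
        unfolding sum_distrib_right sum_distrib_left by (subst sum.swap) (simp add: mult.assoc)
      also have "\<dots> = (\<Sum>l<r. if l = k then A $$ (x, k) * c A k else 0)"
        using A k unfolding factor_set_iff[OF M] by (intro sum.cong) (auto simp: c_def)
      also have "\<dots> = (c A k \<cdot>\<^sub>v col A k) $ x" using k x Ac by (simp add: mult.commute)
      finally show "(M *\<^sub>v col A k) $ x = (c A k \<cdot>\<^sub>v col A k) $ x" .
    qed (use M Ac in simp)
    moreover have "col A k \<noteq> 0\<^sub>v d"
    proof
      assume "col A k = 0\<^sub>v d"
      then have "A $$ (i, k) = 0" if "i < d" for i
        using that Ac k by (metis index_col index_zero_vec(1) carrier_matD)
      then have "c A k = 0" by (simp add: c_def)
      then show False using pos[OF A k] by simp
    qed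
    ultimately show ?thesis
      unfolding eigenvalue_def eigenvector_def using M Ac by (intro exI[of _ "col A k"]) auto
  qed
  obtain A0 where A0: "A0 \<in> factor_set d r M" using ne by blast
  have "c A k = c A0 0" if "A \<in> factor_set d r M" "k < r" for A k
    using eig eigen[OF that] pos[OF that] eigen[OF A0, of 0] pos[OF A0, of 0] r by auto
  then have "(\<Sum>i<d. A $$ (i, k) * A $$ (i, l)) = (if k = l then c A0 0 else 0)"
    if "A \<in> factor_set d r M" "k < r" "l < r" for A k l
    using that unfolding factor_set_iff[OF M] c_def by auto
  then show ?thesis using that[of "c A0 0"] pos[OF A0, of 0] r by auto
qed

section \<open>Norms, projection and gradient in coordinates\<close>

lemma l2_norm_sq: "(l2_norm v)\<^sup>2 = (\<Sum>i<dim_vec v. (v $ i)\<^sup>2)"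
  unfolding l2_norm_def by (simp add: scalar_prod_def atLeast0LessThan sum_nonneg power2_eq_square)

lemma l2_norm_nonneg: "0 \<le> l2_norm v"
  by (simp add: l2_norm_def scalar_prod_def sum_nonneg)

lemma mult_mat_vec_index:
  assumes "A \<in> carrier_mat n m" "v \<in> carrier_vec m" "i < n"
  shows "(A *\<^sub>v v) $ i = (\<Sum>j<m. A $$ (i, j) * v $ j)"
  using assms by (simp add: scalar_prod_def atLeast0LessThan)

lemma bdd_above_op_norm:
  "bdd_above ((\<lambda>v. l2_norm (A *\<^sub>v v)) ` {v \<in> carrier_vec (dim_col A). l2_norm v \<le> 1})"
proof (rule bdd_aboveI2)
  fix v assume "v \<in> {v \<in> carrier_vec (dim_col A). l2_norm v \<le> 1}"
  then have v: "v \<in> carrier_vec (dim_col A)" "l2_norm v \<le> 1" by auto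
  have A: "A \<in> carrier_mat (dim_row A) (dim_col A)" by simp
  show "l2_norm (A *\<^sub>v v) \<le> frob_norm A"
  proof (rule power2_le_imp_le[OF _ frob_norm_nonneg])
    have "(l2_norm (A *\<^sub>v v))\<^sup>2 = (\<Sum>i<dim_row A. (\<Sum>j<dim_col A. A $$ (i, j) * v $ j)\<^sup>2)"
      unfolding l2_norm_sq by (intro sum.cong) (use mult_mat_vec_index[OF A v(1)] in auto)
    also have "\<dots> \<le> (\<Sum>i<dim_row A. (\<Sum>j<dim_col A. (A $$ (i, j))\<^sup>2) * (\<Sum>j<dim_col A. (v $ j)\<^sup>2))"
      by (intro sum_mono Cauchy_Schwarz_ineq_sum)
    also have "\<dots> = (frob_norm A)\<^sup>2 * (l2_norm v)\<^sup>2"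
      using v by (simp add: frob_norm_sq[OF A] l2_norm_sq sum_distrib_right)
    also have "\<dots> \<le> (frob_norm A)\<^sup>2 * 1"
      using v l2_norm_nonneg[of v] by (intro mult_left_mono power_le_one) auto
    finally show "(l2_norm (A *\<^sub>v v))\<^sup>2 \<le> (frob_norm A)\<^sup>2" by simp
  qed
qed

lemma l2_norm_smult: "l2_norm (c \<cdot>\<^sub>v v) = \<bar>c\<bar> * l2_norm v"
proof -
  have "scalar_prod (c \<cdot>\<^sub>v v) (c \<cdot>\<^sub>v v) = c\<^sup>2 * scalar_prod v v"
    by (simp add: scalar_prod_def sum_distrib_left power2_eq_square mult_ac)
  then show ?thesis by (simp add: l2_norm_def real_sqrt_mult)
qed

lemma l2_norm_mult_le:
  assumes A: "A \<in> carrier_mat n m" and v: "v \<in> carrier_vec m"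
  shows "l2_norm (A *\<^sub>v v) \<le> op_norm A * l2_norm v"
proof (cases "l2_norm v = 0")
  case True
  then have "(\<Sum>i<m. (v $ i)\<^sup>2) = 0" using l2_norm_sq[of v] v by simp
  then have v0: "\<forall>i<m. v $ i = 0" by (simp add: sum_nonneg_eq_0_iff)
  have "(l2_norm (A *\<^sub>v v))\<^sup>2 = 0"
    unfolding l2_norm_sq using A v0 mult_mat_vec_index[OF A v] by (auto intro!: sum.neutral)
  then show ?thesis using True by simp
next
  case False
  then have pos: "0 < l2_norm v" using l2_norm_nonneg[of v] by simp
  define u where "u = (1 / l2_norm v) \<cdot>\<^sub>v v"
  have "u \<in> carrier_vec (dim_col A)" "l2_norm u \<le> 1"
    using A v pos by (simp_all add: u_def l2_norm_smult)
  then have "l2_norm (A *\<^sub>v u) \<le> op_norm A"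
    unfolding op_norm_def by (intro cSUP_upper bdd_above_op_norm) auto
  moreover have "A *\<^sub>v u = (1 / l2_norm v) \<cdot>\<^sub>v (A *\<^sub>v v)"
    unfolding u_def using A v by (rule mult_mat_vec)
  ultimately have "l2_norm (A *\<^sub>v v) / l2_norm v \<le> op_norm A"
    using pos by (simp add: l2_norm_smult)
  then show ?thesis using pos by (simp add: divide_le_eq)
qed

lemma op_norm_nonneg: "0 \<le> op_norm A"
proof -
  have "l2_norm (0\<^sub>v (dim_col A)) \<le> 1" by (simp add: l2_norm_def)
  then have "l2_norm (A *\<^sub>v 0\<^sub>v (dim_col A)) \<le> op_norm A"
    unfolding op_norm_def by (intro cSUP_upper bdd_above_op_norm) auto
  then show ?thesis using l2_norm_nonneg order_trans by blast
qed

lemma op_norm_mult_frob_le: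
  fixes f :: "nat \<Rightarrow> nat \<Rightarrow> real"
  assumes A: "A \<in> carrier_mat d d"
  shows "(\<Sum>j<d. \<Sum>k<r. (\<Sum>i<d. A $$ (j, i) * f i k)\<^sup>2) \<le> (op_norm A)\<^sup>2 * (\<Sum>i<d. \<Sum>k<r. (f i k)\<^sup>2)"
proof -
  have col: "(\<Sum>j<d. (\<Sum>i<d. A $$ (j, i) * f i k)\<^sup>2) \<le> (op_norm A)\<^sup>2 * (\<Sum>i<d. (f i k)\<^sup>2)" for k
  proof -
    define v where "v = Matrix.vec d (\<lambda>i. f i k)"
    have v: "v \<in> carrier_vec d" by (simp add: v_def)
    have "(\<Sum>j<d. (\<Sum>i<d. A $$ (j, i) * f i k)\<^sup>2) = (l2_norm (A *\<^sub>v v))\<^sup>2"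
      unfolding l2_norm_sq using A mult_mat_vec_index[OF A v] by (simp add: v_def)
    also have "\<dots> \<le> (op_norm A * l2_norm v)\<^sup>2"
      by (intro power_mono l2_norm_mult_le[OF A v] l2_norm_nonneg)
    also have "\<dots> = (op_norm A)\<^sup>2 * (\<Sum>i<d. (f i k)\<^sup>2)"
      by (simp add: power_mult_distrib l2_norm_sq v_def)
    finally show ?thesis .
  qed
  have "(\<Sum>j<d. \<Sum>k<r. (\<Sum>i<d. A $$ (j, i) * f i k)\<^sup>2) = (\<Sum>k<r. \<Sum>j<d. (\<Sum>i<d. A $$ (j, i) * f i k)\<^sup>2)"
    by (rule sum.swap)
  also have "\<dots> \<le> (\<Sum>k<r. (op_norm A)\<^sup>2 * (\<Sum>i<d. (f i k)\<^sup>2))" by (intro sum_mono col)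
  also have "\<dots> = (op_norm A)\<^sup>2 * (\<Sum>i<d. \<Sum>k<r. (f i k)\<^sup>2)"
    unfolding sum_distrib_left[symmetric] by (subst sum.swap) simp
  finally show ?thesis .
qed

lemma op_norm_orthogonal_columns:
  assumes A: "A \<in> carrier_mat d r" and r: "1 \<le> r" and s: "0 \<le> s"
    and orth: "\<And>k l. k < r \<Longrightarrow> l < r \<Longrightarrow> (\<Sum>i<d. A $$ (i, k) * A $$ (i, l)) = (if k = l then s else 0)"
  shows "op_norm A = sqrt s"
proof -
  have scale: "l2_norm (A *\<^sub>v v) = sqrt s * l2_norm v" if v: "v \<in> carrier_vec r" for v
  proof (rule power2_eq_imp_eq)
    define a where "a i k = A $$ (i, k)" for i k
    have "(l2_norm (A *\<^sub>v v))\<^sup>2 = (\<Sum>i<d. ip {..<r} (a i) (($) v) * ip {..<r} (a i) (($) v))"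
      unfolding l2_norm_sq using A mult_mat_vec_index[OF A v] by (simp add: ip_def a_def power2_eq_square)
    also have "\<dots> = s * ip {..<r} (($) v) (($) v)"
      by (rule sum_ip_orthogonal_columns) (simp add: a_def orth)
    also have "ip {..<r} (($) v) (($) v) = (l2_norm v)\<^sup>2"
      using v l2_norm_sq[of v] by (simp add: ip_def power2_eq_square)
    finally show "(l2_norm (A *\<^sub>v v))\<^sup>2 = (sqrt s * l2_norm v)\<^sup>2"
      using s by (simp add: power_mult_distrib)
  qed (use s l2_norm_nonneg in auto)
  have dim: "dim_col A = r" using A by simp
  show ?thesis
    unfolding op_norm_def dim
  proof (rule antisym)
    have "0\<^sub>v r \<in> {v \<in> carrier_vec r. l2_norm v \<le> 1}" by (simp add: l2_norm_def)
    then show "(SUP v\<in>{v \<in> carrier_vec r. l2_norm v \<le> 1}. l2_norm (A *\<^sub>v v)) \<le> sqrt s"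
      by (intro cSUP_least, blast) (use s in \<open>auto simp: scale mult_left_le l2_norm_nonneg\<close>)
    have u: "unit_vec r 0 \<in> carrier_vec r" "l2_norm (unit_vec r 0) = 1"
      using r by (simp_all add: l2_norm_def)
    have "l2_norm (A *\<^sub>v unit_vec r 0) \<le> (SUP v\<in>{v \<in> carrier_vec r. l2_norm v \<le> 1}. l2_norm (A *\<^sub>v v))"
      by (intro cSUP_upper bdd_above_op_norm[of A, unfolded dim]) (use u in auto)
    then show "sqrt s \<le> (SUP v\<in>{v \<in> carrier_vec r. l2_norm v \<le> 1}. l2_norm (A *\<^sub>v v))"
      using scale[OF u(1)] u(2) by simp
  qed
qed

section \<open>Row norms and the projection onto the feasible set\<close>

abbreviation entries :: "real mat \<Rightarrow> nat \<Rightarrow> nat \<Rightarrow> real" where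
  "entries A i k \<equiv> A $$ (i, k)"

lemma l2_norm_row:
  assumes "A \<in> carrier_mat d r" "i < d"
  shows "l2_norm (Matrix.row A i) = nm {..<r} (entries A i)"
  using assms by (simp add: l2_norm_def nm_def ip_def scalar_prod_def atLeast0LessThan)

lemma two_inf_norm_le_iff:
  assumes "A \<in> carrier_mat d r" "1 \<le> d"
  shows "two_inf_norm A \<le> \<tau> \<longleftrightarrow> (\<forall>i<d. nm {..<r} (entries A i) \<le> \<tau>)"
proof -
  have "two_inf_norm A \<le> \<tau> \<longleftrightarrow> (\<forall>i<d. l2_norm (Matrix.row A i) \<le> \<tau>)"
    using assms unfolding two_inf_norm_def by (subst Max_le_iff) (auto simp: lessThan_empty_iff)
  then show ?thesis using l2_norm_row[OF assms(1)] by auto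
qed

text \<open>The projection of a vector onto the ball of radius \<tau>. The feasible set is a product
  of such balls, one for each row.\<close>

definition proj_row :: "'i set \<Rightarrow> real \<Rightarrow> ('i \<Rightarrow> real) \<Rightarrow> 'i \<Rightarrow> real" where
  "proj_row I \<tau> z = (\<lambda>k. (if nm I z \<le> \<tau> then 1 else \<tau> / nm I z) * z k)"

lemma nm_scale: "nm I (\<lambda>k. c * u k) = \<bar>c\<bar> * nm I u"
  unfolding nm_def ip_scale_left ip_scale_right
  by (simp add: real_sqrt_mult mult.assoc[symmetric])

lemma nm_proj_row: "0 \<le> \<tau> \<Longrightarrow> nm I (proj_row I \<tau> z) \<le> \<tau>"
  unfolding proj_row_def nm_scale using nm_nonneg[of I z] by auto

lemma proj_row_obtuse:
  assumes \<tau>: "0 \<le> \<tau>" and x: "nm I x \<le> \<tau>"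
  shows "ip I (\<lambda>k. z k - proj_row I \<tau> z k) (\<lambda>k. x k - proj_row I \<tau> z k) \<le> 0"
proof (cases "nm I z \<le> \<tau>")
  case True
  then show ?thesis by (simp add: proj_row_def ip_def)
next
  case False
  define t where "t = \<tau> / nm I z"
  have z: "0 < nm I z" using False \<tau> by simp
  have t: "t \<le> 1" using False z by (simp add: t_def)
  have "proj_row I \<tau> z = (\<lambda>k. t * z k)" using False by (simp add: proj_row_def t_def)
  then have "ip I (\<lambda>k. z k - proj_row I \<tau> z k) (\<lambda>k. x k - proj_row I \<tau> z k) = (1 - t) * (ip I z x - t * ip I z z)"
    by (simp add: ip_minus_left ip_minus_right ip_scale_left ip_scale_right algebra_simps)
  also have "\<dots> \<le> 0"
  proof (rule mult_nonneg_nonpos)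
    have "ip I z x \<le> nm I z * nm I x" using abs_ip_le[of I z x] by linarith
    also have "\<dots> \<le> nm I z * \<tau>" using x z by simp
    also have "\<dots> = t * ip I z z" using z by (simp add: t_def nm_sq[symmetric] power2_eq_square)
    finally show "ip I z x - t * ip I z z \<le> 0" by simp
  qed (use t in simp)
  finally show ?thesis .
qed

text \<open>Since \<open>frob_proj\<close> selects some minimiser, uniqueness is part of the claim.
  The obtuse angle in each row gives the Pythagorean inequality \<open>pyth\<close>, which makes
  \<open>P\<close> minimal and any other minimiser equal to it.\<close>

lemma frob_proj_rows:
  assumes Z: "Z \<in> carrier_mat d r" and \<tau>: "0 \<le> \<tau>" and d: "1 \<le> d"
  defines "S \<equiv> {X \<in> carrier_mat d r. two_inf_norm X \<le> \<tau>}"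
  shows "frob_proj S Z = Matrix.mat d r (\<lambda>(i, k). proj_row {..<r} \<tau> (entries Z i) k)"
proof -
  define P where "P = Matrix.mat d r (\<lambda>(i, k). proj_row {..<r} \<tau> (entries Z i) k)"
  have Pc: "P \<in> carrier_mat d r" by (simp add: P_def)
  have P_row: "ip {..<r} u (\<lambda>k. x k - P $$ (i, k)) = ip {..<r} u (\<lambda>k. x k - proj_row {..<r} \<tau> (entries Z i) k)"
    "ip {..<r} (\<lambda>k. x k - P $$ (i, k)) u = ip {..<r} (\<lambda>k. x k - proj_row {..<r} \<tau> (entries Z i) k) u"
    if "i < d" for i u x
    using that by (simp_all add: ip_def P_def)
  have P_S: "P \<in> S"
  proof -
    have "nm {..<r} (entries P i) \<le> \<tau>" if "i < d" for i
    proof -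
      have "nm {..<r} (entries P i) = nm {..<r} (proj_row {..<r} \<tau> (entries Z i))"
        using that by (simp add: nm_def ip_def P_def)
      then show ?thesis using nm_proj_row[OF \<tau>] by simp
    qed
    then show ?thesis unfolding S_def using Pc two_inf_norm_le_iff[OF Pc d] by simp
  qed
  have pyth: "(frob_norm (Z - P))\<^sup>2 + (frob_norm (X - P))\<^sup>2 \<le> (frob_norm (Z - X))\<^sup>2" if X: "X \<in> S" for X
  proof -
    have Xc: "X \<in> carrier_mat d r" and Xn: "\<And>i. i < d \<Longrightarrow> nm {..<r} (entries X i) \<le> \<tau>"
      using X two_inf_norm_le_iff[OF _ d] by (auto simp: S_def)
    have "(\<Sum>k<r. (Z $$ (i, k) - P $$ (i, k))\<^sup>2) + (\<Sum>k<r. (X $$ (i, k) - P $$ (i, k))\<^sup>2)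
        \<le> (\<Sum>k<r. (Z $$ (i, k) - X $$ (i, k))\<^sup>2)" if i: "i < d" for i
    proof -
      define zp where "zp k = Z $$ (i, k) - P $$ (i, k)" for k
      define xp where "xp k = X $$ (i, k) - P $$ (i, k)" for k
      have "ip {..<r} zp xp \<le> 0"
        unfolding zp_def xp_def P_row[OF i] by (rule proj_row_obtuse[OF \<tau> Xn[OF i]])
      moreover have "(\<Sum>k<r. (Z $$ (i, k) - X $$ (i, k))\<^sup>2) = ip {..<r} (\<lambda>k. zp k - xp k) (\<lambda>k. zp k - xp k)"
        by (simp add: zp_def xp_def ip_def power2_eq_square)
      moreover have "(\<Sum>k<r. (Z $$ (i, k) - P $$ (i, k))\<^sup>2) = ip {..<r} zp zp"
        "(\<Sum>k<r. (X $$ (i, k) - P $$ (i, k))\<^sup>2) = ip {..<r} xp xp"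
        by (simp_all add: zp_def xp_def ip_def power2_eq_square)
      ultimately show ?thesis
        by (simp add: ip_minus_left ip_minus_right ip_commute[of _ xp zp])
    qed
    then show ?thesis
      unfolding frob_norm_diff_sq[OF Pc Z] frob_norm_diff_sq[OF Pc Xc] frob_norm_diff_sq[OF Xc Z] sum.distrib[symmetric]
      by (rule sum_mono) auto
  qed
  define Q where "Q = frob_proj S Z"
  have min_P: "frob_norm (Z - P) \<le> frob_norm (Z - X)" if "X \<in> S" for X
    by (rule power2_le_imp_le[OF _ frob_norm_nonneg])
      (use pyth[OF that] zero_le_power2[of "frob_norm (X - P)"] in linarith)
  have "is_arg_min (\<lambda>X. frob_norm (Z - X)) (\<lambda>X. X \<in> S) P"
    unfolding is_arg_min_def using P_S min_P by (auto simp: not_less)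
  then have "is_arg_min (\<lambda>X. frob_norm (Z - X)) (\<lambda>X. X \<in> S) Q"
    unfolding Q_def frob_proj_def arg_min_on_def arg_min_def by (rule someI)
  then have Q: "Q \<in> S" "frob_norm (Z - Q) \<le> frob_norm (Z - P)"
    using P_S by (auto simp: is_arg_min_def not_less)
  have "(frob_norm (Z - Q))\<^sup>2 \<le> (frob_norm (Z - P))\<^sup>2" by (intro power_mono Q frob_norm_nonneg)
  then have "(frob_norm (Q - P))\<^sup>2 \<le> 0" using pyth[OF Q(1)] by linarith
  moreover have Qc: "Q \<in> carrier_mat d r" using Q by (simp add: S_def)
  ultimately have "(\<Sum>i<d. \<Sum>k<r. (Q $$ (i, k) - P $$ (i, k))\<^sup>2) = 0"
    by (metis frob_norm_diff_sq[OF Pc Qc] antisym zero_le_power2)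
  then have "\<forall>i<d. \<forall>k<r. Q $$ (i, k) = P $$ (i, k)"
    by (simp add: sum_nonneg_eq_0_iff sum_nonneg)
  then have "Q = P" using Pc Qc by (intro eq_matI) auto
  then show ?thesis by (simp add: Q_def P_def)
qed

text \<open>An entry in row \<open>i\<close> affects the positions in row \<open>i\<close> and those
  in column \<open>i\<close>. By symmetry of the pattern and of \<open>Y\<close> both contribute
  equally, and with the 2 from the square the prefactor 1 / (2 p) becomes 2 / p.\<close>

lemma gradient_loss:
  assumes F: "F \<in> carrier_mat d r" and \<Omega>: "\<Omega> \<subseteq> {..<d} \<times> {..<d}" "sym \<Omega>"
    and Y: "\<And>i j. i < d \<Longrightarrow> j < d \<Longrightarrow> Y $$ (i, j) = Y $$ (j, i)" and p: "0 < p"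
    and ik: "i < d" "k < r"
  shows "gradient (loss p \<Omega> Y) F $$ (i, k)
    = 2 / p * (\<Sum>j<d. of_bool ((j, i) \<in> \<Omega>) * (ip {..<r} (entries F j) (entries F i) - Y $$ (j, i)) * F $$ (j, k))"
proof -
  define G where "G x a l = (if a = i \<and> l = k then x else F $$ (a, l))" for x a l
  define D where "D a b = ip {..<r} (entries F a) (entries F b) - Y $$ (a, b)" for a b
  have loss_eq: "loss p \<Omega> Y (Matrix.mat (dim_row F) (dim_col F) (\<lambda>kl. if kl = (i, k) then x else F $$ kl))
      = 1 / (2 * p) * (\<Sum>(a, b)\<in>\<Omega>. ((\<Sum>l<r. G x a l * G x b l) - Y $$ (a, b))\<^sup>2)" for x
    unfolding loss_def
  proof (intro arg_cong2[where f = "(*)"] refl sum.cong)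
    fix e assume "e \<in> \<Omega>"
    then obtain a b where e: "e = (a, b)" "a < d" "b < d" using \<Omega> by auto
    let ?X = "Matrix.mat (dim_row F) (dim_col F) (\<lambda>kl. if kl = (i, k) then x else F $$ kl)"
    have X: "?X \<in> carrier_mat d r" using F by simp
    have "(?X * transpose_mat ?X) $$ (a, b) = (\<Sum>l<r. G x a l * G x b l)"
      unfolding mult_transpose_index[OF X e(2,3)] by (intro sum.cong) (use e F in \<open>auto simp: G_def\<close>)
    then show "((?X * transpose_mat ?X) $$ e - Y $$ e)\<^sup>2 = (case e of (a, b) \<Rightarrow> ((\<Sum>l<r. G x a l * G x b l) - Y $$ (a, b))\<^sup>2)"
      by (simp add: e)
  qed
  have G_deriv: "((\<lambda>x. G x a l) has_real_derivative of_bool (a = i \<and> l = k)) (at x)" for a l x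
  proof (cases "a = i \<and> l = k")
    case False
    then have "(\<lambda>x. G x a l) = (\<lambda>x. F $$ (a, l))" by (auto simp: G_def)
    moreover have "of_bool (a = i \<and> l = k) = (0::real)" using False by auto
    ultimately show ?thesis by (simp only: DERIV_const)
  qed (simp add: G_def)
  have G_at: "G (F $$ (i, k)) a l = F $$ (a, l)" for a l by (simp add: G_def)
  have delta: "(\<Sum>l<r. of_bool (a = i \<and> l = k) * c l) = of_bool (a = i) * c k" for a and c :: "nat \<Rightarrow> real"
    using ik by (cases "a = i") (simp_all add: of_bool_def if_distrib[of "\<lambda>x. x * _"] cong: if_cong)
  have "((\<lambda>x. 1 / (2 * p) * (\<Sum>(a, b)\<in>\<Omega>. ((\<Sum>l<r. G x a l * G x b l) - Y $$ (a, b))\<^sup>2)) has_real_derivative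
      1 / (2 * p) * (\<Sum>(a, b)\<in>\<Omega>. 2 * D a b * (of_bool (a = i) * F $$ (b, k) + of_bool (b = i) * F $$ (a, k)))) (at (F $$ (i, k)))"
  proof (intro DERIV_cmult DERIV_sum)
    fix e :: "nat \<times> nat"
    obtain a b where e: "e = (a, b)" by (cases e)
    have deriv: "((\<lambda>x. (\<Sum>l<r. G x a l * G x b l) - Y $$ (a, b)) has_real_derivative
        (\<Sum>l<r. of_bool (a = i \<and> l = k) * G (F $$ (i, k)) b l + of_bool (b = i \<and> l = k) * G (F $$ (i, k)) a l) - 0)
        (at (F $$ (i, k)))"
      by (intro DERIV_diff DERIV_sum DERIV_mult G_deriv DERIV_const)
    define w where "w = of_bool (a = i) * F $$ (b, k) + of_bool (b = i) * F $$ (a, k)"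
    from deriv have q: "((\<lambda>x. (\<Sum>l<r. G x a l * G x b l) - Y $$ (a, b)) has_real_derivative w) (at (F $$ (i, k)))"
      unfolding G_at sum.distrib delta w_def by simp
    have "((\<lambda>x. ((\<Sum>l<r. G x a l * G x b l) - Y $$ (a, b))\<^sup>2) has_real_derivative
        2 * D a b * w) (at (F $$ (i, k)))"
      using DERIV_power[OF q, of 2] by (simp add: G_at D_def ip_def mult_ac)
    then show "((\<lambda>x. case e of (a, b) \<Rightarrow> ((\<Sum>l<r. G x a l * G x b l) - Y $$ (a, b))\<^sup>2) has_real_derivative
        (case e of (a, b) \<Rightarrow> 2 * D a b * (of_bool (a = i) * F $$ (b, k) + of_bool (b = i) * F $$ (a, k)))) (at (F $$ (i, k)))"
      by (simp add: e w_def)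
  qed
  then have "gradient (loss p \<Omega> Y) F $$ (i, k)
      = 1 / (2 * p) * (\<Sum>(a, b)\<in>\<Omega>. 2 * D a b * (of_bool (a = i) * F $$ (b, k) + of_bool (b = i) * F $$ (a, k)))"
    unfolding gradient_def using F ik loss_eq by (simp add: DERIV_imp_deriv)
  also have "(\<Sum>(a, b)\<in>\<Omega>. 2 * D a b * (of_bool (a = i) * F $$ (b, k) + of_bool (b = i) * F $$ (a, k)))
      = (\<Sum>a<d. \<Sum>b<d. of_bool ((a, b) \<in> \<Omega>) * (2 * D a b * (of_bool (a = i) * F $$ (b, k) + of_bool (b = i) * F $$ (a, k))))"
    by (rule sum_pattern[OF \<Omega>(1)])
  also have "\<dots> = (\<Sum>a<d. \<Sum>b<d. of_bool (a = i) * (2 * (of_bool ((a, b) \<in> \<Omega>) * D a b * F $$ (b, k))))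
      + (\<Sum>a<d. \<Sum>b<d. of_bool (b = i) * (2 * (of_bool ((a, b) \<in> \<Omega>) * D a b * F $$ (a, k))))"
    unfolding sum.distrib[symmetric] by (intro sum.cong refl) (simp add: algebra_simps)
  also have "(\<Sum>a<d. \<Sum>b<d. of_bool (a = i) * (2 * (of_bool ((a, b) \<in> \<Omega>) * D a b * F $$ (b, k))))
      = (\<Sum>a<d. if a = i then \<Sum>b<d. 2 * (of_bool ((a, b) \<in> \<Omega>) * D a b * F $$ (b, k)) else 0)"
    by (intro sum.cong) auto
  also have "\<dots> = (\<Sum>b<d. 2 * (of_bool ((i, b) \<in> \<Omega>) * D i b * F $$ (b, k)))" using ik by simp
  also have "\<dots> = (\<Sum>b<d. 2 * (of_bool ((b, i) \<in> \<Omega>) * D b i * F $$ (b, k)))"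
  proof (intro sum.cong refl)
    fix b assume "b \<in> {..<d}"
    then have "D i b = D b i" using Y[of i b] ik by (simp add: D_def ip_commute)
    moreover have "(i, b) \<in> \<Omega> \<longleftrightarrow> (b, i) \<in> \<Omega>" using \<Omega>(2) by (auto simp: sym_def)
    ultimately show "2 * (of_bool ((i, b) \<in> \<Omega>) * D i b * F $$ (b, k)) = 2 * (of_bool ((b, i) \<in> \<Omega>) * D b i * F $$ (b, k))"
      by simp
  qed
  also have "(\<Sum>a<d. \<Sum>b<d. of_bool (b = i) * (2 * (of_bool ((a, b) \<in> \<Omega>) * D a b * F $$ (a, k))))
      = (\<Sum>a<d. \<Sum>b<d. if b = i then 2 * (of_bool ((a, b) \<in> \<Omega>) * D a b * F $$ (a, k)) else 0)"
    by (intro sum.cong) auto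
  also have "\<dots> = (\<Sum>b<d. 2 * (of_bool ((b, i) \<in> \<Omega>) * D b i * F $$ (b, k)))" using ik by simp
  finally show ?thesis
    using p by (simp add: sum_distrib_left[symmetric] D_def)
qed

section \<open>The observation model\<close>

lemma sym_cl_lower_part:
  assumes "\<Omega> \<subseteq> {..<d} \<times> {..<d}" "sym \<Omega>"
  shows "sym_cl (\<Omega> \<inter> lower_pairs d) = \<Omega>"
proof (rule Set.set_eqI)
  fix e :: "nat \<times> nat"
  obtain i j where e: "e = (i, j)" by (cases e)
  have "(i, j) \<in> \<Omega> \<longleftrightarrow> (j, i) \<in> \<Omega>" using assms(2) by (auto simp: sym_def)
  moreover have "(i, j) \<in> \<Omega> \<Longrightarrow> i < d \<and> j < d" using assms(1) by auto
  ultimately show "e \<in> sym_cl (\<Omega> \<inter> lower_pairs d) \<longleftrightarrow> e \<in> \<Omega>"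
    by (auto simp: e sym_cl_def lower_pairs_def)
qed

context symmetric_bernoulli_model
begin

definition pattern_event :: "(nat \<times> nat) set \<Rightarrow> (nat \<times> nat) set \<Rightarrow> ((nat \<times> nat) set \<times> real mat) set" where
  "pattern_event T U = {\<omega> \<in> space P. T \<subseteq> fst \<omega> \<and> U \<inter> fst \<omega> = {}}"

text \<open>Independence is given for the events of being observed. Unobserved positions are added
  one at a time by subtraction: the event for \<open>e\<close> unobserved is the event without
  \<open>e\<close> minus that with \<open>e\<close> observed, so the induction on \<open>U\<close>
  must leave \<open>T\<close> arbitrary.\<close>

lemma pattern_event_prob:
  assumes "finite U" "finite T" "T \<union> U \<subseteq> lower_pairs d" "T \<inter> U = {}"
  shows "pattern_event T U \<in> events \<and> prob (pattern_event T U) = p ^ card T * (1 - p) ^ card U"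
  using assms
proof (induction U arbitrary: T)
  case empty
  define ev where "ev ij = {\<omega> \<in> space P. ij \<in> fst \<omega>}" for ij
  have indep: "indep_events ev (lower_pairs d)"
    using observed_indep by (simp add: ev_def[abs_def] lower_pairs_def)
  have pr: "prob (ev ij) = p" if "ij \<in> T" for ij
    using that empty observed_prob[of "snd ij" "fst ij"] by (auto simp: ev_def lower_pairs_def)
  show ?case
  proof (cases "T = {}")
    case True
    then show ?thesis by (simp add: pattern_event_def prob_space)
  next
    case False
    have eq: "pattern_event T {} = (\<Inter>ij\<in>T. ev ij)"
      using False by (auto simp: pattern_event_def ev_def)
    have "prob (\<Inter>ij\<in>T. ev ij) = (\<Prod>ij\<in>T. prob (ev ij))"
      using indep empty False unfolding indep_events_def by simp
    moreover have "(\<Inter>ij\<in>T. ev ij) \<in> events"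
      using indep empty False unfolding indep_events_def by (intro sets.finite_INT) auto
    ultimately show ?thesis unfolding eq by (simp add: pr)
  qed
next
  case (insert e U)
  have 1: "pattern_event T U \<in> events \<and> prob (pattern_event T U) = p ^ card T * (1 - p) ^ card U"
    using insert by (intro insert.IH) auto
  have 2: "pattern_event (Set.insert e T) U \<in> events \<and>
      prob (pattern_event (Set.insert e T) U) = p ^ card (Set.insert e T) * (1 - p) ^ card U"
    using insert by (intro insert.IH) auto
  have diff: "pattern_event T (Set.insert e U) = pattern_event T U - pattern_event (Set.insert e T) U"
    by (auto simp: pattern_event_def)
  have "prob (pattern_event T U - pattern_event (Set.insert e T) U)
      = prob (pattern_event T U) - prob (pattern_event (Set.insert e T) U)"
    using 1 2 by (intro finite_measure_Diff) (auto simp: pattern_event_def)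
  also have "\<dots> = p ^ card T * (1 - p) ^ card (Set.insert e U)"
    using 1 2 insert by (simp add: algebra_simps)
  finally show ?case using 1 2 unfolding diff by auto
qed

text \<open>A predicate of the observed lower part is a finite disjoint union of exact patterns;
  this yields measurability for arbitrary \<open>G\<close> together with the probability.\<close>

lemma lower_part_prob:
  "{\<omega> \<in> space P. G (fst \<omega> \<inter> lower_pairs d)} \<in> events \<and>
   prob {\<omega> \<in> space P. G (fst \<omega> \<inter> lower_pairs d)} = subset_prob (lower_pairs d) p G"
proof -
  define E where "E = lower_pairs d"
  define X where "X T = pattern_event T (E - T)" for T
  have X: "X T \<in> events \<and> prob (X T) = subset_weight E p T" if "T \<subseteq> E" for T
    unfolding X_def subset_weight_def using that finite_lower_pairs[of d]
    by (intro pattern_event_prob) (auto simp: E_def intro: finite_subset)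
  have eq: "{\<omega> \<in> space P. G (fst \<omega> \<inter> E)} = (\<Union>T\<in>{T \<in> Pow E. G T}. X T)"
  proof (rule Set.set_eqI)
    fix \<omega>
    have "\<omega> \<in> X T \<longleftrightarrow> \<omega> \<in> space P \<and> fst \<omega> \<inter> E = T" if "T \<subseteq> E" for T
      using that by (auto simp: X_def pattern_event_def)
    then show "\<omega> \<in> {\<omega> \<in> space P. G (fst \<omega> \<inter> E)} \<longleftrightarrow> \<omega> \<in> (\<Union>T\<in>{T \<in> Pow E. G T}. X T)" by auto
  qed
  have fin: "finite {T \<in> Pow E. G T}" using finite_lower_pairs[of d] by (simp add: E_def)
  have "disjoint_family_on X {T \<in> Pow E. G T}"
    unfolding disjoint_family_on_def X_def pattern_event_def by blast
  then have "prob (\<Union>T\<in>{T \<in> Pow E. G T}. X T) = (\<Sum>T\<in>{T \<in> Pow E. G T}. prob (X T))"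
    using X fin by (intro finite_measure_finite_Union) auto
  also have "\<dots> = (\<Sum>T\<in>{T \<in> Pow E. G T}. subset_weight E p T)" using X by (intro sum.cong) auto
  also have "\<dots> = (\<Sum>T\<in>Pow E. subset_weight E p T * (if G T then 1 else 0))"
    by (rule sum.mono_neutral_cong_left) (use finite_lower_pairs[of d] in \<open>auto simp: E_def\<close>)
  finally have "prob {\<omega> \<in> space P. G (fst \<omega> \<inter> E)} = subset_prob E p G"
    unfolding eq by (simp add: subset_prob_def subset_expectation_def)
  moreover have "{\<omega> \<in> space P. G (fst \<omega> \<inter> E)} \<in> events"
    unfolding eq using X fin by (intro sets.finite_UN) auto
  ultimately show ?thesis unfolding E_def by simp
qed

end

section \<open>The iteration\<close>

text \<open>Equal Gram matrices of the rows mean that the two factors differ by an orthogonal matrix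
  on the right. Applying it to the deviation as well preserves the tangent and all row norms, so the
  third condition carries over; the others do not mention the factor.\<close>

lemma good_pattern_transfer:
  assumes s: "0 < s" and good: "good_pattern d r p s B a0 \<Omega>" and \<Omega>: "\<Omega> \<subseteq> {..<d} \<times> {..<d}"
    and orth: "\<And>k l. k < r \<Longrightarrow> l < r \<Longrightarrow> (\<Sum>i<d. a i k * a i l) = (if k = l then s else 0)"
    and same: "\<And>i j. i < d \<Longrightarrow> j < d \<Longrightarrow> ip {..<r} (a i) (a j) = ip {..<r} (a0 i) (a0 j)"
  shows "good_pattern d r p s B a \<Omega>"
  unfolding good_pattern_def
proof (intro conjI)
  show "\<forall>h. p * (\<Sum>i<d. \<Sum>j<d. (tangent r a h i j)\<^sup>2)
        - p * s / 2 * (\<Sum>i<d. ip {..<r} (h i) (h i))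
      \<le> (\<Sum>(i, j)\<in>\<Omega>. (tangent r a h i j)\<^sup>2)"
  proof
    fix h :: "nat \<Rightarrow> nat \<Rightarrow> real"
    \<comment> \<open>H0 = H A^T A0 / s, where A^T A0 / s is the orthogonal matrix relating the
      factors.\<close>
    define h0 where "h0 j k = (1 / s) * (\<Sum>i<d. ip {..<r} (a i) (h j) * a0 i k)" for j k
    have h0: "ip {..<r} u (h0 j) = (1 / s) * (\<Sum>i<d. ip {..<r} (a i) (h j) * ip {..<r} u (a0 i))" for u j
      unfolding h0_def ip_scale_right ip_sum_right ..
    have 1: "ip {..<r} (a0 i) (h0 j) = ip {..<r} (a i) (h j)" if "i < d" for i j
    proof -
      have "ip {..<r} (a0 i) (h0 j) = (1 / s) * (\<Sum>i'<d. ip {..<r} (a i') (a i) * ip {..<r} (a i') (h j))"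
        unfolding h0 using that same by (simp add: ip_commute[of _ "a i"] ip_commute[of _ "a0 i"] mult.commute)
      then show ?thesis using s by (simp add: sum_ip_orthogonal_columns[OF orth])
    qed
    have 2: "ip {..<r} (h0 j) (h0 j) = ip {..<r} (h j) (h j)" for j
    proof -
      have "ip {..<r} (h0 j) (h0 j) = (1 / s) * (\<Sum>i<d. ip {..<r} (a i) (h j) * ip {..<r} (a i) (h j))"
        unfolding h0[of "h0 j"] using 1 by (simp add: ip_commute[of _ "h0 j"])
      then show ?thesis using s by (simp add: sum_ip_orthogonal_columns[OF orth])
    qed
    have "p * (\<Sum>i<d. \<Sum>j<d. (tangent r a0 h0 i j)\<^sup>2)
        - p * s / 2 * (\<Sum>i<d. ip {..<r} (h0 i) (h0 i))
      \<le> (\<Sum>(i, j)\<in>\<Omega>. (tangent r a0 h0 i j)\<^sup>2)"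
      using good unfolding good_pattern_def by blast
    then show "p * (\<Sum>i<d. \<Sum>j<d. (tangent r a h i j)\<^sup>2)
        - p * s / 2 * (\<Sum>i<d. ip {..<r} (h i) (h i))
      \<le> (\<Sum>(i, j)\<in>\<Omega>. (tangent r a h i j)\<^sup>2)"
      unfolding sum_pattern[OF \<Omega>] by (simp add: 1 2)
  qed
qed (use good in \<open>auto simp: good_pattern_def\<close>)

text \<open>One fixed outcome and one initial matrix; all consequences of randomness are contained
  in \<open>good\<close>. The noise bound s / 1000 is \<epsilon>_n \<le> \<sigma> / 10 with its
  factor 100 cleared.\<close>

locale completion =
  fixes d r :: nat and p s \<mu> :: real and M Fstar E F0 :: "real mat" and \<Omega> :: "(nat \<times> nat) set"
  assumes M: "M \<in> carrier_mat d d" and M_sym: "transpose_mat M = M"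
    and d: "1 \<le> d" and r: "1 \<le> r" and p: "0 < p" and s: "0 < s"
    and Fstar: "Fstar \<in> factor_set d r M"
    and orth: "\<And>A k l. A \<in> factor_set d r M \<Longrightarrow> k < r \<Longrightarrow> l < r \<Longrightarrow>
      (\<Sum>i<d. A $$ (i, k) * A $$ (i, l)) = (if k = l then s else 0)"
    and rows: "\<And>i. i < d \<Longrightarrow> ip {..<r} (entries Fstar i) (entries Fstar i) \<le> \<mu> * real r * s / real d"
    and \<beta>: "1 \<le> \<mu> * real r"
    and \<Omega>: "\<Omega> \<subseteq> {..<d} \<times> {..<d}" "sym \<Omega>"
    and good: "good_pattern d r p s (75 * (\<mu> * real r * s / real d)) (entries Fstar) \<Omega>"
    and E: "E \<in> carrier_mat d d" "transpose_mat E = E"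
    and noise: "sqrt (real r) * op_norm (obs_proj \<Omega> E) / p \<le> s / 1000"
    and F0: "F0 \<in> carrier_mat d r" and init: "factor_dist d r M F0 \<le> sqrt s / 5"
begin

definition \<beta> :: real where "\<beta> = \<mu> * real r"
definition \<tau> :: real where "\<tau> = sqrt (2 * \<mu> / real d) * frob_norm F0"
definition \<eta> :: real where "\<eta> = 1 / 1000000 * (1 / (\<mu>\<^sup>2 * (real r)\<^sup>2 * s))"
text \<open>The noise level, with \<epsilon>_n = 100 \<omega> / \<sigma>.\<close>

definition \<omega> :: real where "\<omega> = sqrt (real r) * op_norm (obs_proj \<Omega> E) / p"

abbreviation dist :: "real mat \<Rightarrow> real" where "dist \<equiv> factor_dist d r M"

abbreviation iter :: "nat \<Rightarrow> real mat" where
  "iter \<equiv> pgd (feasible_set d r \<mu> F0) (loss p \<Omega> (M + E)) \<eta> F0"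

lemma \<beta>1: "1 \<le> \<beta>"
  using \<beta> by (simp add: \<beta>_def)

lemma \<mu>_pos: "0 < \<mu>"
proof -
  have "0 < \<mu> * real r" using \<beta> by linarith
  then show ?thesis using r by (simp add: zero_less_mult_iff)
qed

lemma \<eta>_eq: "\<eta> * (1000000 * (\<beta>\<^sup>2 * s)) = 1"
  using \<mu>_pos r s by (simp add: \<eta>_def \<beta>_def power_mult_distrib)

lemma factor_dist_le: "A \<in> factor_set d r M \<Longrightarrow> dist F \<le> frob_norm (F - A)"
  unfolding factor_dist_def by (rule cINF_lower) (auto intro!: bdd_belowI2 frob_norm_nonneg)

lemma factor_dist_nonneg: "0 \<le> dist F"
  unfolding factor_dist_def using Fstar by (intro cINF_greatest) (auto simp: frob_norm_nonneg)

lemma factor_same: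
  assumes "A \<in> factor_set d r M" "i < d" "j < d"
  shows "ip {..<r} (entries A i) (entries A j) = M $$ (i, j)"
  using assms unfolding factor_set_iff[OF M] ip_def by simp

lemma factor_frob: "A \<in> factor_set d r M \<Longrightarrow> (frob_norm A)\<^sup>2 = real r * s"
proof -
  assume A: "A \<in> factor_set d r M"
  then have Ac: "A \<in> carrier_mat d r" by (simp add: factor_set_def)
  have "(frob_norm A)\<^sup>2 = (\<Sum>i<d. \<Sum>k<r. (A $$ (i, k))\<^sup>2)" by (rule frob_norm_sq[OF Ac])
  also have "\<dots> = (\<Sum>k<r. \<Sum>i<d. A $$ (i, k) * A $$ (i, k))"
    unfolding power2_eq_square by (rule sum.swap)
  also have "\<dots> = (\<Sum>k<r. s)" by (intro sum.cong) (auto simp: orth[OF A])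
  finally show ?thesis by simp
qed

lemma frob_triangle:
  assumes "X \<in> carrier_mat d r" "Y \<in> carrier_mat d r"
  shows "frob_norm X \<le> frob_norm (X - Y) + frob_norm Y"
proof -
  define I where "I = {..<d} \<times> {..<r}"
  have nm: "frob_norm Z = nm I (\<lambda>e. Z $$ e)" if "Z \<in> carrier_mat d r" for Z
    using that by (simp add: frob_norm_def nm_def ip_def I_def sum.cartesian_product power2_eq_square case_prod_unfold)
  have "nm I (\<lambda>e. (X - Y) $$ e) = nm I (\<lambda>e. X $$ e - Y $$ e)"
    using assms by (auto simp: nm_def ip_def I_def intro!: sum.cong)
  then show ?thesis
    using nm[OF assms(1)] nm[OF assms(2)] nm[OF minus_carrier_mat[OF assms(2), of X]]
      nm_le_plus[of I "\<lambda>e. X $$ e" "\<lambda>e. Y $$ e"] by simp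
qed

lemma frob_minus_commute:
  assumes "X \<in> carrier_mat d r" "Y \<in> carrier_mat d r"
  shows "frob_norm (X - Y) = frob_norm (Y - X)"
proof (rule power2_eq_imp_eq)
  show "(frob_norm (X - Y))\<^sup>2 = (frob_norm (Y - X))\<^sup>2"
    using assms by (simp add: frob_norm_diff_sq power2_commute)
qed (auto simp: frob_norm_nonneg)

lemma sqrt_rs: "sqrt s / 5 \<le> sqrt (real r * s) / 5"
proof -
  have "1 * s \<le> real r * s" using r s by (intro mult_right_mono) auto
  then show ?thesis by simp
qed

lemma frob_norm_near:
  assumes F: "F \<in> carrier_mat d r" and near: "dist F \<le> sqrt s / 5"
  shows "frob_norm F \<le> 6/5 * sqrt (real r * s)" "4/5 * sqrt (real r * s) \<le> frob_norm F"
proof -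
  obtain A where A: "A \<in> factor_set d r M" "dist F = frob_norm (F - A)"
    using factor_dist_attained[OF M F] Fstar by blast
  have Ac: "A \<in> carrier_mat d r" using A by (simp add: factor_set_def)
  have "frob_norm A = sqrt (real r * s)"
    using factor_frob[OF A(1)] frob_norm_nonneg[of A] by (metis real_sqrt_unique)
  then show "frob_norm F \<le> 6/5 * sqrt (real r * s)" "4/5 * sqrt (real r * s) \<le> frob_norm F"
    using frob_triangle[OF F Ac] frob_triangle[OF Ac F] frob_minus_commute[OF F Ac] A(2) near sqrt_rs
    by linarith+
qed

text \<open>The initial matrix lies within \<sigma> / 5 of a factor of norm sqrt (r s), so its norm
  is between 4/5 and 6/5 of that. The second inequality puts the rows of every factor into the
  feasible set; the first keeps the feasible rows short.\<close>

lemma radius_bounds: "real d * \<tau>\<^sup>2 \<le> 3 * \<beta> * s" "\<beta> * s / real d \<le> \<tau>\<^sup>2"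
proof -
  have \<tau>2: "real d * \<tau>\<^sup>2 = 2 * \<mu> * (frob_norm F0)\<^sup>2"
    using \<mu>_pos d by (simp add: \<tau>_def power_mult_distrib)
  have "(frob_norm F0)\<^sup>2 \<le> (6/5 * sqrt (real r * s))\<^sup>2"
    by (intro power_mono frob_norm_near F0 init frob_norm_nonneg)
  then have u: "(frob_norm F0)\<^sup>2 \<le> 36/25 * (real r * s)" using s by (simp add: power_mult_distrib power_divide)
  have "(4/5 * sqrt (real r * s))\<^sup>2 \<le> (frob_norm F0)\<^sup>2"
    using s by (intro power_mono frob_norm_near F0 init) auto
  then have l: "16/25 * (real r * s) \<le> (frob_norm F0)\<^sup>2" using s by (simp add: power_mult_distrib power_divide)
  have "2 * \<mu> * (frob_norm F0)\<^sup>2 \<le> 2 * \<mu> * (36/25 * (real r * s))"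
    using u \<mu>_pos by (intro mult_left_mono) auto
  also have "\<dots> = 72/25 * (\<beta> * s)" by (simp add: \<beta>_def)
  also have "\<dots> \<le> 3 * \<beta> * s" using \<beta>1 s by simp
  finally show "real d * \<tau>\<^sup>2 \<le> 3 * \<beta> * s" using \<tau>2 by simp
  have "\<beta> * s \<le> 32/25 * (\<beta> * s)" using \<beta>1 s by simp
  also have "\<dots> = 2 * \<mu> * (16/25 * (real r * s))" by (simp add: \<beta>_def)
  also have "\<dots> \<le> 2 * \<mu> * (frob_norm F0)\<^sup>2" using l \<mu>_pos by (intro mult_left_mono) auto
  finally show "\<beta> * s / real d \<le> \<tau>\<^sup>2" unfolding \<tau>2[symmetric] using d by (simp add: divide_le_eq mult.commute)
qed

lemma \<tau>_pos: "0 < \<tau>"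
proof -
  have "0 < sqrt (real r * s)" using r s by simp
  then have "0 < frob_norm F0" using frob_norm_near(2)[OF F0 init] by linarith
  then show ?thesis using \<mu>_pos d by (simp add: \<tau>_def)
qed

lemma feasible: "feasible_set d r \<mu> F0 = {X \<in> carrier_mat d r. two_inf_norm X \<le> \<tau>}"
  by (simp add: feasible_set_def \<tau>_def)

lemma entry_sym:
  assumes "X \<in> carrier_mat d d" "transpose_mat X = X" "i < d" "j < d"
  shows "X $$ (i, j) = X $$ (j, i)"
  using assms by (metis index_transpose_mat(1) carrier_matD)

text \<open>The factor nearest to the old iterate serves as competitor for the new one, so the
  contraction towards it bounds the new distance.\<close>

lemma step:
  assumes F: "F \<in> carrier_mat d r" and near: "dist F \<le> sqrt s / 5"
  defines "F1 \<equiv> frob_proj (feasible_set d r \<mu> F0) (F - \<eta> \<cdot>\<^sub>m gradient (loss p \<Omega> (M + E)) F)"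
  shows "F1 \<in> carrier_mat d r" "(dist F1)\<^sup>2 \<le> (1 - \<eta> * s / 2) * (dist F)\<^sup>2 + 29 * \<eta> * \<omega>\<^sup>2"
proof -
  define Z where "Z = F - \<eta> \<cdot>\<^sub>m gradient (loss p \<Omega> (M + E)) F"
  have grad_c: "gradient (loss p \<Omega> (M + E)) F \<in> carrier_mat d r" using F by (simp add: gradient_def)
  then have Z: "Z \<in> carrier_mat d r" unfolding Z_def by (intro minus_carrier_mat smult_carrier_mat)
  have F1: "F1 = Matrix.mat d r (\<lambda>(i, k). proj_row {..<r} \<tau> (entries Z i) k)"
    unfolding F1_def feasible Z_def[symmetric] by (rule frob_proj_rows[OF Z _ d]) (use \<tau>_pos in simp)
  then show F1c: "F1 \<in> carrier_mat d r" by simp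
  obtain A where A: "A \<in> factor_set d r M" "dist F = frob_norm (F - A)"
    and min: "\<And>A'. A' \<in> factor_set d r M \<Longrightarrow> frob_norm (F - A) \<le> frob_norm (F - A')"
    using factor_dist_attained[OF M F] Fstar by blast
  have Ac: "A \<in> carrier_mat d r" using A by (simp add: factor_set_def)
  have sq: "(frob_norm (X - A))\<^sup>2 = (\<Sum>i<d. ip {..<r} (\<lambda>k. X $$ (i, k) - A $$ (i, k)) (\<lambda>k. X $$ (i, k) - A $$ (i, k)))"
    if "X \<in> carrier_mat d r" for X
    unfolding frob_norm_diff_sq[OF Ac that] by (simp add: ip_def power2_eq_square)
  define W where "W = obs_proj \<Omega> E"
  have Wc: "W \<in> carrier_mat d d" using E by (simp add: W_def obs_proj_def)
  define n where "n j k = 2 / p * (\<Sum>i<d. W $$ (j, i) * F $$ (i, k))" for j k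
  \<comment> \<open>The noise part of the gradient is 2 / p times the product of the masked noise
    with \<open>F\<close>, and |F|^2 is at most 36/25 r s; 4 * 36/25 = 144/25.\<close>
  define \<nu> where "\<nu> = 144/25 * (\<omega>\<^sup>2 * s)"
  have zn: "Z $$ (j, k) = F $$ (j, k) - \<eta> * (2 / p * (\<Sum>i<d. of_bool ((i, j) \<in> \<Omega>) *
      (ip {..<r} (entries F i) (entries F j) - ip {..<r} (entries A i) (entries A j)) * F $$ (i, k)) - n j k)"
    if jk: "j < d" "k < r" for j k
  proof -
    have Y: "(M + E) $$ (i, j) = (M + E) $$ (j, i)" if "i < d" "j < d" for i j
      using that M E entry_sym[OF M M_sym that] entry_sym[OF E that] by simp
    have "gradient (loss p \<Omega> (M + E)) F $$ (j, k) = 2 / p * (\<Sum>i<d. of_bool ((i, j) \<in> \<Omega>) *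
        (ip {..<r} (entries F i) (entries F j) - (M + E) $$ (i, j)) * F $$ (i, k))"
      by (rule gradient_loss[OF F \<Omega> Y p jk])
    also have "(\<Sum>i<d. of_bool ((i, j) \<in> \<Omega>) * (ip {..<r} (entries F i) (entries F j) - (M + E) $$ (i, j)) * F $$ (i, k))
        = (\<Sum>i<d. of_bool ((i, j) \<in> \<Omega>) *
          (ip {..<r} (entries F i) (entries F j) - ip {..<r} (entries A i) (entries A j)) * F $$ (i, k)
          - W $$ (j, i) * F $$ (i, k))"
    proof (intro sum.cong refl)
      fix i assume "i \<in> {..<d}"
      then have i: "i < d" by simp
      have "W $$ (j, i) = of_bool ((i, j) \<in> \<Omega>) * E $$ (i, j)"
        using E i jk entry_sym[OF E i jk(1)] \<Omega>(2) by (auto simp: W_def obs_proj_def sym_def)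
      then show "of_bool ((i, j) \<in> \<Omega>) * (ip {..<r} (entries F i) (entries F j) - (M + E) $$ (i, j)) * F $$ (i, k)
        = of_bool ((i, j) \<in> \<Omega>) * (ip {..<r} (entries F i) (entries F j) - ip {..<r} (entries A i) (entries A j)) * F $$ (i, k)
          - W $$ (j, i) * F $$ (i, k)"
        using M E i jk factor_same[OF A(1) i jk(1)] by (simp add: algebra_simps)
    qed
    finally show ?thesis
      unfolding Z_def n_def using F grad_c jk by (simp add: sum_subtractf right_diff_distrib)
  qed
  have step: "descent_step d r p s \<beta> \<tau> \<eta> \<nu> (75 * (\<mu> * real r * s / real d)) \<Omega> (entries A) (entries F) n (entries F1)"
  proof
    show "0 < p" "0 < s" "1 \<le> \<beta>" "0 < \<tau>" "\<Omega> \<subseteq> {..<d} \<times> {..<d}" "sym \<Omega>"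
      by (fact p s \<beta>1 \<tau>_pos \<Omega>)+
    show "real d * \<tau>\<^sup>2 \<le> 3 * \<beta> * s" by (fact radius_bounds)
    show "(\<Sum>i<d. entries A i k * entries A i l) = (if k = l then s else 0)" if "k < r" "l < r" for k l
      by (rule orth[OF A(1) that])
    show "ip {..<r} (entries A i) (entries A i) \<le> \<tau>\<^sup>2" if "i < d" for i
      using rows[OF that] factor_same[OF A(1) that that] factor_same[OF Fstar that that] radius_bounds(2)
      by (simp add: \<beta>_def)
    show "good_pattern d r p s (75 * (\<mu> * real r * s / real d)) (entries A) \<Omega>"
    proof (rule good_pattern_transfer[OF s good \<Omega>(1) orth[OF A(1)]])
      fix i j assume "i < d" "j < d"
      then show "ip {..<r} (entries A i) (entries A j) = ip {..<r} (entries Fstar i) (entries Fstar j)"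
        using factor_same A(1) Fstar by simp
    qed
    show "25 * \<tau>\<^sup>2 \<le> 75 * (\<mu> * real r * s / real d)"
      using radius_bounds(1) d by (simp add: \<beta>_def field_simps)
    show "(\<Sum>i<d. ip {..<r} (\<lambda>k. entries F i k - entries A i k) (\<lambda>k. entries F i k - entries A i k)) \<le> s / 25"
    proof -
      have "(frob_norm (F - A))\<^sup>2 \<le> (sqrt s / 5)\<^sup>2"
        using near A(2) frob_norm_nonneg[of "F - A"] by (intro power_mono) auto
      then show ?thesis unfolding sq[OF F] using s by (simp add: power_divide)
    qed
    show "(\<Sum>i<d. entries A i k * (entries F i l - entries A i l)) = (\<Sum>i<d. entries A i l * (entries F i k - entries A i k))"
      if kl: "k < r" "l < r" for k l
      using nearest_factor_aligned[OF M F A(1) min orth[OF A(1)] kl]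
      by (simp add: right_diff_distrib sum_subtractf mult.commute)
    show "\<eta> * (1000000 * (\<beta>\<^sup>2 * s)) = 1" by (rule \<eta>_eq)
    show "(\<Sum>j<d. ip {..<r} (n j) (n j)) \<le> \<nu>"
    proof -
      have "(\<Sum>j<d. ip {..<r} (n j) (n j)) = 4 / p\<^sup>2 * (\<Sum>j<d. \<Sum>k<r. (\<Sum>i<d. W $$ (j, i) * F $$ (i, k))\<^sup>2)"
      proof -
        have "n j k * n j k = 4 / p\<^sup>2 * (\<Sum>i<d. W $$ (j, i) * F $$ (i, k))\<^sup>2" for j k
          by (simp add: n_def power2_eq_square)
        then show ?thesis by (simp only: ip_def sum_distrib_left)
      qed
      also have "\<dots> \<le> 4 / p\<^sup>2 * ((op_norm W)\<^sup>2 * (\<Sum>i<d. \<Sum>k<r. (F $$ (i, k))\<^sup>2))"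
        by (intro mult_left_mono op_norm_mult_frob_le[OF Wc]) auto
      also have "\<dots> \<le> 4 / p\<^sup>2 * ((op_norm W)\<^sup>2 * (6/5 * sqrt (real r * s))\<^sup>2)"
        unfolding frob_norm_sq[OF F, symmetric]
        by (intro mult_left_mono power_mono frob_norm_near F near frob_norm_nonneg) auto
      also have "\<dots> = \<nu>"
        using s by (simp add: \<nu>_def \<omega>_def W_def power_mult_distrib power_divide mult_ac)
      finally show ?thesis .
    qed
    show "ip {..<r} (entries F1 j) (entries F1 j) \<le> \<tau>\<^sup>2" if "j < d" for j
    proof -
      have "ip {..<r} (entries F1 j) (entries F1 j) = ip {..<r} (proj_row {..<r} \<tau> (entries Z j)) (proj_row {..<r} \<tau> (entries Z j))"
        using that by (simp add: F1 ip_def)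
      then show ?thesis using nm_proj_row[of \<tau> "{..<r}" "entries Z j"] nm_le_iff[of \<tau> "{..<r}" "proj_row {..<r} \<tau> (entries Z j)"] \<tau>_pos by simp
    qed
    show "ip {..<r}
      (\<lambda>k. entries F j k - \<eta> * (2 / p * (\<Sum>i<d. of_bool ((i, j) \<in> \<Omega>) *
          (ip {..<r} (entries F i) (entries F j) - ip {..<r} (entries A i) (entries A j)) * entries F i k) - n j k) - entries F1 j k)
      (\<lambda>k. entries A j k - entries F1 j k) \<le> 0" (is "?lhs \<le> 0") if j: "j < d" for j
    proof -
      have "ip {..<r} (entries A j) (entries A j) \<le> \<tau>\<^sup>2"
        using rows[OF j] factor_same[OF A(1) j j] factor_same[OF Fstar j j] radius_bounds(2) by (simp add: \<beta>_def)
      then have "nm {..<r} (entries A j) \<le> \<tau>"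
        using nm_le_iff[of \<tau> "{..<r}" "entries A j"] \<tau>_pos by simp
      then have "ip {..<r} (\<lambda>k. entries Z j k - proj_row {..<r} \<tau> (entries Z j) k)
          (\<lambda>k. entries A j k - proj_row {..<r} \<tau> (entries Z j) k) \<le> 0"
        using \<tau>_pos by (intro proj_row_obtuse) auto
      also have "ip {..<r} (\<lambda>k. entries Z j k - proj_row {..<r} \<tau> (entries Z j) k)
          (\<lambda>k. entries A j k - proj_row {..<r} \<tau> (entries Z j) k)
        = ?lhs"
        unfolding ip_def[of "{..<r}" "\<lambda>k. _ k - _ k"] by (intro sum.cong refl) (use j in \<open>simp add: zn F1\<close>)
      finally show ?thesis .
    qed
  qed
  have "(dist F1)\<^sup>2 \<le> (frob_norm (F1 - A))\<^sup>2"
    by (intro power_mono factor_dist_le A factor_dist_nonneg)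
  also have "\<dots> \<le> (1 - \<eta> * s / 2) * (frob_norm (F - A))\<^sup>2 + 5 * \<eta> * \<nu> / s"
    unfolding sq[OF F1c] sq[OF F] by (rule descent_step.contraction[OF step])
  also have "5 * \<eta> * \<nu> / s = 144/5 * (\<eta> * \<omega>\<^sup>2)" using s by (simp add: \<nu>_def)
  also have "\<dots> \<le> 29 * \<eta> * \<omega>\<^sup>2"
  proof -
    have "0 \<le> \<eta> * \<omega>\<^sup>2" using s by (simp add: \<eta>_def)
    then show ?thesis by simp
  qed
  finally show "(dist F1)\<^sup>2 \<le> (1 - \<eta> * s / 2) * (dist F)\<^sup>2 + 29 * \<eta> * \<omega>\<^sup>2" by (simp add: A(2))
qed

text \<open>The radius \<sigma> / 5 is carried along because each step presupposes it; it survives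
  since the error floor 58 \<omega>^2 / s is below s / 25. This floor is the fixed point of the
  recursion: 29 \<eta> \<omega>^2 divided by the rate \<eta> s / 2.\<close>

lemma iterate_bound:
  "iter t \<in> carrier_mat d r \<and> dist (iter t) \<le> sqrt s / 5 \<and>
   (dist (iter t))\<^sup>2 \<le> (1 - \<eta> * s / 2) ^ t * (dist F0)\<^sup>2 + 58 * (\<omega>\<^sup>2 / s)"
proof (induction t)
  case 0
  then show ?case using F0 init s by simp
next
  case (Suc t)
  define q where "q = \<eta> * s / 2"
  have "1000000 * (\<beta>\<^sup>2 * (\<eta> * s)) = 1" using \<eta>_eq by (simp add: mult_ac)
  moreover have "0 \<le> \<eta> * s" using s by (simp add: \<eta>_def)
  moreover have "1 * (\<eta> * s) \<le> \<beta>\<^sup>2 * (\<eta> * s)"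
    using \<beta>1 \<open>0 \<le> \<eta> * s\<close> by (intro mult_right_mono) auto
  ultimately have "\<eta> * s \<le> 1 / 1000000" by linarith
  then have q: "0 \<le> q" "q \<le> 1" using \<open>0 \<le> \<eta> * s\<close> by (auto simp: q_def)
  have K: "29 * \<eta> * \<omega>\<^sup>2 = q * (58 * (\<omega>\<^sup>2 / s))" using s by (simp add: q_def)
  have "0 \<le> \<omega>" using p by (simp add: \<omega>_def op_norm_nonneg)
  then have "\<omega>\<^sup>2 \<le> (s / 1000)\<^sup>2" using noise by (intro power_mono) (auto simp: \<omega>_def)
  then have "\<omega>\<^sup>2 / s \<le> s / 1000000" using s by (simp add: power2_eq_square divide_le_eq)
  then have "58 * (\<omega>\<^sup>2 / s) \<le> s / 25" using s by linarith
  then have Ks: "q * (58 * (\<omega>\<^sup>2 / s)) \<le> q * (s / 25)" using q by (intro mult_left_mono) auto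
  have iter_Suc: "iter (Suc t) = frob_proj (feasible_set d r \<mu> F0) (iter t - \<eta> \<cdot>\<^sub>m gradient (loss p \<Omega> (M + E)) (iter t))"
    by simp
  have c: "iter (Suc t) \<in> carrier_mat d r"
    unfolding iter_Suc by (rule step(1)) (use Suc in blast)+
  have le: "(dist (iter (Suc t)))\<^sup>2 \<le> (1 - q) * (dist (iter t))\<^sup>2 + q * (58 * (\<omega>\<^sup>2 / s))"
  proof -
    have "(dist (iter (Suc t)))\<^sup>2 \<le> (1 - \<eta> * s / 2) * (dist (iter t))\<^sup>2 + 29 * \<eta> * \<omega>\<^sup>2"
      unfolding iter_Suc by (rule step(2)) (use Suc in blast)+
    then show ?thesis unfolding K unfolding q_def .
  qed
  have "(dist (iter t))\<^sup>2 \<le> (sqrt s / 5)\<^sup>2" using Suc by (intro power_mono factor_dist_nonneg) auto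
  then have "(1 - q) * (dist (iter t))\<^sup>2 \<le> (1 - q) * (s / 25)"
    using q s by (intro mult_left_mono) (auto simp: power_divide)
  then have "(dist (iter (Suc t)))\<^sup>2 \<le> (1 - q) * (s / 25) + q * (s / 25)" using le Ks by linarith
  also have "\<dots> = s / 25" unfolding distrib_right[symmetric] by simp
  finally have "(dist (iter (Suc t)))\<^sup>2 \<le> (sqrt s / 5)\<^sup>2" using s by (simp add: power_divide)
  then have near: "dist (iter (Suc t)) \<le> sqrt s / 5" by (rule power2_le_imp_le) (use s in simp)
  have "(1 - q) * (dist (iter t))\<^sup>2 \<le> (1 - q) * ((1 - q) ^ t * (dist F0)\<^sup>2 + 58 * (\<omega>\<^sup>2 / s))"
    using Suc q by (intro mult_left_mono) (auto simp: q_def)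
  then have "(dist (iter (Suc t)))\<^sup>2 \<le> (1 - q) * ((1 - q) ^ t * (dist F0)\<^sup>2 + 58 * (\<omega>\<^sup>2 / s)) + q * (58 * (\<omega>\<^sup>2 / s))"
    using le by linarith
  also have "\<dots> = (1 - q) ^ Suc t * (dist F0)\<^sup>2 + 58 * (\<omega>\<^sup>2 / s)"
  proof -
    have "(1 - q) * (x + y) + q * y = (1 - q) * x + y" for x y by (simp add: algebra_simps)
    then show ?thesis by (simp only: power_Suc mult.assoc)
  qed
  finally have "(dist (iter (Suc t)))\<^sup>2 \<le> (1 - q) ^ Suc t * (dist F0)\<^sup>2 + 58 * (\<omega>\<^sup>2 / s)" .
  then show ?case using c near unfolding q_def by blast
qed

end

theorem corollary1:
  shows "\<exists>c1>0. \<exists>c3>0. \<exists>c4>0. \<exists>c5>0.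
    \<forall>(d::nat) (r::nat) (p::real) (Mstar::real mat) (Fstar::real mat)
     (P::((nat \<times> nat) set \<times> real mat) measure) (\<mu>::real).
      1 \<le> r \<longrightarrow> 0 < p \<longrightarrow> p \<le> 1 \<longrightarrow>
      pos_semidef d Mstar \<longrightarrow>
      vec_space.rank d Mstar = r \<longrightarrow>
      (\<forall>k l. eigenvalue Mstar k \<and> k \<noteq> 0 \<and> eigenvalue Mstar l \<and> l \<noteq> 0 \<longrightarrow> k = l) \<longrightarrow>
      Fstar \<in> factor_set d r Mstar \<longrightarrow>
      \<mu> = incoherence Fstar \<longrightarrow>
      symmetric_bernoulli_model P d p \<longrightarrow>
      p * (real d)\<^sup>2 \<ge> c1 * max (\<mu> * real r * real d * ln (real d)) (\<mu>\<^sup>2 * (real r)\<^sup>2 * real d) \<longrightarrow>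
      (\<exists>A\<in>sets P. measure P A \<ge> 1 - 4 / real d ^ 3 \<and>
        (\<forall>(\<Omega>, E)\<in>A.
          100 * (sqrt (real r) * op_norm (obs_proj \<Omega> E) / (p * op_norm Fstar))
            \<le> 1 / 10 * op_norm Fstar \<longrightarrow>
          (\<forall>F0\<in>carrier_mat d r.
            factor_dist d r Mstar F0 \<le> 1 / 5 * op_norm Fstar \<longrightarrow>
            (let F = pgd (feasible_set d r \<mu> F0) (loss p \<Omega> (Mstar + E))
                       (c3 * (1 / (\<mu>\<^sup>2 * (real r)\<^sup>2 * (op_norm Fstar)\<^sup>2))) F0
             in \<forall>t\<ge>1. (factor_dist d r Mstar (F t))\<^sup>2
                  \<le> (1 - c4 * (1 / (\<mu>\<^sup>2 * (real r)\<^sup>2))) ^ t * (factor_dist d r Mstar F0)\<^sup>2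
                    + c5 * (real r * (op_norm (obs_proj \<Omega> E))\<^sup>2 / (p\<^sup>2 * (op_norm Fstar)\<^sup>2))))))"
\<comment> \<open>The witness for c4 is half of that for c3, as the rate is \<eta> s / 2; 58 is the
  error floor of the recursion.\<close>
proof (rule exI[of _ 1000000], rule conjI, simp, rule exI[of _ "1 / 1000000"], rule conjI, simp,
    rule exI[of _ "1 / 2000000"], rule conjI, simp, rule exI[of _ 58], rule conjI, simp, intro allI impI, goal_cases)
  case (1 d r p M Fstar P \<mu>)
  note r = 1(1) and p = 1(2,3) and psd = 1(4) and rank = 1(5) and eig = 1(6) and Fstar = 1(7) and \<mu> = 1(8)
    and model = 1(9) and size = 1(10)
  interpret symmetric_bernoulli_model P d p by (rule model)
  have M: "M \<in> carrier_mat d d" "transpose_mat M = M" using psd by (auto simp: pos_semidef_def)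
  have Fc: "Fstar \<in> carrier_mat d r" using Fstar by (simp add: factor_set_def)
  obtain s where s: "0 < s" and orth: "\<And>A k l. A \<in> factor_set d r M \<Longrightarrow> k < r \<Longrightarrow> l < r \<Longrightarrow>
      (\<Sum>i<d. A $$ (i, k) * A $$ (i, l)) = (if k = l then s else 0)"
    using factor_columns[OF M(1) rank r eig] Fstar by blast
  have op: "op_norm Fstar = sqrt s"
    by (rule op_norm_orthogonal_columns[OF Fc r _ orth[OF Fstar]]) (use s in simp)
  have d: "1 \<le> d"
    using orth[OF Fstar, of 0 0] r s by (cases d) auto
  define \<beta> where "\<beta> = \<mu> * real r"
  define m where "m = two_inf_norm Fstar"
  have "\<mu> = real d * m\<^sup>2 / (real r * s)"
    using Fc s by (simp add: \<mu> incoherence_def op m_def)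
  then have \<beta>_eq: "\<beta> = real d * m\<^sup>2 / s" using r by (simp add: \<beta>_def)
  have rows_m: "ip {..<r} (entries Fstar i) (entries Fstar i) \<le> m\<^sup>2" if "i < d" for i
  proof -
    have "nm {..<r} (entries Fstar i) \<le> m"
      using two_inf_norm_le_iff[OF Fc d, of m] that by (simp add: m_def)
    then have "(nm {..<r} (entries Fstar i))\<^sup>2 \<le> m\<^sup>2" by (intro power_mono nm_nonneg)
    then show ?thesis by (simp add: nm_sq)
  qed
  have rows: "ip {..<r} (entries Fstar i) (entries Fstar i) \<le> \<beta> * s / real d" if "i < d" for i
    using rows_m[OF that] s d by (simp add: \<beta>_eq)
  \<comment> \<open>The average squared row norm is at most the largest one, that is, \<mu> \<ge>
    1.\<close>
  have r\<beta>: "real r \<le> \<beta>"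
  proof -
    have "real r * s = (\<Sum>k<r. \<Sum>i<d. Fstar $$ (i, k) * Fstar $$ (i, k))"
      by (simp add: orth[OF Fstar])
    also have "\<dots> = (\<Sum>i<d. ip {..<r} (entries Fstar i) (entries Fstar i))"
      unfolding ip_def by (rule sum.swap)
    also have "\<dots> \<le> (\<Sum>i<d. m\<^sup>2)" by (intro sum_mono rows_m) auto
    finally show ?thesis using s by (simp add: \<beta>_eq pos_le_divide_eq)
  qed
  have \<beta>1: "1 \<le> \<beta>" using r r\<beta> by linarith
  have size_ln: "1000000 * (\<beta> * ln (real d)) \<le> p * real d" and size_sq: "1000000 * \<beta>\<^sup>2 \<le> p * real d"
  proof -
    have "(1000000 * (\<beta> * ln (real d))) * real d \<le> (p * real d) * real d"
      "(1000000 * \<beta>\<^sup>2) * real d \<le> (p * real d) * real d"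
      using size by (auto simp: \<beta>_def power_mult_distrib power2_eq_square mult_ac max_def split: if_splits)
    then show "1000000 * (\<beta> * ln (real d)) \<le> p * real d" "1000000 * \<beta>\<^sup>2 \<le> p * real d"
      using d by (auto dest!: mult_right_le_imp_le)
  qed
  have "\<beta> * 1 \<le> \<beta> * \<beta>" using \<beta>1 by (intro mult_left_mono) auto
  then have size_\<beta>: "1000000 * \<beta> \<le> p * real d" using size_sq by (simp add: power2_eq_square)
  have "p * real d \<le> 1 * real d" using p by (intro mult_right_mono) auto
  then have rd: "r \<le> d" using r\<beta> size_\<beta> \<beta>1 by linarith
  define G where "G T \<longleftrightarrow> good_pattern d r p s (75 * (\<beta> * s / real d)) (entries Fstar) (sym_cl T)" for T
  \<comment> \<open>The event depends on the observed lower part alone; noise, initial matrix and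
    iteration number are chosen afterwards.\<close>
  define A where "A = {\<omega> \<in> space P. G (fst \<omega> \<inter> lower_pairs d)}"
  have "subset_prob (lower_pairs d) p (\<lambda>T. \<not> G T) \<le> 4 / real d ^ 3"
    unfolding G_def
    by (rule good_pattern_prob[OF p rd s \<beta>1 orth[OF Fstar] rows]) (use size_\<beta> \<beta>1 size_ln in auto)
  then have prob_A: "1 - 4 / real d ^ 3 \<le> measure P A"
    unfolding A_def using lower_part_prob[of G] by (simp add: subset_prob_not finite_lower_pairs)
  have A: "A \<in> sets P" unfolding A_def using lower_part_prob[of G] by blast
  show ?case
    unfolding Let_def
  proof (intro bexI[OF _ A] conjI prob_A, clarify, goal_cases)
    case (1 \<Omega> E F0 t)
    note noise_small = 1(2) and F0 = 1(3) and init = 1(4)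
    have sp: "(\<Omega>, E) \<in> space P" and "G (\<Omega> \<inter> lower_pairs d)" using 1(1) by (auto simp: A_def)
    have \<Omega>: "\<Omega> \<subseteq> {..<d} \<times> {..<d}" "sym \<Omega>" using positions[OF sp] by auto
    have E: "E \<in> carrier_mat d d" "transpose_mat E = E" using noise[OF sp] by auto
    have good: "good_pattern d r p s (75 * (\<beta> * s / real d)) (entries Fstar) \<Omega>"
      using \<open>G (\<Omega> \<inter> lower_pairs d)\<close> by (simp add: G_def sym_cl_lower_part[OF \<Omega>])
    have noise_le: "sqrt (real r) * op_norm (obs_proj \<Omega> E) / p \<le> s / 1000"
    proof -
      define x where "x = sqrt (real r) * op_norm (obs_proj \<Omega> E) / p"
      have "100 * (x / sqrt s) \<le> 1 / 10 * sqrt s" using noise_small by (simp add: op x_def)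
      then have "100 * (x / sqrt s) * sqrt s \<le> 1 / 10 * sqrt s * sqrt s"
        using s by (intro mult_right_mono) auto
      then show ?thesis using s by (simp add: x_def[symmetric])
    qed
    interpret completion d r p s \<mu> M Fstar E F0 \<Omega>
      by unfold_locales (use M d r p s Fstar orth rows[unfolded \<beta>_def] \<beta>1[unfolded \<beta>_def] \<Omega> good[unfolded \<beta>_def] E noise_le F0 init op in auto)
    have op2: "(op_norm Fstar)\<^sup>2 = s" using s by (simp add: op)
    have e1: "1 / 1000000 * (1 / (\<mu>\<^sup>2 * (real r)\<^sup>2 * (op_norm Fstar)\<^sup>2)) = \<eta>"
      unfolding op2 \<eta>_def ..
    have e2: "1 - 1 / 2000000 * (1 / (\<mu>\<^sup>2 * (real r)\<^sup>2)) = 1 - \<eta> * s / 2"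
      using s by (simp add: \<eta>_def)
    have e3: "real r * (op_norm (obs_proj \<Omega> E))\<^sup>2 / (p\<^sup>2 * (op_norm Fstar)\<^sup>2) = \<omega>\<^sup>2 / s"
      unfolding op2 by (simp add: \<omega>_def power_mult_distrib power_divide)
    show ?case
      unfolding e1 e2 e3 using iterate_bound[of t] by blast
  qed
qed

end
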